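(* Let $\mathcal M(R,F)$ be a BMW-type quantum matrix algebra with parameters $q,\mu$. (i) If $j_q\ne0$ and $\mu\ne-q^{-2j+3}$ for all $j=2,\dots,n$ (so that $a_0,\dots,a_n$ are defined), then $$\sum_{i=0}^{n-1}(-q)^i a_i\,p_{n-i}=(-1)^{n-1}n_q\,a_n+(-1)^n\sum_{i=1}^{[n/2]}\big(\mu q^{n-2i}-q^{1-n+2i}\big)a_{n-2i}\,g^i .$$ (ii) If $j_q\ne0$ and $\mu\ne q^{2j-3}$ for all $j=2,\dots,n$ (so that $s_0,\dots,s_n$ are defined), then $$\sum_{i=0}^{n-1}q^{-i}s_i\,p_{n-i}=n_q\,s_n+\sum_{i=1}^{[n/2]}\big(\mu q^{2i-n}+q^{n-2i-1}\big)s_{n-2i}\,g^i .$$ (iii) If both sets $\{a_i\}_{i=0}^n$ and $\{s_i\}_{i=0}^n$ are defined, then $$\sum_{i=0}^n(-1)^i a_i\,s_{n-i}=\delta_{n,0}-\delta_{n,2}\,g,$$ where $\delta_{i,j}$ is the Kronecker symbol.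
   Context: Operators. $V$ is a complex vector space of finite dimension $N$ with a fixed basis (operators on $V^{\otimes n}$ are matrices), $I$ the identity, $P$ the flip on $V\otimes V$. For $X\in\mathrm{End}(V^{\otimes 2})$, $X_{mr}$ is $X$ acting in the tensor factors $m,r$ and trivially elsewhere, $X_m:=X_{m\,m+1}$; for an $N\times N$ matrix $Y$, $Y_m$ is $Y$ in factor $m$. $\mathrm{Tr}_{(i)}$ is the trace over the $i$-th factor. $X$ is skew invertible if there is $\Psi_X\in\mathrm{End}(V^{\otimes2})$ with $\mathrm{Tr}_{(2)}X_{12}(\Psi_X)_{23}=\mathrm{Tr}_{(2)}(\Psi_X)_{12}X_{23}=P_{13}$; then $C_X:=\mathrm{Tr}_{(1)}(\Psi_X)_{12}$, $D_X:=\mathrm{Tr}_{(2)}(\Psi_X)_{12}$, and $X$ is strict skew invertible if $C_X$ or $D_X$ is invertible. An R-matrix is an invertible $R\in\mathrm{End}(V^{\otimes 2})$ with $R_1R_2R_1=R_2R_1R_2$; it gives representations $\rho_R$ of the braid groups $\mathcal B_n$ (generators $\sigma_1,\dots,\sigma_{n-1}$) and of $\mathbb C\mathcal B_n$ on $V^{\otimes n}$, $\sigma_i\mapsto R_i$. A pair $\{R,F\}$ is compatible if $R_1F_2F_1=F_2F_1R_2$ and $R_2F_1F_2=F_1F_2R_1$. For skew invertible $R$ the R-trace over spaces $i_1,\dots,i_s$ is $\mathrm{Tr}_{R(i_1,\dots,i_s)}X:=\mathrm{Tr}_{(i_1,\dots,i_s)}\big((D_R)_{i_1}\cdots(D_R)_{i_s}X\big)$.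 BMW-type. Let $q\in\mathbb C\setminus\{0,\pm1\}$, $\mu\in\mathbb C\setminus\{0,q,-q^{-1}\}$, $i_q:=(q^i-q^{-i})/(q-q^{-1})$, $\eta:=\frac{(q-\mu)(q^{-1}+\mu)}{\mu(q-q^{-1})}$. An R-matrix $R$ is of BMW-type if its minimal polynomial relation is $(qI-R)(q^{-1}I+R)(\mu I-R)=0$ and $K:=\mu^{-1}(q-q^{-1})^{-1}(qI-R)(q^{-1}I+R)$ satisfies $K_2K_1=R_1^{\pm1}R_2^{\pm1}K_1$ and $K_1K_2K_1=K_1$. Put $\kappa_i:=\frac{(q-\sigma_i)(q^{-1}+\sigma_i)}{\mu(q-q^{-1})}$ and $$\sigma_i^-(x):=1+\tfrac{x-1}{q-q^{-1}}\sigma_i+\tfrac{x-1}{q\mu^{-1}x+1}\kappa_i,\qquad \sigma_i^+(x):=1+\tfrac{x-1}{q-q^{-1}}\sigma_i+\tfrac{x-1}{1-q^{-1}\mu^{-1}x}\kappa_i .$$ Antisymmetrizers and symmetrizers: $a^{(1)}=s^{(1)}:=1$, $a^{(i+1)}:=\frac{q^i}{(i+1)_q}a^{(i)}\sigma^-_i(q^{-2i})a^{(i)}$, $s^{(i+1)}:=\frac{q^{-i}}{(i+1)_q}s^{(i)}\sigma^+_i(q^{2i})s^{(i)}$. Quantum matrix algebra. Let $\{R,F\}$ be a compatible pair of strict skew invertible R-matrices. For an $N\times N$ matrix $M$ put $M_{\overline1}:=M_1$, $M_{\overline i}:=F_{i-1}M_{\overline{i-1}}F_{i-1}^{-1}$.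 $\mathcal M(R,F)$ is the unital associative $\mathbb C$-algebra generated by the entries $M_a^b$ of $M$ with relations $R_1M_{\overline1}M_{\overline2}=M_{\overline1}M_{\overline2}R_1$; it is of BMW-type if $R$ is. For $\alpha\in\mathbb C\mathcal B_n$ put $ch(\alpha):=\mathrm{Tr}_{R(1,\dots,n)}(M_{\overline1}\cdots M_{\overline n}\,\rho_R(\alpha))$; these elements and $1$ span a commutative subalgebra $\mathcal C(R,F)$ (the characteristic subalgebra). In it: $a_0=s_0:=1$, $a_i:=ch(a^{(i)})$, $s_i:=ch(s^{(i)})$ ($i\ge1$); $g:=\eta^{-1}ch(\kappa_1)$; power sums $p_1:=\mathrm{Tr}_RM$, $p_i:=ch(\sigma_{i-1}\cdots\sigma_2\sigma_1)$ ($i\ge2$). $[x]$ is the integer part. *)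

theory Defs
  imports
    "HOL-Analysis.Analysis"
    "HOL-Algebra.QuotRing"
    "HOL-Library.Poly_Mapping"
    "HOL-Computational_Algebra.Polynomial"
begin

section \<open>Free associative unital complex algebras\<close>

text \<open>The free algebra on \<open>'x\<close> is the monoid algebra of the words over \<open>'x\<close>; the library provides
  the convolution product on finitely supported functions over an additively written monoid.\<close>

datatype 'x word = Word (letters: "'x list")

instantiation word :: (type) monoid_add
begin

definition zero_word :: "'a word" where "zero_word = Word []"

definition plus_word :: "'a word \<Rightarrow> 'a word \<Rightarrow> 'a word" where
  "plus_word v w = Word (letters v @ letters w)"

instance
  by standard (simp_all add: zero_word_def plus_word_def)

end

type_synonym 'x free_algebra = "'x word \<Rightarrow>\<^sub>0 complex"

definition gen :: "'x \<Rightarrow> 'x free_algebra" where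
  "gen x = Poly_Mapping.single (Word [x]) 1"

definition scalar :: "complex \<Rightarrow> 'x free_algebra" where
  "scalar c = Poly_Mapping.single 0 c"

definition free_ring :: "'x free_algebra ring" where
  "free_ring = \<lparr>carrier = UNIV, monoid.mult = (*), one = 1, ring.zero = 0, add = (+)\<rparr>"

lemma ring_free_ring: "Ring.ring (free_ring :: 'x free_algebra ring)"
proof (rule ringI)
  show "abelian_group (free_ring :: 'x free_algebra ring)"
  proof (rule abelian_groupI)
    fix x :: "'x free_algebra"
    show "\<exists>y\<in>carrier free_ring. y \<oplus>\<^bsub>free_ring\<^esub> x = \<zero>\<^bsub>free_ring\<^esub>"
      by (rule bexI[of _ "- x"]) (simp_all add: free_ring_def)
  qed (simp_all add: free_ring_def algebra_simps)
  show "Group.monoid (free_ring :: 'x free_algebra ring)"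
    by (rule Group.monoidI) (simp_all add: free_ring_def algebra_simps)
qed (simp_all add: free_ring_def algebra_simps)


section \<open>Operators on tensor powers\<close>

text \<open>\<open>'v\<close> indexes the fixed basis of \<open>V\<close>, so \<open>N = CARD('v)\<close>, and lists of length \<open>n\<close> over \<open>'v\<close> index
  the basis of the \<open>n\<close>-th tensor power.  A \<open>tensor_op\<close> gives a matrix for all \<open>n\<close> at once (only
  entries with row and column index of equal length matter), so that an operator on some of the
  tensor factors need not be renamed when further factors are added.
  Tensor factors are numbered from 1: factor \<open>m\<close> is list position \<open>m - 1\<close>.\<close>

type_synonym 'v op1 = "complex^'v^'v"
type_synonym 'v op2 = "complex^('v \<times> 'v)^('v \<times> 'v)"
type_synonym ('v, 'a) tensor_op = "'v list \<Rightarrow> 'v list \<Rightarrow> 'a"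

definition tid :: "('v, 'a::semiring_1) tensor_op" where
  "tid xs ys = of_bool (xs = ys)"

definition tmul :: "('v::finite, 'a::semiring_1) tensor_op \<Rightarrow> ('v, 'a) tensor_op \<Rightarrow> ('v, 'a) tensor_op"
    (infixl \<open>\<bullet>\<bullet>\<close> 70) where
  "(A \<bullet>\<bullet> B) xs ys = (\<Sum>zs | length zs = length xs. A xs zs * B zs ys)"

definition teq :: "nat \<Rightarrow> ('v, 'a) tensor_op \<Rightarrow> ('v, 'a) tensor_op \<Rightarrow> bool" where
  "teq n A B \<longleftrightarrow> (\<forall>xs ys. length xs = n \<longrightarrow> length ys = n \<longrightarrow> A xs ys = B xs ys)"

definition tr :: "nat \<Rightarrow> ('v::finite, 'a::semiring_1) tensor_op \<Rightarrow> 'a" where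
  "tr n A = (\<Sum>xs | length xs = n. A xs xs)"

definition site1 :: "'a::semiring_1^'v^'v \<Rightarrow> nat \<Rightarrow> ('v::finite, 'a) tensor_op" where
  "site1 Y m xs ys = Y $ (xs ! (m - 1)) $ (ys ! (m - 1)) *
     of_bool (\<forall>k<length xs. k \<noteq> m - 1 \<longrightarrow> xs ! k = ys ! k)"

definition site2 :: "'v::finite op2 \<Rightarrow> nat \<Rightarrow> nat \<Rightarrow> ('v, complex) tensor_op" where
  "site2 X m r xs ys = X $ (xs ! (m - 1), xs ! (r - 1)) $ (ys ! (m - 1), ys ! (r - 1)) *
     of_bool (\<forall>k<length xs. k \<noteq> m - 1 \<and> k \<noteq> r - 1 \<longrightarrow> xs ! k = ys ! k)"

abbreviation site :: "'v::finite op2 \<Rightarrow> nat \<Rightarrow> ('v, complex) tensor_op" where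
  "site X m \<equiv> site2 X m (m + 1)"

text \<open>\<open>ptr i\<close> traces out factor \<open>i\<close>; the factors after it are renumbered down by one.\<close>

definition ptr :: "nat \<Rightarrow> ('v::finite, 'a::semiring_1) tensor_op \<Rightarrow> ('v, 'a) tensor_op" where
  "ptr i A xs ys = (\<Sum>k\<in>UNIV. A (take (i - 1) xs @ k # drop (i - 1) xs)
                                 (take (i - 1) ys @ k # drop (i - 1) ys))"


section \<open>R-matrices\<close>

definition flip :: "'v::finite op2" where
  "flip = (\<chi> i j. of_bool (fst i = snd j \<and> snd i = fst j))"

text \<open>After tracing out factor 2 the factors 1 and 3 are numbered 1 and 2, so the operator
  \<open>flip\<close> in factors 1 and 3 becomes \<open>site2 flip 1 2\<close>.\<close>

definition skew_inverse :: "'v::finite op2 \<Rightarrow> 'v op2 \<Rightarrow> bool" where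
  "skew_inverse X \<Psi> \<longleftrightarrow>
     teq 2 (ptr 2 (site2 X 1 2 \<bullet>\<bullet> site2 \<Psi> 2 3)) (site2 flip 1 2) \<and>
     teq 2 (ptr 2 (site2 \<Psi> 1 2 \<bullet>\<bullet> site2 X 2 3)) (site2 flip 1 2)"

definition skew_invertible :: "'v::finite op2 \<Rightarrow> bool" where
  "skew_invertible X \<longleftrightarrow> (\<exists>\<Psi>. skew_inverse X \<Psi>)"

text \<open>The skew inverse is unique if it exists.\<close>

definition Psi :: "'v::finite op2 \<Rightarrow> 'v op2" where
  "Psi X = (SOME \<Psi>. skew_inverse X \<Psi>)"

definition C_op :: "'v::finite op2 \<Rightarrow> 'v op1" where
  "C_op X = (\<chi> a b. ptr 1 (site2 (Psi X) 1 2) [a] [b])"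

definition D_op :: "'v::finite op2 \<Rightarrow> 'v op1" where
  "D_op X = (\<chi> a b. ptr 2 (site2 (Psi X) 1 2) [a] [b])"

definition strict_skew_invertible :: "'v::finite op2 \<Rightarrow> bool" where
  "strict_skew_invertible X \<longleftrightarrow> skew_invertible X \<and> (invertible (C_op X) \<or> invertible (D_op X))"

definition R_matrix :: "'v::finite op2 \<Rightarrow> bool" where
  "R_matrix R \<longleftrightarrow> invertible R \<and>
     teq 3 (site R 1 \<bullet>\<bullet> site R 2 \<bullet>\<bullet> site R 1) (site R 2 \<bullet>\<bullet> site R 1 \<bullet>\<bullet> site R 2)"

definition compatible :: "'v::finite op2 \<Rightarrow> 'v op2 \<Rightarrow> bool" where
  "compatible R F \<longleftrightarrow>
     teq 3 (site R 1 \<bullet>\<bullet> site F 2 \<bullet>\<bullet> site F 1) (site F 2 \<bullet>\<bullet> site F 1 \<bullet>\<bullet> site R 2) \<and>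
     teq 3 (site R 2 \<bullet>\<bullet> site F 1 \<bullet>\<bullet> site F 2) (site F 1 \<bullet>\<bullet> site F 2 \<bullet>\<bullet> site R 1)"

text \<open>Scalar multiples of the identity matrix are written \<open>mat c\<close> below.\<close>

definition poly_at_matrix :: "complex poly \<Rightarrow> complex^'m^'m \<Rightarrow> complex^'m^'m" where
  "poly_at_matrix p A = (\<Sum>i\<le>degree p. mat (coeff p i) ** (((**) A) ^^ i) (mat 1))"

definition is_minimal_polynomial :: "complex poly \<Rightarrow> complex^'m^'m \<Rightarrow> bool" where
  "is_minimal_polynomial p A \<longleftrightarrow> lead_coeff p = 1 \<and> poly_at_matrix p A = 0 \<and>
     (\<forall>r. r \<noteq> 0 \<longrightarrow> poly_at_matrix r A = 0 \<longrightarrow> degree p \<le> degree r)"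

definition K_op :: "complex \<Rightarrow> complex \<Rightarrow> 'v::finite op2 \<Rightarrow> 'v op2" where
  "K_op q \<mu> R = mat (inverse \<mu> * inverse (q - inverse q)) ** (mat q - R) ** (mat (inverse q) + R)"

text \<open>The monic cubic with roots \<open>q\<close>, \<open>- inverse q\<close>, \<open>\<mu>\<close> evaluates at \<open>R\<close> to the product
  \<open>(q - R) (inverse q + R) (\<mu> - R)\<close>.\<close>

definition BMW_type :: "complex \<Rightarrow> complex \<Rightarrow> 'v::finite op2 \<Rightarrow> bool" where
  "BMW_type q \<mu> R \<longleftrightarrow>
     is_minimal_polynomial ([:- q, 1:] * [:inverse q, 1:] * [:- \<mu>, 1:]) R \<and>
     (let K = K_op q \<mu> R; R' = matrix_inv R in
       teq 3 (site K 2 \<bullet>\<bullet> site K 1) (site R 1 \<bullet>\<bullet> site R 2 \<bullet>\<bullet> site K 1) \<and>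
       teq 3 (site K 2 \<bullet>\<bullet> site K 1) (site R' 1 \<bullet>\<bullet> site R' 2 \<bullet>\<bullet> site K 1) \<and>
       teq 3 (site K 1 \<bullet>\<bullet> site K 2 \<bullet>\<bullet> site K 1) (site K 1))"


section \<open>Elements of the braid group algebra\<close>

text \<open>Elements of the group algebra of the braid group are represented by noncommutative
  polynomials in the generators and their inverses.  For an R-matrix \<open>R\<close> the representation
  \<open>rho R\<close> on the \<open>n\<close>-th tensor power is the evaluation at \<open>R\<^sub>i\<close> and its inverse; the braid
  relations are respected, so the choice of the representing polynomial is immaterial.\<close>

datatype braid_gen = Sig nat | SigInv nat

type_synonym braid_alg = "braid_gen free_algebra"

fun gen_op :: "'v::finite op2 \<Rightarrow> braid_gen \<Rightarrow> ('v, complex) tensor_op" where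
  "gen_op R (Sig i) = site R i"
| "gen_op R (SigInv i) = site (matrix_inv R) i"

definition rho :: "'v::finite op2 \<Rightarrow> braid_alg \<Rightarrow> ('v, complex) tensor_op" where
  "rho R \<alpha> xs ys = (\<Sum>w\<in>Poly_Mapping.keys \<alpha>.
     Poly_Mapping.lookup \<alpha> w * foldr (\<lambda>g A. gen_op R g \<bullet>\<bullet> A) (letters w) tid xs ys)"

definition sigma :: "nat \<Rightarrow> braid_alg" where
  "sigma i = gen (Sig i)"

definition qnum :: "complex \<Rightarrow> nat \<Rightarrow> complex" where
  "qnum q i = (q ^ i - inverse q ^ i) / (q - inverse q)"

definition kappa :: "complex \<Rightarrow> complex \<Rightarrow> nat \<Rightarrow> braid_alg" where
  "kappa q \<mu> i = scalar (1 / (\<mu> * (q - inverse q))) * ((scalar q - sigma i) * (scalar (inverse q) + sigma i))"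

definition sigma_minus :: "complex \<Rightarrow> complex \<Rightarrow> nat \<Rightarrow> complex \<Rightarrow> braid_alg" where
  "sigma_minus q \<mu> i x = 1 + scalar ((x - 1) / (q - inverse q)) * sigma i
     + scalar ((x - 1) / (q * inverse \<mu> * x + 1)) * kappa q \<mu> i"

definition sigma_plus :: "complex \<Rightarrow> complex \<Rightarrow> nat \<Rightarrow> complex \<Rightarrow> braid_alg" where
  "sigma_plus q \<mu> i x = 1 + scalar ((x - 1) / (q - inverse q)) * sigma i
     + scalar ((x - 1) / (1 - inverse q * inverse \<mu> * x)) * kappa q \<mu> i"

text \<open>The values at 0 are never used.\<close>

fun antisym :: "complex \<Rightarrow> complex \<Rightarrow> nat \<Rightarrow> braid_alg" where
  "antisym q \<mu> 0 = 1"
| "antisym q \<mu> (Suc i) = (if i = 0 then 1 else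
     scalar (q ^ i / qnum q (i + 1)) *
       (antisym q \<mu> i * sigma_minus q \<mu> i (q powi (- 2 * int i)) * antisym q \<mu> i))"

fun symm :: "complex \<Rightarrow> complex \<Rightarrow> nat \<Rightarrow> braid_alg" where
  "symm q \<mu> 0 = 1"
| "symm q \<mu> (Suc i) = (if i = 0 then 1 else
     scalar (q powi (- int i) / qnum q (i + 1)) *
       (symm q \<mu> i * sigma_plus q \<mu> i (q ^ (2 * i)) * symm q \<mu> i))"


section \<open>The quantum matrix algebra\<close>

text \<open>Matrices over the quantum matrix algebra are written with representatives of their entries
  in the free algebra on the \<open>N\<^sup>2\<close> symbols for the entries of \<open>M\<close>; complex matrices are embedded
  by \<open>lift\<close>.\<close>

type_synonym 'v entry_alg = "('v \<times> 'v) free_algebra"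

definition M_mat :: "'v::finite entry_alg^'v^'v" where
  "M_mat = (\<chi> a b. gen (a, b))"

definition lift :: "('v, complex) tensor_op \<Rightarrow> ('v, 'x free_algebra) tensor_op" where
  "lift A xs ys = scalar (A xs ys)"

text \<open>\<open>Mbar F i\<close> is \<open>M\<close> with overlined index \<open>i\<close> (the value at 0 is never used), and
  \<open>Mprod F n\<close> is the product of the first \<open>n\<close> of these.\<close>

fun Mbar :: "'v::finite op2 \<Rightarrow> nat \<Rightarrow> ('v, 'v entry_alg) tensor_op" where
  "Mbar F 0 = tid"
| "Mbar F (Suc i) = (if i = 0 then site1 M_mat 1 else
     lift (site F i) \<bullet>\<bullet> Mbar F i \<bullet>\<bullet> lift (site (matrix_inv F) i))"

fun Mprod :: "'v::finite op2 \<Rightarrow> nat \<Rightarrow> ('v, 'v entry_alg) tensor_op" where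
  "Mprod F 0 = tid"
| "Mprod F (Suc n) = Mprod F n \<bullet>\<bullet> Mbar F (Suc n)"

definition qm_relations :: "'v::finite op2 \<Rightarrow> 'v op2 \<Rightarrow> 'v entry_alg set" where
  "qm_relations R F =
     {(lift (site R 1) \<bullet>\<bullet> Mbar F 1 \<bullet>\<bullet> Mbar F 2) xs ys - (Mbar F 1 \<bullet>\<bullet> Mbar F 2 \<bullet>\<bullet> lift (site R 1)) xs ys
      | xs ys. length xs = 2 \<and> length ys = 2}"

definition qm_ideal :: "'v::finite op2 \<Rightarrow> 'v op2 \<Rightarrow> 'v entry_alg set" where
  "qm_ideal R F = Idl\<^bsub>free_ring\<^esub> (qm_relations R F)"

text \<open>Ideals in the library are two-sided.\<close>

definition qm_algebra :: "'v::finite op2 \<Rightarrow> 'v op2 \<Rightarrow> 'v entry_alg set ring" where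
  "qm_algebra R F = free_ring Quot (qm_ideal R F)"

lemma ring_qm_algebra: "Ring.ring (qm_algebra R F)"
  unfolding qm_algebra_def qm_ideal_def
  by (intro ideal.quotient_is_ring ring.genideal_ideal ring_free_ring) (simp add: free_ring_def)

definition qm_class :: "'v::finite op2 \<Rightarrow> 'v op2 \<Rightarrow> 'v entry_alg \<Rightarrow> 'v entry_alg set" where
  "qm_class R F x = qm_ideal R F +>\<^bsub>free_ring\<^esub> x"

definition qm_scale :: "'v::finite op2 \<Rightarrow> 'v op2 \<Rightarrow> complex \<Rightarrow> 'v entry_alg set \<Rightarrow> 'v entry_alg set" where
  "qm_scale R F c x = qm_class R F (scalar c) \<otimes>\<^bsub>qm_algebra R F\<^esub> x"


section \<open>The characteristic subalgebra\<close>

fun D_prod :: "'v::finite op2 \<Rightarrow> nat \<Rightarrow> ('v, complex) tensor_op" where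
  "D_prod R 0 = tid"
| "D_prod R (Suc n) = D_prod R n \<bullet>\<bullet> site1 (D_op R) (Suc n)"

definition R_trace :: "'v::finite op2 \<Rightarrow> nat \<Rightarrow> ('v, 'v entry_alg) tensor_op \<Rightarrow> 'v entry_alg" where
  "R_trace R n X = tr n (lift (D_prod R n) \<bullet>\<bullet> X)"

text \<open>\<open>ch R F n \<alpha>\<close> is meant for \<open>\<alpha>\<close> in the group algebra of the braid group on \<open>n\<close> strands.\<close>

definition ch :: "'v::finite op2 \<Rightarrow> 'v op2 \<Rightarrow> nat \<Rightarrow> braid_alg \<Rightarrow> 'v entry_alg set" where
  "ch R F n \<alpha> = qm_class R F (R_trace R n (Mprod F n \<bullet>\<bullet> lift (rho R \<alpha>)))"

definition elem_a :: "'v::finite op2 \<Rightarrow> 'v op2 \<Rightarrow> complex \<Rightarrow> complex \<Rightarrow> nat \<Rightarrow> 'v entry_alg set" where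
  "elem_a R F q \<mu> i = (if i = 0 then \<one>\<^bsub>qm_algebra R F\<^esub> else ch R F i (antisym q \<mu> i))"

definition elem_s :: "'v::finite op2 \<Rightarrow> 'v op2 \<Rightarrow> complex \<Rightarrow> complex \<Rightarrow> nat \<Rightarrow> 'v entry_alg set" where
  "elem_s R F q \<mu> i = (if i = 0 then \<one>\<^bsub>qm_algebra R F\<^esub> else ch R F i (symm q \<mu> i))"

definition eta :: "complex \<Rightarrow> complex \<Rightarrow> complex" where
  "eta q \<mu> = (q - \<mu>) * (inverse q + \<mu>) / (\<mu> * (q - inverse q))"

definition elem_g :: "'v::finite op2 \<Rightarrow> 'v op2 \<Rightarrow> complex \<Rightarrow> complex \<Rightarrow> 'v entry_alg set" where
  "elem_g R F q \<mu> = qm_scale R F (inverse (eta q \<mu>)) (ch R F 2 (kappa q \<mu> 1))"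

text \<open>Power sums, for \<open>i \<ge> 1\<close>.\<close>

definition elem_p :: "'v::finite op2 \<Rightarrow> 'v op2 \<Rightarrow> nat \<Rightarrow> 'v entry_alg set" where
  "elem_p R F i = (if i = 1 then qm_class R F (R_trace R 1 (site1 M_mat 1))
                   else ch R F i (prod_list (map sigma (rev [1..<i]))))"

end

theory Submission imports Defs begin

text \<open>
  Operators on all tensor powers live in one ring of linear operators on functions of index
  sequences, where \<open>R_i\<close>, \<open>R_i\<inverse>\<close> and \<open>K_i\<close> satisfy the relations of the Birman-Murakami-Wenzl
  algebra for every \<open>i\<close>. The map \<open>\<alpha> \<mapsto> ch(\<alpha>)\<close> turns the juxtaposition of braids into the product, so that
  \<open>a_i p_{n-i} = ch(a^{(i)} \<sigma>_{n-1} \<dots> \<sigma>_{i+1})\<close>, and it is cyclic modulo the defining relations.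
  Followed by a linear functional that vanishes on the relations it is therefore a trace on the algebra on
  \<open>n\<close> strands, and (i) reduces to an identity for all such traces.

  The definition of \<open>a^{(i+1)}\<close> expresses \<open>q^i a_i p_{n-i}\<close> as a sum of two consecutive terms of a
  telescoping sequence and a correction that contains \<open>\<kappa>_i\<close>. Sliding this \<open>\<kappa>_i\<close> through \<open>\<sigma>_{n-1} \<dots> \<sigma>_{i+1}\<close>
  rewrites the correction as one for the trace \<open>x \<mapsto> t(x \<kappa>_{n-1}) / \<eta>\<close> on \<open>n - 2\<close> strands, up to terms
  that telescope as well, and the right hand side of (i) follows by induction from \<open>n - 2\<close> to \<open>n\<close>.

  Statement (ii) is (i) for \<open>- 1 / q\<close> in place of \<open>q\<close>. For (iii), evaluate the sum of all
  \<open>a_i s_j p_k\<close> with \<open>i + j + k = n\<close>, suitably weighted, by (i) and by (ii); the two results differ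
  by \<open>n_q\<close> times the alternating sum of the \<open>a_i s_{n-i}\<close> and terms that are known by induction.
\<close>

section \<open>Traces on the Birman-Murakami-Wenzl algebra\<close>

text \<open>Cyclicity of \<open>ch\<close> holds only modulo the two-sided ideal of relations, and
  the reduction by two strands replaces the trace by another one. The identity is therefore stated
  for every trace, and a separation argument returns to the quotient. Juxtaposition becomes a
  product because the R-trace over factor m + 1 of F_m Z F_m^{-1} equals the R-trace over factor m
  of Z, if Z does not act in factor m + 1. This is a contraction identity that follows from
  compatibility and skew invertibility of R. The same identity with R in place of F shows that R
  commutes with D_R tensor D_R, which cyclicity needs. The coefficients \<mu> q^{n-2i} - q^{1-n+2i}
  arise only at the top of the telescoping sum, where no crossing is left for \<kappa> to slide
  along. Replacing q by -1/q leaves q - 1/q, \<kappa>_i, eta and g unchanged and turns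
  antisymmetrizers into symmetrizers; so (ii) needs no second computation. In (iii) the a_i and s_j
  have to be interchanged. This holds modulo the ideal: a power of \<sigma>_1 ... \<sigma>_{n-1}
  exchanges two blocks of strands by conjugation.\<close>

locale complex_algebra = vector_space scale for scale :: "complex \<Rightarrow> 'r::ring_1 \<Rightarrow> 'r" (infixr \<open>\<odot>\<close> 75) +
  assumes mult_scale_left [simp]: "c \<odot> x * y = c \<odot> (x * y)"
    and mult_scale_right [simp]: "x * c \<odot> y = c \<odot> (x * y)"

text \<open>In the names of the relations below, the digits 1 and 2 stand for the indices \<open>i\<close> and \<open>Suc i\<close>.\<close>

locale bmw = complex_algebra scale for scale :: "complex \<Rightarrow> 'r::ring_1 \<Rightarrow> 'r" (infixr \<open>\<odot>\<close> 75) +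
  fixes s si k :: "nat \<Rightarrow> 'r" and q \<mu> :: complex
  assumes q_nonzero [simp]: "q \<noteq> 0" and q_sq: "q\<^sup>2 \<noteq> 1" and mu_nonzero [simp]: "\<mu> \<noteq> 0"
    and mu_q: "\<mu> \<noteq> q" and mu_q': "\<mu> \<noteq> - inverse q"
    and s_si [simp]: "s i * si i = 1" and si_s [simp]: "si i * s i = 1"
    and braid: "s i * (s (Suc i) * s i) = s (Suc i) * (s i * s (Suc i))"
    and far: "Suc i < j \<Longrightarrow> s i * s j = s j * s i"
    and k_eq: "k i = (1 / (\<mu> * (q - inverse q))) \<odot> ((q \<odot> 1 - s i) * (inverse q \<odot> 1 + s i))"
    and k_s [simp]: "k i * s i = \<mu> \<odot> k i"
    and k2k1: "k (Suc i) * k i = s i * (s (Suc i) * k i)"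
    and k2k1': "k (Suc i) * k i = si i * (si (Suc i) * k i)"
    and k1k2k1: "k i * (k (Suc i) * k i) = k i"
begin

section \<open>Consequences of the relations between crossings and \<kappa>'s\<close>

definition lam :: complex where "lam = q - inverse q"

definition eta :: complex where
  "eta = (q - \<mu>) * (inverse q + \<mu>) / (\<mu> * lam)"

lemma lam_nonzero [simp]: "lam \<noteq> 0"
  using q_nonzero q_sq by (simp add: lam_def field_simps power2_eq_square)

lemma cancel_inverse [simp]:
  "q * (inverse q * z) = z" "inverse q * (q * z) = z"
  "\<mu> * (inverse \<mu> * z) = z" "inverse \<mu> * (\<mu> * z) = z"
  by (simp_all flip: mult.assoc)

lemma eta_nonzero [simp]: "eta \<noteq> 0"
  using mu_q mu_q' by (simp add: eta_def add_eq_0_iff)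

lemma k_alt: "(lam * \<mu>) \<odot> k i = 1 + lam \<odot> s i - s i * s i"
proof -
  have "(lam * \<mu>) \<odot> k i = (q \<odot> 1 - s i) * (inverse q \<odot> 1 + s i)"
    using mu_nonzero lam_nonzero by (simp add: k_eq flip: lam_def)
  then show ?thesis using q_nonzero by (simp add: lam_def algebra_simps)
qed

text \<open>Only \<open>k_s\<close> is assumed. \<open>k i\<close> is a polynomial in
  \<open>s i\<close>, so the two commute, and the nonzero factor \<open>lam * \<mu>\<close> can be
  cancelled.\<close>

lemma s_k [simp]: "s i * k i = \<mu> \<odot> k i"
proof -
  have "(lam * \<mu>) \<odot> (s i * k i) = s i * ((lam * \<mu>) \<odot> k i)" by simp
  also have "\<dots> = ((lam * \<mu>) \<odot> k i) * s i"
    unfolding k_alt by (simp add: algebra_simps)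
  also have "\<dots> = (lam * \<mu>) \<odot> (\<mu> \<odot> k i)" by simp
  finally show ?thesis
    using mu_nonzero lam_nonzero by (metis no_zero_divisors scale_left_imp_eq)
qed

lemma s_sq: "s i * s i = 1 + lam \<odot> s i - (lam * \<mu>) \<odot> k i"
  using k_alt[of i] by (simp add: algebra_simps)

lemma si_left [simp]: "si i * (s i * x) = x" and s_left [simp]: "s i * (si i * x) = x"
  by (simp_all flip: mult.assoc)

lemma k_s_left [simp]: "k i * (s i * x) = \<mu> \<odot> (k i * x)"
  and s_k_left [simp]: "s i * (k i * x) = \<mu> \<odot> (k i * x)"
  by (simp_all flip: mult.assoc)

lemma si_k [simp]: "si i * k i = inverse \<mu> \<odot> k i"
proof -
  have "si i * (s i * k i) = k i" by (simp del: s_k)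
  then have "inverse \<mu> \<odot> (si i * (s i * k i)) = inverse \<mu> \<odot> k i" by simp
  then show ?thesis by (simp del: si_left)
qed

lemma k_si [simp]: "k i * si i = inverse \<mu> \<odot> k i"
proof -
  have "k i * s i * si i = k i" by (simp add: mult.assoc del: k_s k_s_left)
  then have "inverse \<mu> \<odot> (k i * s i * si i) = inverse \<mu> \<odot> k i" by simp
  then show ?thesis by simp
qed

lemma k_si_left [simp]: "k i * (si i * x) = inverse \<mu> \<odot> (k i * x)"
  and si_k_left [simp]: "si i * (k i * x) = inverse \<mu> \<odot> (k i * x)"
  by (simp_all flip: mult.assoc)

text \<open>The Kauffman skein relation s - s^{-1} = lam (1 - k): multiply \<open>s_sq\<close> by
  the inverse, which acts on \<open>k i\<close> as 1/\<mu>.\<close>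

lemma si_eq: "si i = s i - lam \<odot> 1 + lam \<odot> k i"
proof -
  have "si i * (s i * s i) = si i * (1 + lam \<odot> s i - (lam * \<mu>) \<odot> k i)"
    by (simp only: s_sq)
  then have "s i + (lam * \<mu> * inverse \<mu>) \<odot> k i = si i + lam \<odot> 1"
    by (simp add: right_diff_distrib distrib_left eq_diff_eq diff_eq_eq)
  moreover have "lam * \<mu> * inverse \<mu> = lam" by simp
  ultimately have "s i + lam \<odot> k i = si i + lam \<odot> 1" by simp
  then show ?thesis by (simp add: algebra_simps)
qed

text \<open>On \<open>k i\<close> the crossing acts as \<mu>, so \<open>k_alt\<close> is evaluated
  at s = \<mu>; its value (q - \<mu>)(1/q + \<mu>) divided by lam \<mu> is
  \<open>eta\<close>.\<close>

lemma k_k [simp]: "k i * k i = eta \<odot> k i"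
proof -
  have "(lam * \<mu>) \<odot> (k i * k i) = ((lam * \<mu>) \<odot> k i) * k i" by simp
  also have "\<dots> = (1 + lam * \<mu> - \<mu> * \<mu>) \<odot> k i"
    unfolding k_alt by (simp add: algebra_simps)
  also have "1 + lam * \<mu> - \<mu> * \<mu> = (q - \<mu>) * (inverse q + \<mu>)"
    by (simp add: lam_def algebra_simps)
  also have "\<dots> = (lam * \<mu>) * eta"
    by (simp add: eta_def)
  finally have "(lam * \<mu>) \<odot> (k i * k i) = (lam * \<mu>) \<odot> (eta \<odot> k i)" by simp
  then show ?thesis
    by (metis lam_nonzero mu_nonzero no_zero_divisors scale_left_imp_eq)
qed

lemma k_k_left [simp]: "k i * (k i * x) = eta \<odot> (k i * x)"
  by (simp flip: mult.assoc)

text \<open>Each \<open>k i\<close> is the same polynomial in \<open>s i\<close>, so intertwining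
  relations carry over.\<close>

lemma conj_k: assumes "t * s i = s j * t" shows "t * k i = k j * t"
proof -
  have 1: "t * (q \<odot> 1 - s i) = (q \<odot> 1 - s j) * t"
    and 2: "t * (inverse q \<odot> 1 + s i) = (inverse q \<odot> 1 + s j) * t"
    using assms by (simp_all add: algebra_simps)
  have "t * ((q \<odot> 1 - s i) * (inverse q \<odot> 1 + s i)) = (q \<odot> 1 - s j) * (inverse q \<odot> 1 + s j) * t"
    by (metis 1 2 mult.assoc)
  then show ?thesis by (simp add: k_eq)
qed

lemma conj_si: "t * s i = s j * t \<Longrightarrow> t * si i = si j * t"
  by (metis mult.assoc mult_1_right s_si si_left)

lemma s1s2k1: "s i * (s (Suc i) * k i) = k (Suc i) * (s i * s (Suc i))"
  using conj_k[of "s i * s (Suc i)" i "Suc i"] braid by (simp add: mult.assoc)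

lemma k1s2k1: "k i * (s (Suc i) * k i) = inverse \<mu> \<odot> k i"
proof -
  have "k i = k i * (k (Suc i) * k i)" by (simp only: k1k2k1)
  also have "\<dots> = \<mu> \<odot> (k i * (s (Suc i) * k i))" by (simp add: k2k1)
  finally have "inverse \<mu> \<odot> k i = inverse \<mu> \<odot> \<mu> \<odot> (k i * (s (Suc i) * k i))" by simp
  then show ?thesis using mu_nonzero by simp
qed

lemma k1si2k1: "k i * (si (Suc i) * k i) = \<mu> \<odot> k i"
proof -
  have "k i = k i * (k (Suc i) * k i)" by (simp only: k1k2k1)
  also have "\<dots> = inverse \<mu> \<odot> (k i * (si (Suc i) * k i))" by (simp add: k2k1')
  finally have "\<mu> \<odot> k i = \<mu> \<odot> inverse \<mu> \<odot> (k i * (si (Suc i) * k i))" by simp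
  then show ?thesis using mu_nonzero by simp
qed

text \<open>The mirror image of \<open>k1k2k1\<close>, which is not among the hypotheses.
  Conjugation by s_i s_{i+1} turns k_i into k_{i+1}, and when s_i s_{i+1} or its inverse stands
  between two k_i the powers of \<mu> cancel.\<close>

lemma k2k1k2: "k (Suc i) * (k i * k (Suc i)) = k (Suc i)"
proof -
  let ?t = "s i * s (Suc i)" and ?t' = "si (Suc i) * si i"
  have tt: "?t * ?t' = 1" by (simp add: mult.assoc)
  have k2: "k (Suc i) = ?t * k i * ?t'"
  proof -
    have "?t * k i * ?t' = k (Suc i) * (?t * ?t')" by (simp add: mult.assoc s1s2k1 del: s_left)
    then show ?thesis unfolding tt by simp
  qed
  have a: "k i * ?t' * k i = k i"
    using mu_nonzero by (simp add: mult.assoc k1si2k1)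
  have b: "k i * ?t * k i = k i"
    using mu_nonzero by (simp add: mult.assoc k1s2k1)
  have "k (Suc i) * (k i * k (Suc i)) = ?t * (k i * ?t' * k i) * ?t * k i * ?t'"
    unfolding k2 by (simp only: mult.assoc)
  also have "\<dots> = ?t * (k i * ?t * k i) * ?t'"
    unfolding a by (simp only: mult.assoc)
  also have "\<dots> = k (Suc i)" unfolding b k2 ..
  finally show ?thesis .
qed

lemma k2k1_right: "k (Suc i) * k i = k (Suc i) * (s i * s (Suc i))"
  by (simp add: k2k1 s1s2k1)

lemma s2k1: "s (Suc i) * k i = si i * (k (Suc i) * k i)"
  by (simp add: k2k1)

text \<open>Together with \<open>s2k1\<close> and \<open>k2si1\<close>, a move for sliding a pair
  k_{i+1} k_i along a braid: a crossing at i + 1 is traded for one at i.\<close>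

lemma k2k1si2: "k (Suc i) * (k i * si (Suc i)) = k (Suc i) * s i"
  using arg_cong[OF k2k1_right, of "\<lambda>x. x * si (Suc i)" i] by (simp add: mult.assoc)

lemma k2si1: "k (Suc i) * si i = k (Suc i) * (k i * s (Suc i))"
proof -
  have "si i * (si (Suc i) * s i) = s (Suc i) * (si i * si (Suc i))"
    by (metis (no_types, opaque_lifting) braid mult.assoc mult_1_right s_si si_left)
  then have "k (Suc i) * k i = k (Suc i) * (si i * si (Suc i))"
    using conj_k[of "si i * si (Suc i)" i "Suc i"] by (simp add: k2k1' mult.assoc)
  from arg_cong[OF this, of "\<lambda>x. x * s (Suc i)"] show ?thesis
    by (simp add: mult.assoc)
qed

lemma far_si: "Suc i < j \<Longrightarrow> si i * s j = s j * si i"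
  using conj_si[of "s j" i i] far[of i j] by simp

text \<open>The image of the braid group algebra on n strands. Index 0 is left out, so
  \<open>B 0\<close> and \<open>B 1\<close> contain only scalars although \<open>s 0\<close> exists.
  The \<open>k i\<close> need not be listed, being polynomials in the \<open>s i\<close>.\<close>

inductive_set B :: "nat \<Rightarrow> 'r set" for n where
  B_1: "1 \<in> B n"
| B_s: "1 \<le> i \<Longrightarrow> i < n \<Longrightarrow> s i \<in> B n"
| B_si: "1 \<le> i \<Longrightarrow> i < n \<Longrightarrow> si i \<in> B n"
| B_scale: "x \<in> B n \<Longrightarrow> c \<odot> x \<in> B n"
| B_add: "x \<in> B n \<Longrightarrow> y \<in> B n \<Longrightarrow> x + y \<in> B n"
| B_mult: "x \<in> B n \<Longrightarrow> y \<in> B n \<Longrightarrow> x * y \<in> B n"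

lemma B_diff: "x \<in> B n \<Longrightarrow> y \<in> B n \<Longrightarrow> x - y \<in> B n"
  using B_add[OF _ B_scale[of y n "-1"], of x] by simp

lemma B_k: "1 \<le> i \<Longrightarrow> i < n \<Longrightarrow> k i \<in> B n"
  unfolding k_eq by (intro B_mult B_scale B_diff B_add B_s B_1)

lemma B_mono: "x \<in> B m \<Longrightarrow> m \<le> n \<Longrightarrow> x \<in> B n"
  by (induction rule: B.induct) (auto intro: B.intros)

lemma B_comm:
  assumes "x \<in> B n" "n < j"
  shows "x * s j = s j * x"
  using assms
proof (induction rule: B.induct)
  case (B_s i) then show ?case using far[of i j] by simp
next
  case (B_si i) then show ?case using far_si[of i j] by simp
next
  case (B_mult x y) then show ?case by (metis mult.assoc)
qed (simp_all add: algebra_simps)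

lemma B_comm_k: "x \<in> B n \<Longrightarrow> n < j \<Longrightarrow> x * k j = k j * x"
  using conj_k[OF B_comm] .

lemma B_comm_si: "x \<in> B n \<Longrightarrow> n < j \<Longrightarrow> x * si j = si j * x"
  using conj_si[OF B_comm] .

end

section \<open>Antisymmetrizers: idempotency and absorption of crossings\<close>

lemma qnum_1 [simp]: "q - inverse q \<noteq> 0 \<Longrightarrow> qnum q (Suc 0) = 1"
  by (simp add: qnum_def)

lemma qnum_0 [simp]: "qnum q 0 = 0"
  by (simp add: qnum_def)

context bmw
begin

definition xq :: "nat \<Rightarrow> complex" where "xq i = inverse q ^ (2 * i)"

text \<open>The denominator of \<kappa>_i in \<sigma>_i^-(q^{-2i}). It vanishes iff \<mu> = -
  q^{1-2i}, the value that the theorem excludes for j = i + 1.\<close>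

definition wq :: "nat \<Rightarrow> complex" where "wq i = 1 + q * inverse \<mu> * xq i"

definition sm :: "nat \<Rightarrow> complex \<Rightarrow> 'r" where
  "sm i x = 1 + ((x - 1) / lam) \<odot> s i + ((x - 1) / (1 + q * inverse \<mu> * x)) \<odot> k i"

fun asym :: "nat \<Rightarrow> 'r" where
  "asym 0 = 1"
| "asym (Suc i) = (if i = 0 then 1 else
     (q ^ i / qnum q (i + 1)) \<odot> (asym i * (sm i (xq i) * asym i)))"

text \<open>Division by zero gives 0 in HOL, so the recursion always has a value; this says that no
  denominator met on the way to stage n vanishes.\<close>

definition asym_defined :: "nat \<Rightarrow> bool" where
  "asym_defined n \<longleftrightarrow> (\<forall>j\<in>{1..<n}. qnum q (Suc j) \<noteq> 0 \<and> wq j \<noteq> 0)"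

lemma asym_defined_mono: "asym_defined n \<Longrightarrow> m \<le> n \<Longrightarrow> asym_defined m"
  by (auto simp: asym_defined_def)

lemma xq_Suc: "xq (Suc i) = inverse q * inverse q * xq i"
  by (simp add: xq_def)

lemma xq_lam: "q ^ i * (1 - xq i) = lam * qnum q i"
proof -
  have "q ^ i * xq i = inverse q ^ i"
    by (simp add: xq_def mult_2 power_add) (simp add: power_mult_distrib[symmetric])
  then have "q ^ i * (1 - xq i) = q ^ i - inverse q ^ i" by (simp add: algebra_simps)
  also have "\<dots> = lam * qnum q i" using lam_nonzero by (simp add: qnum_def flip: lam_def)
  finally show ?thesis .
qed

text \<open>The factor 1/q + s_i of \<open>k i\<close> vanishes on the eigenvalue -1/q.\<close>

lemma anti_k:
  assumes "a * s i = (- inverse q) \<odot> a"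
  shows "a * k i = 0"
proof -
  have "a * ((q \<odot> 1 - s i) * (inverse q \<odot> 1 + s i)) = 0"
    by (simp add: distrib_left right_diff_distrib left_diff_distrib mult.assoc[symmetric] assms
        scale_right_distrib)
  then show ?thesis by (simp add: k_eq)
qed

text \<open>The computation behind absorption. With u = s_{i+1} and l = k_{i+1} everything reduces
  to the five elements a, a u, a l s_i, a l k_i and a l. The coefficients \<open>?A3\<close> and
  \<open>?A4\<close> are proportional and \<open>?A5\<close> is the left side of \<open>e4\<close>
  up to \<open>?A3\<close>, so four scalar conditions suffice.\<close>

lemma asym_sm_sm_annihilates:
  fixes a :: 'r and i :: nat
  defines "p \<equiv> s (Suc i) + inverse q \<odot> 1"
  assumes as: "a * s i = (- inverse q) \<odot> a"
    and e1: "inverse q - inverse q * inverse q * d1 + c1 = 0"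
    and e2: "1 - inverse q * d1 + q * c1 = 0"
    and e3: "c2 * d1 + q * d2 * (c2 - q * c1) = 0"
    and e4: "- lam * \<mu> * c1 + c2 * (\<mu> + inverse q) + lam * inverse q * c2 * d1 = 0"
  shows "a * ((1 + c1 \<odot> s (Suc i) + c2 \<odot> k (Suc i)) * ((1 + d1 \<odot> s i + d2 \<odot> k i) * p)) = 0"
proof -
  define u l where "u = s (Suc i)" and "l = k (Suc i)"
  have ak: "a * k i = 0" by (rule anti_k[OF as])
  have as': "a * (s i * x) = (- inverse q) \<odot> (a * x)" and ak': "a * (k i * x) = 0" for x
    by (simp_all add: as ak flip: mult.assoc)
  have u2: "u * u = 1 + lam \<odot> u - (lam * \<mu>) \<odot> l" by (simp add: u_def l_def s_sq)
  \<comment> \<open>\<open>a\<close> absorbs s_i^{-1} with the factor - q, by the skein relation and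
    a k_i = 0.\<close>
  have auk: "a * (u * k i) = (- q) \<odot> (a * (l * k i))"
    unfolding u_def l_def s2k1 si_eq
    by (simp add: distrib_left distrib_right right_diff_distrib left_diff_distrib mult.assoc[symmetric] as ak)
      (simp add: lam_def algebra_simps)
  have lsu: "l * (s i * u) = l * k i"
    by (simp add: u_def l_def k2k1_right)
  have lku: "l * (k i * u) = l * s i + lam \<odot> (l * k i) - lam \<odot> l"
    using k2k1si2[of i] k2k1k2[of i] unfolding si_eq
    by (simp add: u_def[symmetric] l_def[symmetric] distrib_left right_diff_distrib algebra_simps)
  have q1: "lam + inverse q = q" by (simp add: lam_def)
  have p0: "a * p = a * u + inverse q \<odot> a"
    by (simp add: p_def u_def distrib_left)
  have p1: "a * (u * p) = a + (lam + inverse q) \<odot> (a * u) - (lam * \<mu>) \<odot> (a * l)"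
    unfolding p_def u_def[symmetric]
    by (simp add: distrib_left u2 algebra_simps)
  have p2: "a * (u * (s i * p)) = 0"
    using braid[of i] unfolding p_def
    by (simp add: u_def distrib_left flip: braid) (simp add: as')
  have p3: "a * (l * p) = (\<mu> + inverse q) \<odot> (a * l)"
    unfolding p_def by (simp add: l_def distrib_left scale_left_distrib)
  have p4: "a * (l * (s i * p)) = a * (l * k i) + inverse q \<odot> (a * (l * s i))"
    unfolding p_def u_def[symmetric] by (simp add: distrib_left lsu)
  have p5: "a * (l * (k i * p)) = a * (l * s i) + (lam + inverse q) \<odot> (a * (l * k i)) - lam \<odot> (a * l)"
    unfolding p_def u_def[symmetric]
    by (simp add: distrib_left lku algebra_simps)
  have p6: "a * (u * (k i * p)) = (- q) \<odot> (a * (l * (k i * p)))"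
    using arg_cong[OF auk, of "\<lambda>x. x * p"] by (simp add: mult.assoc)
  let ?A3 = "inverse q * c2 * d1 + (c2 * d2 - q * c1 * d2)"
  let ?A4 = "c2 * d1 + q * (c2 * d2 - q * c1 * d2)"
  let ?A5 = "- lam * \<mu> * c1 + c2 * (\<mu> + inverse q) - lam * (c2 * d2 - q * c1 * d2)"
  have A4: "?A4 = 0" using e3 by (simp add: algebra_simps)
  have "?A3 = inverse q * ?A4" by (simp add: distrib_left)
  then have A3: "?A3 = 0" using A4 by simp
  have "?A5 = (- lam * \<mu> * c1 + c2 * (\<mu> + inverse q) + lam * inverse q * c2 * d1) - lam * ?A3"
    by (simp add: algebra_simps)
  then have A5: "?A5 = 0" unfolding e4 A3 by simp
  have "a * ((1 + c1 \<odot> u + c2 \<odot> l) * ((1 + d1 \<odot> s i + d2 \<odot> k i) * p))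
    = (inverse q - inverse q * inverse q * d1 + c1) \<odot> a + (1 - inverse q * d1 + q * c1) \<odot> (a * u)
      + ?A3 \<odot> (a * (l * s i)) + ?A4 \<odot> (a * (l * k i)) + ?A5 \<odot> (a * l)"
    by (simp only: distrib_left distrib_right mult_1_left mult_scale_left mult_scale_right mult.assoc
        p0 p1[unfolded q1] p2 p3 p4 p5[unfolded q1] p6 as' ak')
      (simp add: scale_left_distrib scale_right_distrib scale_left_diff_distrib scale_right_diff_distrib
        algebra_simps)
  also have "\<dots> = 0" unfolding e1 e2 A3 A4 A5 by simp
  finally show ?thesis unfolding u_def l_def .
qed

text \<open>The four conditions at the spectral parameters x and q^2 x. They are used with x =
  q^{-2n}, where q^2 x is the parameter of the preceding stage.\<close>

lemma sm_coefficients: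
  assumes "1 + q * inverse \<mu> * x \<noteq> 0" "1 + q * inverse \<mu> * (q * q * x) \<noteq> 0"
  defines "c1 \<equiv> (x - 1) / lam" and "c2 \<equiv> (x - 1) / (1 + q * inverse \<mu> * x)"
    and "d1 \<equiv> (q * q * x - 1) / lam" and "d2 \<equiv> (q * q * x - 1) / (1 + q * inverse \<mu> * (q * q * x))"
  shows "inverse q - inverse q * inverse q * d1 + c1 = 0"
    "1 - inverse q * d1 + q * c1 = 0"
    "c2 * d1 + q * d2 * (c2 - q * c1) = 0"
    "- lam * \<mu> * c1 + c2 * (\<mu> + inverse q) + lam * inverse q * c2 * d1 = 0"
proof -
  define w v where "w = 1 + q * inverse \<mu> * x" and "v = 1 + q * inverse \<mu> * (q * q * x)"
  have nz: "w \<noteq> 0" "v \<noteq> 0" using assms(1,2) by (simp_all add: w_def v_def)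
  have c1: "lam * c1 = x - 1" and d1: "lam * d1 = q * q * x - 1" by (simp_all add: c1_def d1_def)
  have c2: "c2 = lam * c1 / w" and d2: "d2 = lam * d1 / v"
    by (simp_all add: c2_def d2_def c1 d1 w_def v_def)
  have "lam * (inverse q - inverse q * inverse q * d1 + c1)
      = lam * inverse q - inverse q * inverse q * (lam * d1) + lam * c1" by (simp add: algebra_simps)
  also have "\<dots> = 0" unfolding c1 d1 by (simp add: lam_def field_simps)
  finally show "inverse q - inverse q * inverse q * d1 + c1 = 0" by simp
  have "lam * (1 - inverse q * d1 + q * c1) = lam - inverse q * (lam * d1) + q * (lam * c1)"
    by (simp add: algebra_simps)
  also have "\<dots> = 0" unfolding c1 d1 by (simp add: lam_def field_simps)
  finally show "1 - inverse q * d1 + q * c1 = 0" by simp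
  have "c2 * d1 + q * d2 * (c2 - q * c1) = lam * c1 * d1 * (v + q * (lam - q * w)) / (w * v)"
    unfolding c2 d2 using nz by (simp add: field_simps)
  also have "v + q * (lam - q * w) = 0" by (simp add: v_def w_def lam_def algebra_simps)
  finally show "c2 * d1 + q * d2 * (c2 - q * c1) = 0" by simp
  have "- lam * \<mu> * c1 + c2 * (\<mu> + inverse q) + lam * inverse q * c2 * d1
      = lam * c1 * (- \<mu> * w + \<mu> + inverse q + inverse q * (lam * d1)) / w"
    unfolding c2 using nz by (simp add: field_simps)
  also have "- \<mu> * w + \<mu> + inverse q + inverse q * (lam * d1) = 0"
    unfolding d1 w_def by (simp add: algebra_simps)
  finally show "- lam * \<mu> * c1 + c2 * (\<mu> + inverse q) + lam * inverse q * c2 * d1 = 0" by simp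
qed

lemma B_sm: "1 \<le> i \<Longrightarrow> i < n \<Longrightarrow> sm i x \<in> B n"
  unfolding sm_def by (intro B_add B_scale B_s B_k B_1)

lemma asym_B: "asym n \<in> B n"
proof (induction n)
  case (Suc n)
  then show ?case using B_sm[of n "Suc n"] by (auto intro!: B_1 B_scale B_mult dest: B_mono[of _ n "Suc n"])
qed (simp add: B_1)

text \<open>Strong induction, since stage n + 1 looks back at n and n - 1 strands. The two
  properties support each other: absorbing the new crossing needs idempotency of earlier stages, and
  idempotency follows from absorption.\<close>

lemma asym_absorbs:
  assumes "1 \<le> n" "asym_defined n"
  shows "asym n * asym n = asym n \<and> (\<forall>j\<in>{1..<n}. asym n * s j = (- inverse q) \<odot> asym n)"
  using assms
proof (induction n rule: less_induct)
  case (less N)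
  show ?case
  proof (cases "N = 1")
    case False
    then obtain n where N: "N = Suc n" and n1: "1 \<le> n" using less.prems(1) by (cases N) auto
    note IH = less.IH[unfolded N]
    have defN: "asym_defined (Suc n)" using less.prems(2) by (simp add: N)
    let ?a = "asym n" and ?A = "asym (Suc n)" and ?b = "sm n (xq n)" and ?c = "q ^ n / qnum q (Suc n)"
    have idem: "?a * ?a = ?a" and anti: "\<And>j. 1 \<le> j \<Longrightarrow> j < n \<Longrightarrow> ?a * s j = (- inverse q) \<odot> ?a"
      using IH[of n] n1 asym_defined_mono[OF defN, of n] by auto
    have S: "?A = ?c \<odot> (?a * (?b * ?a))" using n1 by simp
    have qn: "qnum q (Suc n) \<noteq> 0" and wn: "wq n \<noteq> 0"
      using n1 defN by (auto simp: asym_defined_def)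
    \<comment> \<open>Earlier crossings are absorbed by the right factor \<open>?a\<close>; only s_n
      is new.\<close>
    have last: "?a * (?b * (?a * (s n + inverse q \<odot> 1))) = 0"
    proof (cases "n = 1")
      case True
      have w: "1 + q * inverse \<mu> * xq 1 \<noteq> 0" using wn True by (simp add: wq_def)
      have mq: "xq 1 = inverse q * inverse q" by (simp add: xq_def power2_eq_square del: One_nat_def)
      have lq: "xq 1 - 1 = - inverse q * lam" unfolding mq lam_def by (simp add: algebra_simps)
      then have c1: "(xq 1 - 1) / lam = - inverse q" by simp
      define c2 where "c2 = (xq 1 - 1) / (1 + q * inverse \<mu> * xq 1)"
      have c2: "c2 * (\<mu> + inverse q) = - lam * inverse q * \<mu>"
      proof -
        have "\<mu> * (1 + q * inverse \<mu> * xq 1) = \<mu> + inverse q"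
          unfolding mq by (simp add: field_simps)
        then have "c2 * (\<mu> + inverse q) = \<mu> * (c2 * (1 + q * inverse \<mu> * xq 1))"
          by (metis mult.left_commute)
        also have "c2 * (1 + q * inverse \<mu> * xq 1) = xq 1 - 1"
          using w by (simp add: c2_def del: One_nat_def)
        finally have "c2 * (\<mu> + inverse q) = \<mu> * (xq 1 - 1)" .
        then show ?thesis unfolding lq by (simp add: algebra_simps)
      qed
      have "sm 1 (xq 1) * (s 1 + inverse q \<odot> 1)
         = (1 - inverse q * lam - inverse q * inverse q) \<odot> s 1
           + (inverse q * lam * \<mu> + c2 * (\<mu> + inverse q)) \<odot> k 1"
        unfolding sm_def c1 c2_def[symmetric]
        by (simp add: distrib_left distrib_right s_sq scale_right_distrib scale_right_diff_distrib
            scale_left_distrib scale_left_diff_distrib algebra_simps)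
      also have "1 - inverse q * lam - inverse q * inverse q = 0" by (simp add: lam_def algebra_simps)
      finally show ?thesis using True c2 by simp
    next
      case False
      then obtain i where n: "n = Suc i" and i: "1 \<le> i" using n1 by (cases n) auto
      let ?a' = "asym i" and ?b' = "sm i (xq i)" and ?c' = "q ^ i / qnum q (Suc i)"
        and ?p = "s (Suc i) + inverse q \<odot> 1"
      have idem': "?a' * ?a' = ?a'" and wi: "wq i \<noteq> 0"
        using IH[of i] i n asym_defined_mono[OF defN, of i] defN by (auto simp: asym_defined_def)
      have S': "?a = ?c' \<odot> (?a' * (?b' * ?a'))" using i n by simp
      have aa': "?a * ?a' = ?a"
        unfolding S' by (simp add: mult.assoc idem')
      have comm: "?a' * s n = s n * ?a'" "?a' * k n = k n * ?a'"
        using B_comm[OF asym_B, of i n] B_comm_k[OF asym_B, of i n] n by auto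
      have bc: "?b * ?a' = ?a' * ?b" and pc: "?a' * ?p = ?p * ?a'"
        using comm n by (simp_all add: sm_def algebra_simps)
      have bc': "?b * (?a' * y) = ?a' * (?b * y)" for y
        by (simp only: bc flip: mult.assoc)
      have x: "q * q * xq n = xq i" by (simp add: n xq_Suc)
      have w: "1 + q * inverse \<mu> * xq n \<noteq> 0" "1 + q * inverse \<mu> * (q * q * xq n) \<noteq> 0"
        using wn wi unfolding wq_def x by simp_all
      have "?a * s i = (- inverse q) \<odot> ?a" using anti i n by simp
      from asym_sm_sm_annihilates[OF this sm_coefficients[OF w]]
      have z: "?a * (?b * (?b' * ?p)) = 0"
        unfolding sm_def x[symmetric] n[symmetric] .
      \<comment> \<open>\<open>?a'\<close> commutes with s_n and k_n. Its two copies inside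
        \<open>?a\<close> are moved outwards until \<open>?b * (?b' * ?p)\<close> stands right after
        \<open>?a\<close>.\<close>
      have "?a * (s n + inverse q \<odot> 1) = ?c' \<odot> ((?a' * (?b' * ?a')) * ?p)"
        unfolding S' by (simp add: n del: asym.simps)
      then have "?a * (?b * (?a * (s n + inverse q \<odot> 1))) = ?c' \<odot> (?a * (?b * ((?a' * (?b' * ?a')) * ?p)))"
        by (simp del: asym.simps)
      also have "(?a' * (?b' * ?a')) * ?p = ?a' * (?b' * (?p * ?a'))"
        using pc by (simp add: mult.assoc)
      also have "?a * (?b * (?a' * (?b' * (?p * ?a')))) = (?a * ?a') * (?b * (?b' * ?p)) * ?a'"
        by (simp only: bc' mult.assoc)
      also have "\<dots> = 0" unfolding aa' z by simp
      finally show ?thesis by simp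
    qed
    have As: "?A * s j = (- inverse q) \<odot> ?A" if "1 \<le> j" "j < Suc n" for j
    proof (cases "j = n")
      case True
      have "?A * (s n + inverse q \<odot> 1) = 0"
        unfolding S using last by (simp add: mult.assoc)
      then show ?thesis by (simp add: True distrib_left eq_neg_iff_add_eq_0)
    next
      case False
      then show ?thesis using anti[of j] that unfolding S by (simp add: mult.assoc)
    qed
    have Aa: "?A * ?a = ?A" unfolding S by (simp add: mult.assoc idem)
    \<comment> \<open>\<open>?A\<close> kills k_n and absorbs s_n, so \<sigma>_n^-(q^{-2n}) acts as
      a scalar. The prefactor in the definition is the inverse of that scalar, because q^n + n_q / q
      = (n + 1)_q.\<close>
    have Ab: "?A * ?b = (1 + (1 - xq n) / lam * inverse q) \<odot> ?A"
      using As[of n] anti_k[of ?A n] n1 unfolding sm_def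
      by (simp add: distrib_left scale_left_distrib scale_left_diff_distrib diff_divide_distrib left_diff_distrib algebra_simps del: asym.simps)
    have "?A * ?A = ?c \<odot> (?A * ?a * ?b * ?a)" by (subst (2) S) (simp add: mult.assoc del: asym.simps)
    also have "\<dots> = (?c * (1 + (1 - xq n) / lam * inverse q)) \<odot> ?A"
      unfolding Aa Ab by (simp add: Aa del: asym.simps)
    also have "?c * (1 + (1 - xq n) / lam * inverse q) = 1"
    proof -
      have "q ^ n * (1 + (1 - xq n) / lam * inverse q) = q ^ n + inverse q * (q ^ n * (1 - xq n) / lam)"
        by (simp only: distrib_left mult_1_right mult_1_left times_divide_eq_left times_divide_eq_right mult_ac)
      also have "q ^ n * (1 - xq n) / lam = qnum q n" by (simp add: xq_lam)
      also have "q ^ n + inverse q * qnum q n = (lam * q ^ n + inverse q * (q ^ n - inverse q ^ n)) / lam"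
        unfolding qnum_def lam_def[symmetric] by (simp add: add_divide_distrib)
      also have "\<dots> = qnum q (Suc n)"
        unfolding qnum_def lam_def[symmetric] by (simp add: lam_def algebra_simps)
      finally show ?thesis using qn by simp
    qed
    finally have "?A * ?A = ?A" by (simp del: asym.simps)
    then show ?thesis using As N by auto
  qed simp
qed

lemma asym_idem: "asym_defined n \<Longrightarrow> asym n * asym n = asym n"
  using asym_absorbs[of n] by (cases n) auto

end

text \<open>The scalar identity for the top correction term in \<open>zt_last\<close>, read with Q =
  q^n. With Q as an independent variable it is an identity of rational functions.\<close>

lemma last_coeff:
  fixes q \<mu> Q :: complex
  assumes "q \<noteq> 0" "\<mu> \<noteq> 0" "Q \<noteq> 0"
  defines "p \<equiv> inverse q" and "u \<equiv> inverse \<mu>" and "P \<equiv> inverse Q"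
  shows "((q - \<mu>) * (p + \<mu>) * u * Q - (Q - P) * u) * (1 + q * u * (P * P)) - (q - p) * (Q - P)
    = (1 + p * u * (P * P)) * ((Q - P) * u * q\<^sup>2 * (P * P) - (\<mu> * Q - q * P) * (1 + q * u * (P * P)))"
  using assms(1-3) unfolding p_def u_def P_def by (simp add: field_simps power2_eq_square)

context bmw
begin

lemma k2s1k2: "k (Suc i) * (s i * k (Suc i)) = inverse \<mu> \<odot> k (Suc i)"
proof -
  have "k (Suc i) * k i * k (Suc i) = \<mu> \<odot> (k (Suc i) * (s i * k (Suc i)))"
    unfolding k2k1_right by (simp add: mult.assoc)
  then have "inverse \<mu> \<odot> k (Suc i) = inverse \<mu> \<odot> \<mu> \<odot> (k (Suc i) * (s i * k (Suc i)))"
    by (simp add: mult.assoc k2k1k2)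
  then show ?thesis by simp
qed

section \<open>Braids of the power sums, and traces on n strands\<close>

declare asym.simps(2) [simp del]

lemma asym_1 [simp]: "asym (Suc 0) = 1"
  by (simp add: asym.simps(2))

text \<open>The descending product \<sigma>_{n-1} ... \<sigma>_i. With i + 1 for i it is the braid
  of p_{n-i} placed behind i strands.\<close>

definition d :: "nat \<Rightarrow> nat \<Rightarrow> 'r" where
  "d n i = prod_list (map s (rev [i..<n]))"

lemma d_ge [simp]: "n \<le> i \<Longrightarrow> d n i = 1"
  by (simp add: d_def)

lemma d_rec: "i < n \<Longrightarrow> d n i = d n (Suc i) * s i"
  by (simp add: d_def upt_conv_Cons)

lemma d_front: "i \<le> n \<Longrightarrow> d (Suc n) i = s n * d n i"
  by (simp add: d_def)

lemma d_B: "1 \<le> i \<Longrightarrow> d n i \<in> B n"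
proof (induction n)
  case (Suc n)
  then show ?case
    by (cases "i \<le> n") (auto simp: d_front intro!: B_mult B_s B_1 dest: B_mono[of _ n "Suc n"])
qed (simp add: B_1)

lemma d_comm: "x \<in> B i \<Longrightarrow> i < j \<Longrightarrow> x * d n j = d n j * x"
proof (induction n)
  case (Suc n)
  then show ?case
    using B_comm[of x i n] by (cases "j \<le> n") (simp_all add: d_front, metis mult.assoc)
qed simp

text \<open>The product \<kappa>_{n-2i+1} ... \<kappa>_{n-3} \<kappa>_{n-1} on the last 2 i strands;
  behind \<open>asym (n - 2 * i)\<close> it represents eta^i a_{n-2i} g^i.\<close>

fun kp :: "nat \<Rightarrow> nat \<Rightarrow> 'r" where
  "kp n 0 = 1"
| "kp n (Suc i) = kp (n - 2) i * k (n - 1)"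

text \<open>Cyclicity is asked for inside \<open>B n\<close> only, so that the notion survives
  multiplication by \<kappa>_{n-1}, after which it holds on n - 2 strands.\<close>

definition trace_on :: "nat \<Rightarrow> ('r \<Rightarrow> complex) \<Rightarrow> bool" where
  "trace_on n t \<longleftrightarrow> (\<forall>x y. t (x + y) = t x + t y) \<and> (\<forall>c x. t (c \<odot> x) = c * t x) \<and>
     (\<forall>x\<in>B n. \<forall>y\<in>B n. t (x * y) = t (y * x))"

lemma
  assumes "trace_on n t"
  shows trace_add: "t (x + y) = t x + t y" and trace_scale: "t (c \<odot> x) = c * t x"
    and trace_cyc: "x \<in> B n \<Longrightarrow> y \<in> B n \<Longrightarrow> t (x * y) = t (y * x)"
  using assms by (auto simp: trace_on_def)

lemma trace_diff: "trace_on n t \<Longrightarrow> t (x - y) = t x - t y"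
  using trace_add[of n t "x - y" y] by simp

lemma asym_B': "j \<le> n \<Longrightarrow> asym j \<in> B n"
  using asym_B B_mono by blast

lemma d_B': "m \<le> n \<Longrightarrow> 1 \<le> i \<Longrightarrow> d m i \<in> B n"
  using d_B B_mono by blast

lemmas B_intros = B_mult B_add B_scale B_1 B_s B_si B_k asym_B' d_B'

text \<open>\<kappa>_{n+1} commutes with \<open>B n\<close> and can be carried along. The division
  by eta matches the normalisation of g.\<close>

lemma trace_reduce:
  assumes t: "trace_on (Suc (Suc n)) t"
  defines "t' \<equiv> \<lambda>x. t (x * k (Suc n)) / eta"
  shows "trace_on n t'"
  unfolding trace_on_def
proof (intro conjI ballI allI)
  fix x y assume xy: "x \<in> B n" "y \<in> B n"
  then have xy': "x \<in> B (Suc (Suc n))" "y \<in> B (Suc (Suc n))" by (auto intro: B_mono)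
  have "t (x * (y * k (Suc n))) = t (y * k (Suc n) * x)"
    using xy' by (intro trace_cyc[OF t]) (auto intro!: B_intros)
  also have "y * k (Suc n) * x = y * x * k (Suc n)"
    using B_comm_k[OF xy(1), of "Suc n"] by (simp add: mult.assoc)
  finally show "t' (x * y) = t' (y * x)" by (simp add: t'_def mult.assoc)
qed (auto simp: t'_def trace_add[OF t] trace_scale[OF t] distrib_right add_divide_distrib)

text \<open>Unfold the recursion. As X commutes with \<open>asym j\<close>, cyclicity brings the two
  outer copies together, idempotency leaves one of them, and \<sigma>_j^- contributes three
  terms.\<close>

lemma trace_asym_step:
  assumes t: "trace_on n t" and j: "j < n" and def: "asym_defined n" and X: "X \<in> B n"
    and comm: "asym j * X = X * asym j"
  shows "qnum q (Suc j) * t (asym (Suc j) * X) = q ^ j * t (asym j * X)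
     - qnum q j * t (asym j * (X * s j)) - lam * qnum q j / wq j * t (asym j * (X * k j))"
\<comment> \<open>Index 0 is outside \<open>B n\<close>, but for j = 0 the terms with s_0 and k_0
  have the coefficient 0_q = 0.\<close>
proof (cases "j = 0")
  case True
  then show ?thesis using lam_nonzero by (simp add: lam_def)
next
  case False
  then have j1: "1 \<le> j" by simp
  let ?a = "asym j" and ?b = "sm j (xq j)"
  have qn: "qnum q (Suc j) \<noteq> 0" and w: "wq j \<noteq> 0"
    using def j j1 by (auto simp: asym_defined_def)
  have S: "asym (Suc j) = (q ^ j / qnum q (Suc j)) \<odot> (?a * (?b * ?a))" using j1 by (simp add: asym.simps(2))
  have b: "?b \<in> B n" using B_sm[of j n] j j1 by simp
  have "t (?a * (?b * (?a * X))) = t (?b * (?a * X) * ?a)"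
    using j b X by (intro trace_cyc[OF t]) (auto intro!: B_intros)
  also have "?b * (?a * X) * ?a = ?b * (?a * ?a * X)"
    by (metis comm mult.assoc)
  also have "?a * ?a * X = ?a * X"
    using asym_idem[OF asym_defined_mono[OF def, of j]] j by simp
  also have "t (?b * (?a * X)) = t (?a * X * ?b)"
    using j b X by (intro trace_cyc[OF t]) (auto intro!: B_intros)
  also have "?a * X * ?b = ?a * X + ((xq j - 1) / lam) \<odot> (?a * (X * s j)) + ((xq j - 1) / wq j) \<odot> (?a * (X * k j))"
    by (simp add: sm_def distrib_left wq_def mult.assoc)
  finally have "t (?a * (?b * (?a * X))) = t (?a * X) + (xq j - 1) / lam * t (?a * (X * s j))
      + (xq j - 1) / wq j * t (?a * (X * k j))"
    by (simp add: trace_add[OF t] trace_scale[OF t])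
  then have "qnum q (Suc j) * t (asym (Suc j) * X) = q ^ j * (t (?a * X) + (xq j - 1) / lam * t (?a * (X * s j))
      + (xq j - 1) / wq j * t (?a * (X * k j)))"
    unfolding S using qn by (simp add: trace_scale[OF t] mult.assoc)
  also have "\<dots> = q ^ j * t (?a * X) - (q ^ j * (1 - xq j)) / lam * t (?a * (X * s j))
      - (q ^ j * (1 - xq j)) / wq j * t (?a * (X * k j))"
    using w lam_nonzero by (simp add: field_simps)
  finally show ?thesis unfolding xq_lam using w by simp
qed

text \<open>The pair k_{j+2} k_{j+1} slides along the crossings of \<open>d n (j + 3)\<close> to the
  last strands, where it leaves a single \<kappa>_{n'+1} and a braid on n' strands.\<close>

lemma slide:
  assumes t: "trace_on n t" and "Suc (Suc n') = n" and jn: "j < n'" and y: "y \<in> B (Suc j)"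
  shows "t (asym j * (d n (j + 3) * (k (j + 2) * (k (j + 1) * y))))
    = t (asym j * (d n' (Suc j) * y) * k (Suc n')) / eta"
proof -
  have n: "n = Suc (Suc n')" using assms by simp
  \<comment> \<open>m marks the place of the pair. A step from m to m + 1 uses up s_{m+2} on its
    left and creates s_m on its right, while s_{m+1}^{-1} travels around the trace.\<close>
  define G where "G m = t (asym j * (d n (m + 2) * (k (Suc m) * (k m * (d m (Suc j) * y)))))" for m
  have step: "G m = G (Suc m)" if m: "Suc j \<le> m" "m < n'" for m
  proof -
    have e: "d n (m + 2) = d n (m + 3) * s (Suc (Suc m))"
      using d_rec[of "m + 2" n] m n by (simp add: eval_nat_numeral)
    have y': "y \<in> B n" using y m n by (auto intro: B_mono)
    let ?R = "asym j * (d n (m + 3) * (k (Suc (Suc m)) * (k (Suc m) * (k m * (d m (Suc j) * y)))))"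
    have c1: "asym j * si (Suc m) = si (Suc m) * asym j"
      using m by (intro B_comm_si[OF asym_B]) auto
    have c2: "si (Suc m) * d n (m + 3) = d n (m + 3) * si (Suc m)"
      by (rule d_comm[of _ "m + 2"]) (auto intro: B_si)
    have c1': "asym j * (si (Suc m) * z) = si (Suc m) * (asym j * z)"
      and c2': "d n (m + 3) * (si (Suc m) * z) = si (Suc m) * (d n (m + 3) * z)" for z
      by (simp_all only: c1 c2[symmetric] flip: mult.assoc)
    have c3: "d m (Suc j) * y * si (Suc m) = si (Suc m) * (d m (Suc j) * y)"
      using m y by (intro B_comm_si[of _ m]) (auto intro!: B_mult d_B dest: B_mono[of _ "Suc j" m])
    have "G m = t (asym j * (d n (m + 3) * (si (Suc m) * (k (Suc (Suc m)) * (k (Suc m) * (k m * (d m (Suc j) * y)))))))"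
    proof -
      have "s (Suc (Suc m)) * (k (Suc m) * z) = si (Suc m) * (k (Suc (Suc m)) * (k (Suc m) * z))" for z
        using s2k1[of "Suc m"] by (metis mult.assoc)
      then show ?thesis unfolding G_def e by (simp add: mult.assoc)
    qed
    also have "\<dots> = t (si (Suc m) * ?R)"
      by (simp only: c1' c2' mult.assoc)
    also have "\<dots> = t (?R * si (Suc m))"
      using m n y' by (intro trace_cyc[OF t]) (auto intro!: B_intros)
    also have "?R * si (Suc m) = asym j * (d n (m + 3) * (k (Suc (Suc m)) * (k (Suc m) * (k m * si (Suc m)) * (d m (Suc j) * y))))"
      using c3 by (simp add: mult.assoc)
    also have "\<dots> = asym j * (d n (m + 3) * (k (Suc (Suc m)) * (k (Suc m) * (d (Suc m) (Suc j) * y))))"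
      using m unfolding k2k1si2 by (simp add: d_front mult.assoc)
    finally show ?thesis by (simp add: G_def eval_nat_numeral)
  qed
  have "Suc j \<le> n' \<Longrightarrow> G (Suc j) = G n'"
    by (rule dec_induct[of "Suc j" n' "\<lambda>m. G (Suc j) = G m"]) (use step jn in auto)
  then have 1: "G (Suc j) = G n'" using jn by simp
  define V where "V = d n' (Suc j) * y"
  have V: "V \<in> B n'" unfolding V_def using jn y by (auto intro!: B_intros intro: B_mono)
  have V': "V \<in> B n" using V n by (auto intro: B_mono)
  have aK: "asym j * k (Suc n') = k (Suc n') * asym j"
    using jn by (intro B_comm_k[OF asym_B]) auto
  have VK: "V * k (Suc n') = k (Suc n') * V" by (rule B_comm_k[OF V]) simp
  let ?W = "asym j * (k (Suc n') * (k n' * V))"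
  \<comment> \<open>A second k_{n'+1} costs eta; moved around the trace it closes up in k_{n'+1}
    k_{n'} k_{n'+1} = k_{n'+1}.\<close>
  have "eta * t ?W = t (asym j * (k (Suc n') * (k (Suc n') * (k n' * V))))"
    by (simp add: trace_scale[OF t])
  also have "asym j * (k (Suc n') * (k (Suc n') * (k n' * V))) = k (Suc n') * ?W"
    using aK by (metis mult.assoc)
  also have "t \<dots> = t (?W * k (Suc n'))"
    using jn n V' by (intro trace_cyc[OF t]) (auto intro!: B_intros)
  also have "?W * k (Suc n') = asym j * (k (Suc n') * (k n' * k (Suc n')) * V)"
    using VK by (simp add: mult.assoc)
  also have "\<dots> = asym j * V * k (Suc n')"
    unfolding k2k1k2 using VK by (simp add: mult.assoc)
  finally have "t ?W = t (asym j * V * k (Suc n')) / eta"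
    by (simp add: field_simps)
  moreover have "G n' = t ?W" by (simp add: G_def n V_def)
  moreover have "G (Suc j) = t (asym j * (d n (j + 3) * (k (j + 2) * (k (j + 1) * y))))"
    by (simp add: G_def eval_nat_numeral)
  ultimately show ?thesis using 1 by (simp add: V_def)
qed

text \<open>The single \<kappa>_{j+1} becomes a pair by s_{j+2} k_{j+1} = s_{j+1}^{-1} k_{j+2}
  k_{j+1}. The inverse crossing travels around the trace and meets x, which \<open>xy\<close> turns
  into y; then \<open>slide\<close> applies. Needed for x = 1, k_j and s_j^{-1}.\<close>

lemma turn:
  assumes t: "trace_on n t" and n: "n = Suc (Suc n')" and jn: "j < n'" and x: "x \<in> B (Suc j)"
    and y: "y \<in> B (Suc j)" and xy: "k (Suc j) * (x * si (Suc j)) = k (Suc j) * (c \<odot> y)"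
  shows "t (asym j * (d n (j + 2) * (k (j + 1) * x))) = c * (t (asym j * (d n' (Suc j) * y) * k (Suc n')) / eta)"
proof -
  have e: "d n (j + 2) = d n (j + 3) * s (Suc (Suc j))"
    using d_rec[of "j + 2" n] jn n by (simp add: eval_nat_numeral)
  have x': "x \<in> B n" using x jn n by (auto intro: B_mono)
  let ?R = "asym j * (d n (j + 3) * (k (Suc (Suc j)) * (k (Suc j) * x)))"
  have c1: "asym j * si (Suc j) = si (Suc j) * asym j"
    by (intro B_comm_si[OF asym_B]) auto
  have c2: "si (Suc j) * d n (j + 3) = d n (j + 3) * si (Suc j)"
    by (rule d_comm[of _ "j + 2"]) (auto intro: B_si)
  have c1': "asym j * (si (Suc j) * z) = si (Suc j) * (asym j * z)"
    and c2': "d n (j + 3) * (si (Suc j) * z) = si (Suc j) * (d n (j + 3) * z)" for z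
    by (simp_all only: c1 c2[symmetric] flip: mult.assoc)
  have "s (Suc (Suc j)) * (k (Suc j) * z) = si (Suc j) * (k (Suc (Suc j)) * (k (Suc j) * z))" for z
    using s2k1[of "Suc j"] by (metis mult.assoc)
  then have "t (asym j * (d n (j + 2) * (k (j + 1) * x)))
      = t (asym j * (d n (j + 3) * (si (Suc j) * (k (Suc (Suc j)) * (k (Suc j) * x)))))"
    unfolding e by (simp add: mult.assoc)
  also have "\<dots> = t (si (Suc j) * ?R)"
    by (simp only: c1' c2' mult.assoc)
  also have "\<dots> = t (?R * si (Suc j))"
    using jn n x' by (intro trace_cyc[OF t]) (auto intro!: B_intros)
  also have "?R * si (Suc j) = c \<odot> (asym j * (d n (j + 3) * (k (j + 2) * (k (j + 1) * y))))"
    using xy by (simp add: mult.assoc)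
  also have "t \<dots> = c * t (asym j * (d n (j + 3) * (k (j + 2) * (k (j + 1) * y))))"
    by (rule trace_scale[OF t])
  finally show ?thesis using slide[OF t _ jn y] n by simp
qed

text \<open>\<open>zt n t i\<close> is the correction term with \<open>\<kappa>_i\<close> and \<open>yt n t\<close> the telescoping sequence that appears
  when the correction terms for \<open>n + 2\<close> strands are reduced to those for \<open>n\<close> strands.\<close>

definition zt :: "nat \<Rightarrow> ('r \<Rightarrow> complex) \<Rightarrow> nat \<Rightarrow> complex" where
  "zt n t i = lam * qnum q i / wq i * t (asym i * (d n (Suc i) * k i))"

definition yt :: "nat \<Rightarrow> ('r \<Rightarrow> complex) \<Rightarrow> nat \<Rightarrow> complex" where
  "yt n t i = lam * qnum q i * inverse \<mu> * q\<^sup>2 * xq i / wq i * t (asym i * d n i)"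

text \<open>For X = \<sigma>_{n-1} ... \<sigma>_{i+1} the crossing s_i in
  \<open>trace_asym_step\<close> extends X to \<open>d n i\<close>, so the two main terms are
  consecutive members of one sequence.\<close>

lemma power_sum_step:
  assumes t: "trace_on n t" and def: "asym_defined n" and i: "i < n"
  shows "q ^ i * t (asym i * d n (Suc i)) = qnum q (Suc i) * t (asym (Suc i) * d n (Suc i))
     + qnum q i * t (asym i * d n i) + zt n t i"
  using trace_asym_step[OF t i def d_B[of "Suc i" n]] d_comm[OF asym_B, of i "Suc i" n] d_rec[OF i]
  unfolding zt_def by (simp add: mult.assoc)

lemma wq_Suc: "wq (Suc j) = 1 + inverse q * inverse \<mu> * xq j"
  by (simp add: wq_def xq_Suc algebra_simps)

text \<open>Unfolding \<open>asym (Suc j)\<close> in the correction term gives traces that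
  \<open>turn\<close> takes to n - 2 strands. Among them \<open>?X\<close> is eliminated by
  \<open>power_sum_step\<close> for t'. All resulting coefficients contain
  \<open>wq (Suc j)\<close>, the denominator of the correction term.\<close>

lemma zt_step:
  assumes t: "trace_on n t" and def: "asym_defined n" and n: "n = Suc (Suc n')" and jn: "j < n'"
  defines "t' \<equiv> \<lambda>x. t (x * k (Suc n')) / eta"
  shows "zt n t (Suc j) = yt n' t' (Suc j) + yt n' t' j - zt n' t' j"
proof -
  have t': "trace_on n' t'" unfolding t'_def using t n by (intro trace_reduce) simp
  have def': "asym_defined n'" using def n by (auto intro: asym_defined_mono)
  let ?X = "t' (asym j * d n' (Suc j))" and ?Y = "t' (asym j * d n' j)"
    and ?Z = "t' (asym j * (d n' (Suc j) * k j))"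
    and ?Y1 = "t' (asym (Suc j) * d n' (Suc j))" and ?Z1 = "t (asym (Suc j) * (d n (j + 2) * k (Suc j)))"
  have w1: "wq (Suc j) \<noteq> 0" using def jn n by (auto simp: asym_defined_def)
  have T0: "t (asym j * (d n (j + 2) * k (Suc j))) = inverse \<mu> * ?X"
    using turn[OF t n jn B_1 B_1, of "inverse \<mu>"] by (simp add: t'_def mult.assoc)
  have comm: "asym j * (d n (j + 2) * k (Suc j)) = d n (j + 2) * k (Suc j) * asym j"
    using d_comm[OF asym_B, of j "j + 2" n] B_comm_k[OF asym_B, of j "Suc j"]
    by simp (metis mult.assoc)
  have D: "d n (j + 2) * k (Suc j) \<in> B n" using jn n by (auto intro!: B_intros)
  note step = trace_asym_step[OF t _ def D comm]
  have X: "q ^ j * ?X = qnum q (Suc j) * ?Y1 + qnum q j * ?Y + zt n' t' j"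
    by (rule power_sum_step[OF t' def' jn])
  have "qnum q (Suc j) * ?Z1 = inverse \<mu> * q ^ j * xq j * ?X
      - wq j / lam * zt n' t' j + qnum q j * lam * (q * inverse \<mu> * xq j / wq j) * ?Y"
  proof (cases "j = 0")
    case True
    then show ?thesis using step jn n T0 by (simp add: zt_def xq_def)
  next
    case False
    then have j1: "1 \<le> j" by simp
    have w: "wq j \<noteq> 0" using def j1 jn n by (auto simp: asym_defined_def)
    have dj: "d n' (Suc j) * s j = d n' j" using d_rec[OF jn] by simp
    have T1: "t (asym j * (d n (j + 2) * (k (Suc j) * k j))) = ?Y"
      using turn[OF t n jn, of "k j" "s j" 1] j1 k2k1si2[of j]
      by (simp add: t'_def dj mult.assoc B_k B_s)
    have "k (Suc j) * (si j * si (Suc j)) = k (Suc j) * k j"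
      using k2si1[of j] by (simp flip: mult.assoc) (simp add: mult.assoc)
    then have T2: "t (asym j * (d n (j + 2) * (k (Suc j) * si j))) = ?Z"
      using turn[OF t n jn, of "si j" "k j" 1] j1 by (simp add: t'_def mult.assoc B_k B_si)
    \<comment> \<open>The skein relation reduces s_j to the three cases already evaluated.\<close>
    have "s j = si j + lam \<odot> 1 - lam \<odot> k j" by (simp add: si_eq)
    then have "asym j * (d n (j + 2) * (k (Suc j) * s j)) =
      asym j * (d n (j + 2) * (k (Suc j) * si j)) + lam \<odot> (asym j * (d n (j + 2) * k (Suc j)))
      - lam \<odot> (asym j * (d n (j + 2) * (k (Suc j) * k j)))"
      by (simp add: distrib_left right_diff_distrib)
    then have T3: "t (asym j * (d n (j + 2) * (k (Suc j) * s j))) = ?Z + lam * (inverse \<mu> * ?X) - lam * ?Y"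
      using T0 T1 T2 by (simp add: trace_add[OF t] trace_diff[OF t] trace_scale[OF t])
    have "qnum q (Suc j) * ?Z1 = q ^ j * (inverse \<mu> * ?X)
      - qnum q j * (?Z + lam * (inverse \<mu> * ?X) - lam * ?Y) - lam * qnum q j / wq j * ?Y"
      using step jn n T0 T1 T3 by (simp add: mult.assoc)
    also have "\<dots> = inverse \<mu> * (q ^ j - lam * qnum q j) * ?X - qnum q j * ?Z
        + qnum q j * lam * ((wq j - 1) / wq j) * ?Y"
      using w by (simp add: field_simps)
    also have "q ^ j - lam * qnum q j = q ^ j * xq j"
      using xq_lam[of j] by (simp add: algebra_simps)
    also have "qnum q j * ?Z = wq j / lam * zt n' t' j"
      using w lam_nonzero by (simp add: zt_def)
    also have "wq j - 1 = q * inverse \<mu> * xq j" by (simp add: wq_def)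
    finally show ?thesis by (simp add: mult.assoc)
  qed
  also have "inverse \<mu> * q ^ j * xq j * ?X = inverse \<mu> * xq j * (q ^ j * ?X)" by simp
  finally have E: "qnum q (Suc j) * ?Z1 = inverse \<mu> * xq j * (q ^ j * ?X) - wq j / lam * zt n' t' j
      + qnum q j * lam * (q * inverse \<mu> * xq j / wq j) * ?Y" .
  have lz: "lam * (wq j / lam * zt n' t' j) = wq j * zt n' t' j" by simp
  have Z1: "lam * (qnum q (Suc j) * ?Z1) = lam * inverse \<mu> * xq j * qnum q (Suc j) * ?Y1
      + (lam * inverse \<mu> * xq j - wq j) * zt n' t' j
      + qnum q j * lam * (inverse \<mu> * xq j + lam * (q * inverse \<mu> * xq j / wq j)) * ?Y"
    unfolding E distrib_left right_diff_distrib lz unfolding X by (simp add: algebra_simps)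
  have c1: "lam * inverse \<mu> * xq j - wq j = - wq (Suc j)"
    unfolding wq_Suc unfolding wq_def lam_def by (simp add: algebra_simps)
  have c2: "qnum q j * lam * (inverse \<mu> * xq j + lam * (q * inverse \<mu> * xq j / wq j)) * ?Y
      = wq (Suc j) * yt n' t' j"
  proof (cases "j = 0")
    case False
    then have w: "wq j \<noteq> 0" using def jn n by (auto simp: asym_defined_def)
    have e: "wq j + lam * q = q\<^sup>2 * wq (Suc j)"
      unfolding wq_Suc unfolding wq_def lam_def by (simp add: algebra_simps power2_eq_square)
    have "inverse \<mu> * xq j + lam * (q * inverse \<mu> * xq j / wq j) = inverse \<mu> * xq j * (wq j + lam * q) / wq j"
      using w by (simp add: field_simps)
    then have "inverse \<mu> * xq j + lam * (q * inverse \<mu> * xq j / wq j) = inverse \<mu> * xq j * (q\<^sup>2 * wq (Suc j)) / wq j"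
      unfolding e .
    then show ?thesis by (simp add: yt_def)
  qed (simp add: yt_def)
  have c3: "lam * inverse \<mu> * xq j * qnum q (Suc j) * ?Y1 = wq (Suc j) * yt n' t' (Suc j)"
    using w1 by (simp add: yt_def xq_Suc power2_eq_square)
  have "wq (Suc j) * zt n t (Suc j) = lam * (qnum q (Suc j) * ?Z1)"
    using w1 by (simp add: zt_def)
  also have "\<dots> = wq (Suc j) * (yt n' t' (Suc j) + yt n' t' j - zt n' t' j)"
    unfolding Z1 c1 c2 c3 by (simp add: algebra_simps)
  finally show ?thesis using w1 by simp
qed

text \<open>At the top index \<open>d\<close> is 1 and there is nothing to slide along. The traces
  with 1, k_n and s_n next to \<kappa>_{n+1} are eta, 1 and 1/\<mu> times t'(a^{(n)}), the last two
  by doubling \<kappa>_{n+1}. The coefficient \<mu> q^n - q^{1-n} of the final formula originates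
  here.\<close>

lemma zt_last:
  assumes t: "trace_on (Suc (Suc n)) t" and def: "asym_defined (Suc (Suc n))"
  defines "t' \<equiv> \<lambda>x. t (x * k (Suc n)) / eta"
  shows "zt (Suc (Suc n)) t (Suc n) = yt n t' n - (\<mu> * q ^ n - q * inverse q ^ n) * t' (asym n)"
proof -
  let ?g = "t' (asym n)" and ?N = "Suc (Suc n)"
  have w1: "wq (Suc n) \<noteq> 0" using def by (auto simp: asym_defined_def)
  have T0: "t (asym n * k (Suc n)) = eta * ?g" by (simp add: t'_def)
  have comm: "asym n * k (Suc n) = k (Suc n) * asym n" by (rule B_comm_k[OF asym_B]) simp
  have K: "k (Suc n) \<in> B ?N" by (simp add: B_k)
  have T: "t (asym n * (k (Suc n) * x)) = t (asym n * (k (Suc n) * (x * k (Suc n)))) / eta"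
    if x: "x \<in> B ?N" for x
  proof -
    have "eta * t (asym n * (k (Suc n) * x)) = t (asym n * (k (Suc n) * (k (Suc n) * x)))"
      by (simp add: trace_scale[OF t])
    also have "asym n * (k (Suc n) * (k (Suc n) * x)) = k (Suc n) * (asym n * (k (Suc n) * x))"
      by (metis comm mult.assoc)
    also have "t \<dots> = t (asym n * (k (Suc n) * x) * k (Suc n))"
      using x by (intro trace_cyc[OF t]) (auto intro!: B_intros)
    finally show ?thesis by (simp add: field_simps)
  qed
  note step = trace_asym_step[OF t _ def K comm, simplified]
  let ?Z1 = "t (asym (Suc n) * k (Suc n))"
  have lamw: "lam * eta = (q - \<mu>) * (inverse q + \<mu>) * inverse \<mu>" by (simp add: eta_def field_simps)
  show ?thesis
  proof (cases "n = 0")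
    case True
    have "qnum q (Suc 0) * ?Z1 = eta * ?g" using step T0 True by simp
    then have "zt ?N t (Suc n) = lam * eta / wq (Suc n) * ?g" using True by (simp add: zt_def)
    also have "lam * eta = (q - \<mu>) * wq (Suc n)"
      unfolding lamw wq_Suc True by (simp add: xq_def algebra_simps)
    finally have "zt ?N t (Suc n) = (q - \<mu>) * ?g" using w1 by simp
    then show ?thesis using True by (simp add: yt_def algebra_simps)
  next
    case False
    then have n1: "1 \<le> n" by simp
    have w: "wq n \<noteq> 0" using def n1 by (auto simp: asym_defined_def)
    have T1: "t (asym n * (k (Suc n) * k n)) = ?g"
      using T[of "k n"] n1 by (simp add: B_k k2k1k2 t'_def)
    have T2: "t (asym n * (k (Suc n) * s n)) = inverse \<mu> * ?g"
      using T[of "s n"] n1 by (simp add: B_s k2s1k2 t'_def trace_scale[OF t])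
    define Q P where "Q = q ^ n" and "P = inverse q ^ n"
    have QP: "Q * P = 1" by (simp add: Q_def P_def flip: power_mult_distrib)
    have x: "xq n = P * P" by (simp add: xq_def P_def mult_2 power_add)
    have ql: "lam * qnum q n = Q - P"
      using lam_nonzero by (simp add: qnum_def lam_def[symmetric] Q_def P_def)
    define u p where "u = inverse \<mu>" and "p = inverse q"
    have up: "u * \<mu> = 1" "p * q = 1" by (simp_all add: u_def p_def)
    define W where "W = 1 + p * u * (P * P)"
    define w where "w = 1 + q * u * (P * P)"
    have Ww: "wq (Suc n) = W" "wq n = w"
      by (simp_all add: W_def w_def wq_Suc x u_def p_def) (simp add: wq_def x)
    have lam: "lam = q - p" by (simp add: lam_def p_def)
    have "qnum q (Suc n) * ?Z1 = Q * (eta * ?g) - qnum q n * (u * ?g) - lam * qnum q n / wq n * ?g"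
      using step T0 T1 T2 by (simp add: Q_def u_def)
    then have "lam * (qnum q (Suc n) * ?Z1) =
       lam * (Q * (eta * ?g) - qnum q n * (u * ?g) - lam * qnum q n / wq n * ?g)" by simp
    also have "\<dots> = ((lam * eta) * Q - (lam * qnum q n) * u - lam * (lam * qnum q n) / wq n) * ?g"
      by (simp add: algebra_simps)
    also have "\<dots> = ((q - \<mu>) * (p + \<mu>) * u * Q - (Q - P) * u - (q - p) * (Q - P) / w) * ?g"
      unfolding lamw ql Ww by (simp add: u_def p_def lam_def)
    also have "(q - \<mu>) * (p + \<mu>) * u * Q - (Q - P) * u - (q - p) * (Q - P) / w
       = W * ((Q - P) * u * q\<^sup>2 * (P * P) / w - (\<mu> * Q - q * P))"
    proof -
      have "((q - \<mu>) * (p + \<mu>) * u * Q - (Q - P) * u) * w - (q - p) * (Q - P)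
         = W * ((Q - P) * u * q\<^sup>2 * (P * P) - (\<mu> * Q - q * P) * w)"
        using last_coeff[of q \<mu> Q]
        by (simp add: W_def w_def u_def p_def P_def Q_def power_inverse)
      then show ?thesis using w Ww by (simp add: field_simps)
    qed
    finally have "lam * (qnum q (Suc n) * ?Z1) = W * (((Q - P) * u * q\<^sup>2 * (P * P) / w - (\<mu> * Q - q * P)) * ?g)"
      by simp
    then have "zt ?N t (Suc n) = ((Q - P) * u * q\<^sup>2 * (P * P) / w - (\<mu> * Q - q * P)) * ?g"
      using w1 unfolding Ww by (simp add: zt_def Ww nonzero_divide_eq_eq mult_ac)
    also have "\<dots> = yt n t' n - (\<mu> * Q - q * P) * ?g"
      unfolding yt_def ql[symmetric] x Ww u_def[symmetric] by (simp add: algebra_simps)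
    finally show ?thesis by (simp add: Q_def P_def)
  qed
qed

section \<open>Summation over i: the Newton relations for a trace\<close>

lemma alternating_telescope:
  fixes y :: "nat \<Rightarrow> complex"
  shows "(\<Sum>j<n. (-1) ^ j * (y (Suc j) + y j)) = y 0 - (-1) ^ n * y n"
  by (induction n) (simp_all add: algebra_simps)

text \<open>By \<open>zt_step\<close> the terms below the top are those for t' and a telescoping sum
  in \<open>yt\<close>. Since \<open>yt\<close> is 0 at index 0, only its upper boundary term stays,
  and \<open>zt_last\<close> cancels it; what \<open>zt_last\<close> has left is the summand i =
  1.\<close>

lemma zt_sum:
  assumes "trace_on n t" "asym_defined n"
  shows "(\<Sum>i<n. (-1) ^ i * zt n t i) = (-1) ^ n * (\<Sum>i\<in>{1..n div 2}.
     (\<mu> * q powi (int n - 2 * int i) - q powi (1 - int n + 2 * int i)) * (t (asym (n - 2 * i) * kp n i) / eta ^ i))"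
  using assms
proof (induction n arbitrary: t rule: less_induct)
  case (less N)
  show ?case
  proof (cases "N < 2")
    case True
    then consider "N = 0" | "N = 1" by linarith
    then show ?thesis by cases (simp_all add: zt_def)
  next
    case False
    then obtain n where N: "N = Suc (Suc n)" by (metis add_2_eq_Suc le_add_diff_inverse linorder_not_less)
    define t' where "t' = (\<lambda>x. t (x * k (Suc n)) / eta)"
    have t: "trace_on (Suc (Suc n)) t" and def: "asym_defined (Suc (Suc n))" using less.prems N by auto
    have t': "trace_on n t'" unfolding t'_def by (rule trace_reduce[OF t])
    have def': "asym_defined n" using asym_defined_mono[OF def] by simp
    let ?c = "\<lambda>n i. \<mu> * q powi (int n - 2 * int i) - q powi (1 - int n + 2 * int i)"
    let ?f = "\<lambda>i. ?c N i * (t (asym (N - 2 * i) * kp N i) / eta ^ i)"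
    have z: "zt N t (Suc n) = yt n t' n - (\<mu> * q ^ n - q * inverse q ^ n) * t' (asym n)"
      unfolding N t'_def by (rule zt_last[OF t def])
    have split: "(\<Sum>i<N. h i) = h 0 + (\<Sum>j<n. h (Suc j)) + h (Suc n)" for h :: "nat \<Rightarrow> complex"
      unfolding N by (subst sum.lessThan_Suc_shift) simp
    have "(\<Sum>i<N. (-1) ^ i * zt N t i) = (\<Sum>j<n. (-1) ^ Suc j * zt N t (Suc j)) + (-1) ^ Suc n * zt N t (Suc n)"
      unfolding split[of "\<lambda>i. (-1) ^ i * zt N t i"] by (simp add: zt_def)
    also have "(\<Sum>j<n. (-1) ^ Suc j * zt N t (Suc j))
       = (\<Sum>j<n. (-1) ^ j * zt n t' j - (-1) ^ j * (yt n t' (Suc j) + yt n t' j))"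
    proof (rule sum.cong)
      fix j assume "j \<in> {..<n}"
      then have e: "zt N t (Suc j) = yt n t' (Suc j) + yt n t' j - zt n t' j"
        unfolding t'_def N using zt_step[OF t def refl] by simp
      show "(-1) ^ Suc j * zt N t (Suc j) = (-1) ^ j * zt n t' j - (-1) ^ j * (yt n t' (Suc j) + yt n t' j)"
        unfolding e by (simp add: algebra_simps)
    qed simp
    also have "\<dots> = (\<Sum>j<n. (-1) ^ j * zt n t' j) + (-1) ^ n * yt n t' n"
      unfolding sum_subtractf alternating_telescope[of "yt n t'"] by (simp add: yt_def)
    also have "(-1) ^ Suc n * zt N t (Suc n) = (-1) ^ n * ((\<mu> * q ^ n - q * inverse q ^ n) * t' (asym n)) - (-1) ^ n * yt n t' n"
      unfolding z by (simp add: algebra_simps)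
    also have "(\<Sum>j<n. (-1) ^ j * zt n t' j) = (-1) ^ n * (\<Sum>i\<in>{1..n div 2}. ?c n i * (t' (asym (n - 2 * i) * kp n i) / eta ^ i))"
      using less.IH[of n t'] t' def' N by simp
    \<comment> \<open>The coefficient depends on n - 2 i only, and t' appends one \<kappa> and one
      1/eta, so summand i for n strands is summand i + 1 for n + 2.\<close>
    also have "(\<Sum>i\<in>{1..n div 2}. ?c n i * (t' (asym (n - 2 * i) * kp n i) / eta ^ i)) = (\<Sum>i\<in>{1..n div 2}. ?f (Suc i))"
      by (intro sum.cong) (simp_all add: N t'_def mult.assoc mult_ac algebra_simps)
    also have "\<dots> = (\<Sum>i\<in>{Suc 1..Suc (n div 2)}. ?f i)"
      by (rule sum.shift_bounds_cl_Suc_ivl[symmetric])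
    also have "(\<mu> * q ^ n - q * inverse q ^ n) * t' (asym n) = ?f 1"
    proof -
      have "1 - int N + 2 = 1 + - int n" by (simp add: N)
      moreover have "q powi (1 + - int n) = q * inverse q ^ n"
        by (subst power_int_add) (auto simp: power_int_minus power_inverse)
      ultimately show ?thesis by (simp add: N t'_def)
    qed
    finally have "(\<Sum>i<N. (-1) ^ i * zt N t i) = (-1) ^ n * (?f 1 + (\<Sum>i\<in>{Suc 1..Suc (n div 2)}. ?f i))"
      by (simp add: algebra_simps)
    also have "?f 1 + (\<Sum>i\<in>{Suc 1..Suc (n div 2)}. ?f i) = (\<Sum>i\<in>{1..Suc (n div 2)}. ?f i)"
      by (rule sum.atLeast_Suc_atMost[symmetric]) simp
    finally show ?thesis by (simp add: N)
  qed
qed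

theorem newton_trace:
  assumes t: "trace_on n t" and def: "asym_defined n"
  shows "(\<Sum>i<n. (- q) ^ i * t (asym i * d n (Suc i))) = (-1) powi (int n - 1) * qnum q n * t (asym n)
    + (-1) ^ n * (\<Sum>i\<in>{1..n div 2}. (\<mu> * q powi (int n - 2 * int i) - q powi (1 - int n + 2 * int i))
        * (t (asym (n - 2 * i) * kp n i) / eta ^ i))"
proof -
  let ?y = "\<lambda>i. qnum q i * t (asym i * d n i)"
  have "(\<Sum>i<n. (- q) ^ i * t (asym i * d n (Suc i)))
    = (\<Sum>i<n. (-1) ^ i * (?y (Suc i) + ?y i) + (-1) ^ i * zt n t i)"
  proof (rule sum.cong)
    fix i assume "i \<in> {..<n}"
    then have "q ^ i * t (asym i * d n (Suc i)) = ?y (Suc i) + ?y i + zt n t i"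
      using power_sum_step[OF t def, of i] by simp
    moreover have "(- q) ^ i = (-1) ^ i * q ^ i" by (rule power_minus)
    ultimately show "(- q) ^ i * t (asym i * d n (Suc i)) = (-1) ^ i * (?y (Suc i) + ?y i) + (-1) ^ i * zt n t i"
      by (simp only: mult.assoc distrib_left)
  qed simp
  also have "\<dots> = - ((-1) ^ n * ?y n) + (\<Sum>i<n. (-1) ^ i * zt n t i)"
    unfolding sum.distrib alternating_telescope[of ?y] by simp
  also have "- ((-1) ^ n * ?y n) = (-1) powi (int n - 1) * qnum q n * t (asym n)"
    by (cases "even n") (simp_all add: power_int_minus_left)
  finally show ?thesis unfolding zt_sum[OF t def] .
qed

end

section \<open>Scalars in the free algebra\<close>

lemma scalar_add: "scalar (c + d) = scalar c + scalar d"
  by (simp add: scalar_def single_add)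

lemma scalar_mult: "scalar (c * d) = scalar c * scalar d"
  by (simp add: scalar_def mult_single)

lemma scalar_0 [simp]: "scalar 0 = 0"
  by (simp add: scalar_def)

lemma scalar_1 [simp]: "scalar 1 = 1"
  by (simp add: scalar_def)

lemma scalar_sum: "scalar (sum f A) = (\<Sum>x\<in>A. scalar (f x))"
  by (induction A rule: infinite_finite_induct) (simp_all add: scalar_add)

lemma poly_mapping_add_induct [case_names single add]:
  assumes "\<And>w c. P (Poly_Mapping.single w c)" and "\<And>p r. P p \<Longrightarrow> P r \<Longrightarrow> P (p + r)"
  shows "P (p :: 'k \<Rightarrow>\<^sub>0 'b::comm_monoid_add)"
proof (induction p rule: update_induct)
  case const
  then show ?case using assms(1)[of undefined 0] by simp
next
  case (update p a b)
  then have "Poly_Mapping.update a b p = p + Poly_Mapping.single a b"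
    by (intro poly_mapping_eqI) (auto simp: lookup_update lookup_add lookup_single in_keys_iff when_def)
  then show ?case using update assms by simp
qed

lemma scalar_central: "x * scalar c = scalar c * x"
  by (induction x rule: poly_mapping_add_induct)
    (simp_all add: scalar_def mult_single algebra_simps)

lemma scalar_left_commute: "x * (scalar c * y) = scalar c * (x * y)"
  by (metis mult.assoc scalar_central)

interpretation free: vector_space "\<lambda>c (x :: 'x free_algebra). scalar c * x"
  by standard (simp_all add: scalar_add scalar_mult algebra_simps)

section \<open>Linear operators on functions on index sequences\<close>

text \<open>A sequence \<open>x :: nat \<Rightarrow> 'v\<close> carries the index of factor \<open>m\<close> at \<open>x m\<close>; an operator on the first
  \<open>n\<close> factors only changes the positions \<open>1, \<dots>, n\<close>. Position 0 serves as an additional factor, so that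
  relations in factors 0, 1, 2 are transported to all positions, and back, by \<open>shift\<close>.\<close>

typedef ('v, 'x) lop = "{h :: ((nat \<Rightarrow> 'v) \<Rightarrow> 'x free_algebra) \<Rightarrow> (nat \<Rightarrow> 'v) \<Rightarrow> 'x free_algebra.
    (\<forall>f g. h (\<lambda>x. f x + g x) = (\<lambda>x. h f x + h g x)) \<and> (\<forall>c f. h (\<lambda>x. scalar c * f x) = (\<lambda>x. scalar c * h f x))}"
  morphisms app Lop
  by (rule exI[of _ "\<lambda>f. f"]) simp

setup_lifting type_definition_lop

lemma app_add: "app h (\<lambda>x. f x + g x) x = app h f x + app h g x"
  and app_scale: "app h (\<lambda>x. scalar c * f x) x = scalar c * app h f x"
  using app[of h] by auto

lemma lop_eqI: "(\<And>f x. app g f x = app h f x) \<Longrightarrow> g = h"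
  by (metis app_inject ext)

instantiation lop :: (type, type) ring_1
begin

lift_definition zero_lop :: "('a, 'b) lop" is "\<lambda>f x. 0" by simp
lift_definition one_lop :: "('a, 'b) lop" is "\<lambda>f. f" by simp
lift_definition plus_lop :: "('a, 'b) lop \<Rightarrow> ('a, 'b) lop \<Rightarrow> ('a, 'b) lop" is "\<lambda>g h f x. g f x + h f x"
  by (simp add: fun_eq_iff algebra_simps)
lift_definition uminus_lop :: "('a, 'b) lop \<Rightarrow> ('a, 'b) lop" is "\<lambda>h f x. - h f x"
  by (simp add: fun_eq_iff algebra_simps)
lift_definition minus_lop :: "('a, 'b) lop \<Rightarrow> ('a, 'b) lop \<Rightarrow> ('a, 'b) lop" is "\<lambda>g h f x. g f x - h f x"
  by (simp add: fun_eq_iff algebra_simps)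
lift_definition times_lop :: "('a, 'b) lop \<Rightarrow> ('a, 'b) lop \<Rightarrow> ('a, 'b) lop" is "\<lambda>g h f. g (h f)"
  by simp

instance
proof
  show "(0 :: ('a, 'b) lop) \<noteq> 1"
  proof
    assume "(0 :: ('a, 'b) lop) = 1"
    then have "app (0 :: ('a, 'b) lop) (\<lambda>_. 1) undefined = app 1 (\<lambda>_. 1) undefined" by simp
    then show False by (simp add: zero_lop.rep_eq one_lop.rep_eq)
  qed
qed (rule lop_eqI; simp add: zero_lop.rep_eq one_lop.rep_eq plus_lop.rep_eq uminus_lop.rep_eq
    minus_lop.rep_eq times_lop.rep_eq algebra_simps app_add[simplified])+

end

lemmas app_simps = zero_lop.rep_eq one_lop.rep_eq plus_lop.rep_eq uminus_lop.rep_eq minus_lop.rep_eq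
  times_lop.rep_eq

lemma app_sum_left: "app (\<Sum>a\<in>A. h a) f x = (\<Sum>a\<in>A. app (h a) f x)"
  by (induction A rule: infinite_finite_induct) (simp_all add: app_simps)

text \<open>Operators are linear over the complex numbers only, so left multiplication is one of
  them for every element of the free algebra, scalars being central.\<close>

definition Lmul :: "'x free_algebra \<Rightarrow> ('v, 'x) lop" where
  "Lmul a = Lop (\<lambda>f x. a * f x)"

lemma app_Lmul: "app (Lmul a) f x = a * f x"
  unfolding Lmul_def by (subst Lop_inverse) (simp_all add: fun_eq_iff algebra_simps scalar_left_commute)

lift_definition lscale :: "complex \<Rightarrow> ('v, 'x) lop \<Rightarrow> ('v, 'x) lop" (infixr \<open>\<odot>\<close> 75) is
  "\<lambda>c h f x. scalar c * h f x"
  by (auto simp: fun_eq_iff distrib_left)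

text \<open>The matrix unit e_{ab} in factor m. Matrices acting in some factors are sums of products
  of these and left multiplications.\<close>

lift_definition munit :: "nat \<Rightarrow> 'v \<Rightarrow> 'v \<Rightarrow> ('v, 'x) lop" is
  "\<lambda>m a b f x. if x m = a then f (x(m := b)) else 0"
  by (auto simp: fun_eq_iff)

lift_definition shift :: "('v, 'x) lop \<Rightarrow> ('v, 'x) lop" is
  "\<lambda>h f x. h (\<lambda>y. f (case_nat (x 0) y)) (\<lambda>n. x (Suc n))"
  by (simp add: fun_eq_iff)

interpretation lop: complex_algebra "lscale :: complex \<Rightarrow> ('v, 'x) lop \<Rightarrow> _"
proof
  fix c c' :: complex and g h :: "('v, 'x) lop"
  show "c \<odot> (g + h) = c \<odot> g + c \<odot> h" "(c + c') \<odot> h = c \<odot> h + c' \<odot> h"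
    "c \<odot> c' \<odot> h = (c * c') \<odot> h" "1 \<odot> h = h" "c \<odot> g * h = c \<odot> (g * h)"
    by (rule lop_eqI; simp add: lscale.rep_eq app_simps free.scale_left_distrib distrib_left mult.assoc)+
  show "g * c \<odot> h = c \<odot> (g * h)"
    by (rule lop_eqI) (simp only: lscale.rep_eq times_lop.rep_eq app_scale)
qed

lemma lscale_Lmul: "c \<odot> h = Lmul (scalar c) * h"
  by (rule lop_eqI) (simp add: lscale.rep_eq app_Lmul app_simps)

lemma Lmul_mult: "Lmul (a * b) = Lmul a * Lmul b"
  and Lmul_add: "Lmul (a + b) = Lmul a + Lmul b"
  and Lmul_1 [simp]: "Lmul 1 = 1"
  by (rule lop_eqI; simp add: app_Lmul app_simps algebra_simps)+

lemma munit_mult: "munit m a b * munit m c d = (if b = c then munit m a d else 0)"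
  by (rule lop_eqI) (simp add: munit.rep_eq app_simps)

lemma munit_comm: "m \<noteq> m' \<Longrightarrow> munit m a b * munit m' c d = munit m' c d * munit m a b"
  by (rule lop_eqI) (simp add: munit.rep_eq app_simps fun_upd_twist)

lemma munit_Lmul: "munit m a b * Lmul c = Lmul c * munit m a b"
  by (rule lop_eqI) (simp add: munit.rep_eq app_Lmul app_simps)

lemma munit_1: "(\<Sum>a\<in>UNIV. munit m a a) = (1 :: ('v::finite, 'x) lop)"
proof (rule lop_eqI)
  fix f :: "(nat \<Rightarrow> 'v) \<Rightarrow> 'x free_algebra" and x
  have "app (\<Sum>a\<in>UNIV. munit m a a) f x = (\<Sum>a\<in>UNIV. if a = x m then f (x(m := a)) else 0)"
    by (simp add: app_sum_left munit.rep_eq eq_commute)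
  then show "app (\<Sum>a\<in>UNIV. munit m a a) f x = app 1 f x" by (simp add: app_simps)
qed

lemma case_nat_eta: "case_nat (x 0) (\<lambda>n. x (Suc n)) = x"
  by (auto simp: fun_eq_iff split: nat.split)

lemma shift_add: "shift (g + h) = shift g + shift h"
  and shift_mult: "shift (g * h) = shift g * shift h"
  and shift_1 [simp]: "shift 1 = 1"
  and shift_scale: "shift (c \<odot> h) = c \<odot> shift h"
  by (rule lop_eqI; simp add: shift.rep_eq app_simps lscale.rep_eq case_nat_eta)+

lemma shift_munit: "shift (munit m a b) = (munit (Suc m) a b :: ('v, 'x) lop)"
proof (rule lop_eqI)
  fix f :: "(nat \<Rightarrow> 'v) \<Rightarrow> 'x free_algebra" and x
  have "case_nat (x 0) ((\<lambda>n. x (Suc n))(m := b)) = x(Suc m := b)"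
    by (auto simp: fun_eq_iff split: nat.split)
  then show "app (shift (munit m a b)) f x = app (munit (Suc m) a b) f x"
    by (simp add: shift.rep_eq munit.rep_eq)
qed

lemma shift_sum: "shift (sum h A) = (\<Sum>a\<in>A. shift (h a))"
  by (induction A rule: infinite_finite_induct)
    (simp_all add: shift_add, (rule lop_eqI; simp add: shift.rep_eq app_simps)+)

section \<open>Matrices acting in one or two factors\<close>

definition act1 :: "'v::finite op1 \<Rightarrow> nat \<Rightarrow> ('v, 'x) lop" where
  "act1 Y m = (\<Sum>a\<in>UNIV. \<Sum>b\<in>UNIV. Y $ a $ b \<odot> munit m a b)"

definition act2 :: "'v::finite op2 \<Rightarrow> nat \<Rightarrow> ('v, 'x) lop" where
  "act2 X m = (\<Sum>a\<in>UNIV. \<Sum>b\<in>UNIV. \<Sum>c\<in>UNIV. \<Sum>d\<in>UNIV.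
     X $ (a, b) $ (c, d) \<odot> (munit m a c * munit (Suc m) b d))"

lemma sum_delta_if:
  fixes F :: "'i::finite \<Rightarrow> 'a::comm_monoid_add"
  shows "(\<Sum>a\<in>UNIV. if x = a then F a else 0) = F x"
  by (simp add: eq_commute[of x])

lemma app_act1: "app (act1 Y m) f x = (\<Sum>b\<in>UNIV. scalar (Y $ x m $ b) * f (x(m := b)))"
  unfolding act1_def
  by (simp add: app_sum_left lscale.rep_eq munit.rep_eq if_distrib cong: if_cong)
    (subst sum.swap, simp add: sum_delta_if)

lemma app_act2: "app (act2 X m) f x =
  (\<Sum>c\<in>UNIV. \<Sum>d\<in>UNIV. scalar (X $ (x m, x (Suc m)) $ (c, d)) * f (x(m := c, Suc m := d)))"
proof -
  have "app (act2 X m) f x = (\<Sum>a\<in>UNIV. if x m = a then \<Sum>b\<in>UNIV. if x (Suc m) = b then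
    (\<Sum>c\<in>UNIV. \<Sum>d\<in>UNIV. scalar (X $ (a, b) $ (c, d)) * f (x(m := c, Suc m := d))) else 0 else 0)"
  proof -
    have "app (X $ (a, b) $ (c, d) \<odot> (munit m a c * munit (Suc m) b d)) f x = (if x m = a then if x (Suc m) = b then
      scalar (X $ (a, b) $ (c, d)) * f (x(m := c, Suc m := d)) else 0 else 0)" for a b c d
      by (simp add: lscale.rep_eq munit.rep_eq app_simps)
    then have "(\<Sum>c\<in>UNIV. \<Sum>d\<in>UNIV. app (X $ (a, b) $ (c, d) \<odot> (munit m a c * munit (Suc m) b d)) f x)
      = (if x m = a then if x (Suc m) = b then \<Sum>c\<in>UNIV. \<Sum>d\<in>UNIV.
      scalar (X $ (a, b) $ (c, d)) * f (x(m := c, Suc m := d)) else 0 else 0)" for a b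
      by simp
    then show ?thesis
      unfolding act2_def app_sum_left by (intro sum.cong refl) simp
  qed
  then show ?thesis by (simp add: sum_delta_if)
qed

lemma act2_mult: "act2 (X ** Y) m = (act2 X m * act2 Y m :: ('v::finite, 'x) lop)"
proof (rule lop_eqI)
  fix f :: "(nat \<Rightarrow> 'v) \<Rightarrow> 'x free_algebra" and x
  let ?p = "(x m, x (Suc m))" and ?g = "\<lambda>r. f (x(m := fst r, Suc m := snd r))"
  have pair: "(\<Sum>c\<in>UNIV. \<Sum>d\<in>UNIV. h (c, d)) = (\<Sum>r\<in>UNIV. h r)" for h :: "'v \<times> 'v \<Rightarrow> 'x free_algebra"
    by (simp add: sum.cartesian_product)
  have "app (act2 (X ** Y) m) f x = (\<Sum>r\<in>UNIV. scalar ((X ** Y) $ ?p $ r) * ?g r)"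
    unfolding app_act2 pair[symmetric] by simp
  also have "\<dots> = (\<Sum>r\<in>UNIV. \<Sum>z\<in>UNIV. scalar (X $ ?p $ z) * (scalar (Y $ z $ r) * ?g r))"
    by (simp add: matrix_matrix_mult_def scalar_sum sum_distrib_right)
  also have "\<dots> = (\<Sum>z\<in>UNIV. \<Sum>r\<in>UNIV. scalar (X $ ?p $ z) * (scalar (Y $ z $ r) * ?g r))"
    by (rule sum.swap)
  also have "\<dots> = (\<Sum>z\<in>UNIV. scalar (X $ ?p $ z) * (\<Sum>r\<in>UNIV. scalar (Y $ z $ r) * ?g r))"
    by (simp add: sum_distrib_left)
  also have "\<dots> = app (act2 X m * act2 Y m) f x"
    unfolding app_simps app_act2 pair[symmetric] by simp
  finally show "app (act2 (X ** Y) m) f x = app (act2 X m * act2 Y m) f x" .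
qed

lemma act2_mat: "act2 (mat c) m = (c \<odot> 1 :: ('v::finite, 'x) lop)"
proof (rule lop_eqI)
  fix f :: "(nat \<Rightarrow> 'v) \<Rightarrow> 'x free_algebra" and x
  have "app (act2 (mat c) m) f x = (\<Sum>a\<in>UNIV. if x m = a then \<Sum>b\<in>UNIV. if x (Suc m) = b then
      scalar c * f (x(m := a, Suc m := b)) else 0 else 0)"
    unfolding app_act2
  proof (intro sum.cong refl)
    fix a
    show "(\<Sum>d\<in>UNIV. scalar (mat c $ (x m, x (Suc m)) $ (a, d)) * f (x(m := a, Suc m := d)))
      = (if x m = a then \<Sum>b\<in>UNIV. if x (Suc m) = b then scalar c * f (x(m := a, Suc m := b)) else 0 else 0)"
      by (cases "x m = a") (auto simp: mat_def if_distrib[of scalar] if_distribR sum_delta_if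
          if_distrib[of "\<lambda>z. z * _"] cong: if_cong)
  qed
  then show "app (act2 (mat c) m) f x = app (c \<odot> 1) f x"
    by (simp add: sum_delta_if lscale.rep_eq app_simps)
qed

lemma act2_add: "act2 (X + Y) m = act2 X m + act2 Y m"
  and act2_diff: "act2 (X - Y) m = act2 X m - act2 Y m"
  by (simp_all add: act2_def lop.scale_left_distrib lop.scale_left_diff_distrib sum.distrib sum_subtractf)

lemma shift_act2: "shift (act2 X m) = act2 X (Suc m)"
  by (simp add: act2_def shift_sum shift_scale shift_mult shift_munit)

lemma comm_mult: "x * a = a * x \<Longrightarrow> x * b = b * x \<Longrightarrow> x * (a * b) = a * b * (x :: 'a::semigroup_mult)"
  by (metis mult.assoc)

lemma act2_munit_comm:
  "j \<noteq> m \<Longrightarrow> j \<noteq> Suc m \<Longrightarrow> munit j a b * act2 X m = act2 X m * munit j a b"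
  unfolding act2_def sum_distrib_left sum_distrib_right
  by (intro sum.cong refl) (simp only: lop.mult_scale_left lop.mult_scale_right,
      intro arg_cong[of _ _ "lscale _"] comm_mult munit_comm)

lemma act1_munit_comm: "j \<noteq> m \<Longrightarrow> munit j a b * act1 Y m = act1 Y m * munit j a b"
  unfolding act1_def sum_distrib_left sum_distrib_right
  by (intro sum.cong refl) (simp add: munit_comm)

lemma comm_act2:
  assumes "\<And>a b. munit m a b * h = h * munit m a b" "\<And>a b. munit (Suc m) a b * h = h * munit (Suc m) a b"
  shows "act2 X m * h = h * act2 X m"
  unfolding act2_def sum_distrib_left sum_distrib_right
  by (intro sum.cong refl) (simp only: lop.mult_scale_left lop.mult_scale_right,
      intro arg_cong[of _ _ "lscale _"] comm_mult[symmetric] assms[symmetric])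

lemma comm_act1:
  assumes "\<And>a b. munit m a b * h = h * munit m a b"
  shows "act1 Y m * h = h * act1 Y m"
  unfolding act1_def sum_distrib_left sum_distrib_right
  by (intro sum.cong refl) (simp add: assms)

lemma act2_far: "Suc i < j \<Longrightarrow> act2 X i * act2 Y j = act2 Y j * act2 X i"
  by (rule comm_act2) (simp_all add: act2_munit_comm)

section \<open>From matrices indexed by lists to operators on sequences\<close>

definition upd :: "nat \<Rightarrow> 'v list \<Rightarrow> (nat \<Rightarrow> 'v) \<Rightarrow> nat \<Rightarrow> 'v" where
  "upd n ys x = (\<lambda>k. if 1 \<le> k \<and> k \<le> n then ys ! (k - 1) else x k)"

definition pre :: "nat \<Rightarrow> (nat \<Rightarrow> 'v) \<Rightarrow> 'v list" where
  "pre n x = map x [1..<Suc n]"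

lemma length_pre [simp]: "length (pre n x) = n"
  by (simp add: pre_def)

lemma nth_pre [simp]: "i < n \<Longrightarrow> pre n x ! i = x (Suc i)"
  by (simp add: pre_def del: upt_Suc)

lemma pre_upd [simp]: "length ys = n \<Longrightarrow> pre n (upd n ys x) = ys"
  by (rule nth_equalityI) (simp_all add: upd_def)

lemma upd_upd [simp]: "upd n zs (upd n ys x) = upd n zs x"
  by (auto simp: upd_def fun_eq_iff)

lemma upd_pre [simp]: "upd n (pre n x) x = x"
  by (auto simp: upd_def fun_eq_iff)

lemma upd_0: "upd 0 ys x = x"
  by (auto simp: upd_def fun_eq_iff)

lemma finite_lists [simp]: "finite {ys :: 'v::finite list. length ys = n}"
  using finite_lists_length_eq[OF finite[of "UNIV :: 'v set"], of n] by simp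

text \<open>The matrix acts in positions 1, ..., n and the identity elsewhere. Only entries between
  lists of length n are read, as in \<open>teq n\<close>.\<close>

definition rep :: "nat \<Rightarrow> ('v::finite, 'x free_algebra) tensor_op \<Rightarrow> ('v, 'x) lop" where
  "rep n A = Lop (\<lambda>f x. \<Sum>ys | length ys = n. A (pre n x) ys * f (upd n ys x))"

lemma app_rep: "app (rep n A) f x = (\<Sum>ys | length ys = n. A (pre n x) ys * f (upd n ys x))"
  unfolding rep_def
  by (subst Lop_inverse)
    (simp_all add: fun_eq_iff distrib_left sum.distrib sum_distrib_left scalar_left_commute)

lemma rep_cong: "(\<And>xs ys. length xs = n \<Longrightarrow> length ys = n \<Longrightarrow> A xs ys = B xs ys) \<Longrightarrow> rep n A = rep n B"
  by (rule lop_eqI) (auto simp: app_rep intro!: sum.cong)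

lemma rep_tmul: "rep n (A \<bullet>\<bullet> B) = rep n A * rep n B"
proof (rule lop_eqI)
  fix f x
  let ?L = "{ys :: 'a list. length ys = n}"
  have "app (rep n (A \<bullet>\<bullet> B)) f x = (\<Sum>ys\<in>?L. \<Sum>zs\<in>?L. A (pre n x) zs * (B zs ys * f (upd n ys x)))"
    by (simp add: app_rep tmul_def sum_distrib_right mult.assoc)
  also have "\<dots> = (\<Sum>zs\<in>?L. \<Sum>ys\<in>?L. A (pre n x) zs * (B zs ys * f (upd n ys x)))"
    by (rule sum.swap)
  also have "\<dots> = app (rep n A * rep n B) f x"
    by (simp add: app_rep app_simps sum_distrib_left)
  finally show "app (rep n (A \<bullet>\<bullet> B)) f x = app (rep n A * rep n B) f x" .
qed

lemma rep_tid: "rep n tid = 1"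
proof (rule lop_eqI)
  fix f :: "(nat \<Rightarrow> 'a) \<Rightarrow> 'b free_algebra" and x :: "nat \<Rightarrow> 'a"
  have "app (rep n tid) f x = (\<Sum>ys | length ys = n. if ys = pre n x then f (upd n ys x) else 0)"
    unfolding app_rep tid_def by (intro sum.cong) auto
  then show "app (rep n tid) f x = app 1 f x"
    by (simp add: app_simps)
qed

lemma lift_tmul: "lift (A \<bullet>\<bullet> B) = lift A \<bullet>\<bullet> lift B"
  by (simp add: fun_eq_iff lift_def tmul_def scalar_sum scalar_mult)

lemma lift_tid: "lift tid = tid"
  by (simp add: fun_eq_iff lift_def tid_def of_bool_def)

lemma rep_lift_cong: "teq n A B \<Longrightarrow> rep n (lift A) = rep n (lift B)"
  by (rule rep_cong) (simp add: lift_def teq_def)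

text \<open>Only lists that agree with x outside the factors i and i + 1 contribute, and pairs index
  these. List position i - 1 is sequence position i.\<close>

lemma rep_site:
  assumes "1 \<le> i" "i < n"
  shows "rep n (lift (site X i)) = act2 X i"
proof (rule lop_eqI)
  fix f :: "(nat \<Rightarrow> 'a) \<Rightarrow> 'b free_algebra" and x :: "nat \<Rightarrow> 'a"
  let ?P = "\<lambda>ys. \<forall>k<n. k \<noteq> i - 1 \<and> k \<noteq> i \<longrightarrow> x (Suc k) = ys ! k"
  let ?u = "\<lambda>(c, d). x(i := c, Suc i := d)"
  have "app (rep n (lift (site X i))) f x
    = (\<Sum>ys | length ys = n. if ?P ys then scalar (X $ (x i, x (Suc i)) $ (ys ! (i - 1), ys ! i)) * f (upd n ys x) else 0)"
    unfolding app_rep lift_def site2_def using assms by (intro sum.cong) (auto simp: Suc_diff_Suc)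
  also have "\<dots> = (\<Sum>ys | length ys = n \<and> ?P ys. scalar (X $ (x i, x (Suc i)) $ (ys ! (i - 1), ys ! i)) * f (upd n ys x))"
    by (subst sum.inter_filter[symmetric]) (simp_all add: conj_commute)
  also have "\<dots> = (\<Sum>cd\<in>UNIV. scalar (X $ (x i, x (Suc i)) $ cd) * f (?u cd))"
  proof (rule sum.reindex_bij_witness[where j = "\<lambda>ys. (ys ! (i - 1), ys ! i)" and i = "\<lambda>cd. pre n (?u cd)"])
    fix ys assume ys: "ys \<in> {ys. length ys = n \<and> ?P ys}"
    have u: "?u (ys ! (i - 1), ys ! i) = upd n ys x"
    proof
      fix m
      show "?u (ys ! (i - 1), ys ! i) m = upd n ys x m"
        using ys assms by (cases m) (auto simp: upd_def)
    qed
    then show "pre n (?u (ys ! (i - 1), ys ! i)) = ys" using ys by simp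
    show "scalar (X $ (x i, x (Suc i)) $ (ys ! (i - 1), ys ! i)) * f (?u (ys ! (i - 1), ys ! i))
      = scalar (X $ (x i, x (Suc i)) $ (ys ! (i - 1), ys ! i)) * f (upd n ys x)" unfolding u ..
  next
    fix cd :: "'a \<times> 'a"
    show "(pre n (?u cd) ! (i - 1), pre n (?u cd) ! i) = cd"
      using assms by (cases cd) (auto simp: Suc_diff_Suc)
    show "pre n (?u cd) \<in> {ys. length ys = n \<and> ?P ys}"
      using assms by (cases cd) auto
  qed auto
  also have "\<dots> = app (act2 X i) f x"
    unfolding app_act2 by (simp add: sum.cartesian_product case_prod_unfold)
  finally show "app (rep n (lift (site X i))) f x = app (act2 X i) f x" .
qed

definition actA :: "'x free_algebra^'v^'v \<Rightarrow> nat \<Rightarrow> ('v::finite, 'x) lop" where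
  "actA Y m = (\<Sum>a\<in>UNIV. \<Sum>b\<in>UNIV. Lmul (Y $ a $ b) * munit m a b)"

lemma app_actA: "app (actA Y m) f x = (\<Sum>b\<in>UNIV. Y $ x m $ b * f (x(m := b)))"
proof -
  have "app (actA Y m) f x = (\<Sum>a\<in>UNIV. \<Sum>b\<in>UNIV. if x m = a then Y $ a $ b * f (x(m := b)) else 0)"
    unfolding actA_def app_sum_left by (intro sum.cong refl) (simp add: app_Lmul munit.rep_eq app_simps)
  also have "\<dots> = (\<Sum>a\<in>UNIV. if x m = a then \<Sum>b\<in>UNIV. Y $ a $ b * f (x(m := b)) else 0)"
    by (intro sum.cong refl) simp
  finally show ?thesis by (simp add: sum_delta_if)
qed

lemma rep_site1:
  assumes "1 \<le> m" "m \<le> n"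
  shows "rep n (site1 Y m) = actA Y m"
proof (rule lop_eqI)
  fix f :: "(nat \<Rightarrow> 'a) \<Rightarrow> 'b free_algebra" and x :: "nat \<Rightarrow> 'a"
  let ?P = "\<lambda>ys. \<forall>k<n. k \<noteq> m - 1 \<longrightarrow> x (Suc k) = ys ! k"
  have "app (rep n (site1 Y m)) f x
    = (\<Sum>ys | length ys = n. if ?P ys then Y $ x m $ (ys ! (m - 1)) * f (upd n ys x) else 0)"
    unfolding app_rep site1_def using assms by (intro sum.cong) (auto simp: Suc_diff_Suc)
  also have "\<dots> = (\<Sum>ys | length ys = n \<and> ?P ys. Y $ x m $ (ys ! (m - 1)) * f (upd n ys x))"
    by (subst sum.inter_filter[symmetric]) (simp_all add: conj_commute)
  also have "\<dots> = (\<Sum>b\<in>UNIV. Y $ x m $ b * f (x(m := b)))"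
  proof (rule sum.reindex_bij_witness[where j = "\<lambda>ys. ys ! (m - 1)" and i = "\<lambda>b. pre n (x(m := b))"])
    fix ys assume ys: "ys \<in> {ys. length ys = n \<and> ?P ys}"
    have u: "x(m := ys ! (m - 1)) = upd n ys x"
    proof
      fix j
      show "(x(m := ys ! (m - 1))) j = upd n ys x j"
        using ys assms by (cases j) (auto simp: upd_def)
    qed
    then show "pre n (x(m := ys ! (m - 1))) = ys" using ys by simp
    show "Y $ x m $ (ys ! (m - 1)) * f (x(m := ys ! (m - 1))) = Y $ x m $ (ys ! (m - 1)) * f (upd n ys x)"
      unfolding u ..
  next
    fix b
    show "pre n (x(m := b)) ! (m - 1) = b" using assms by simp
    show "pre n (x(m := b)) \<in> {ys. length ys = n \<and> ?P ys}" using assms by auto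
  qed auto
  finally show "app (rep n (site1 Y m)) f x = app (actA Y m) f x"
    unfolding app_actA .
qed

lemma rep_lift_site1:
  assumes "1 \<le> m" "m \<le> n"
  shows "rep n (lift (site1 D m)) = (act1 D m :: ('v::finite, 'x) lop)"
proof -
  have "(lift (site1 D m) :: ('v, 'x free_algebra) tensor_op) = site1 (\<chi> a b. scalar (D $ a $ b)) m"
    by (auto simp: fun_eq_iff lift_def site1_def of_bool_def)
  then show ?thesis
    by (simp add: rep_site1[OF assms] actA_def act1_def lscale_Lmul)
qed

text \<open>The trace over factor \<open>m\<close>, with the identity put back in that factor.\<close>

definition trm :: "nat \<Rightarrow> ('v::finite, 'x) lop \<Rightarrow> ('v, 'x) lop" where
  "trm m h = (\<Sum>a\<in>UNIV. \<Sum>c\<in>UNIV. munit m c a * h * munit m a c)"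

lemma app_trm: "app (trm m h) f x = (\<Sum>a\<in>UNIV. app h (\<lambda>y. if y m = a then f (y(m := x m)) else 0) (x(m := a)))"
proof -
  have "app (trm m h) f x = (\<Sum>a\<in>UNIV. \<Sum>c\<in>UNIV. if x m = c then
      app h (\<lambda>y. if y m = a then f (y(m := c)) else 0) (x(m := a)) else 0)"
    unfolding trm_def app_sum_left by (intro sum.cong refl) (simp add: munit.rep_eq app_simps)
  then show ?thesis by (simp add: sum_delta_if)
qed

fun trN :: "nat \<Rightarrow> ('v::finite, 'x) lop \<Rightarrow> ('v, 'x) lop" where
  "trN 0 h = h"
| "trN (Suc n) h = trN n (trm (Suc n) h)"

lemma sum_lists_snoc:
  "(\<Sum>ys :: 'v::finite list | length ys = Suc n. F ys) = (\<Sum>ys | length ys = n. \<Sum>b\<in>UNIV. F (ys @ [b]))"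
proof -
  have "(\<Sum>ys :: 'v list | length ys = n. \<Sum>b\<in>UNIV. F (ys @ [b])) = (\<Sum>(ys, b)\<in>{ys. length ys = n} \<times> UNIV. F (ys @ [b]))"
    by (simp add: sum.cartesian_product)
  also have "\<dots> = (\<Sum>ys | length ys = Suc n. F ys)"
    by (rule sum.reindex_bij_witness[where j = "\<lambda>(ys, b). ys @ [b]" and i = "\<lambda>ys. (butlast ys, last ys)"])
      (auto simp: length_Suc_conv_rev)
  finally show ?thesis by simp
qed

lemma trm_rep: "trm (Suc n) (rep (Suc n) A) = rep n (\<lambda>xs ys. \<Sum>a\<in>UNIV. A (xs @ [a]) (ys @ [a]))"
proof (rule lop_eqI)
  fix f :: "(nat \<Rightarrow> 'a) \<Rightarrow> 'b free_algebra" and x :: "nat \<Rightarrow> 'a"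
  have p: "pre (Suc n) (x(Suc n := a)) = pre n x @ [a]" for a
    by (simp add: pre_def)
  have u: "(upd (Suc n) (ys @ [a]) z)(Suc n := x (Suc n)) = upd n ys x" "upd (Suc n) (ys @ [b]) z (Suc n) = b"
    if "length ys = n" "z = x(Suc n := a)" for ys a b z
    using that by (auto simp: upd_def fun_eq_iff nth_append)
  have "app (trm (Suc n) (rep (Suc n) A)) f x = (\<Sum>a\<in>UNIV. \<Sum>ys | length ys = n. \<Sum>b\<in>UNIV.
      A (pre n x @ [a]) (ys @ [b]) * (if b = a then f (upd n ys x) else 0))"
    unfolding app_trm app_rep sum_lists_snoc p by (intro sum.cong refl) (auto simp: u)
  also have "\<dots> = (\<Sum>a\<in>UNIV. \<Sum>ys | length ys = n. A (pre n x @ [a]) (ys @ [a]) * f (upd n ys x))"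
    by (simp add: if_distrib[of "\<lambda>z. _ * z"] cong: if_cong)
  also have "\<dots> = (\<Sum>ys | length ys = n. \<Sum>a\<in>UNIV. A (pre n x @ [a]) (ys @ [a]) * f (upd n ys x))"
    by (rule sum.swap)
  finally show "app (trm (Suc n) (rep (Suc n) A)) f x
    = app (rep n (\<lambda>xs ys. \<Sum>a\<in>UNIV. A (xs @ [a]) (ys @ [a]))) f x"
    by (simp add: app_rep sum_distrib_right)
qed

text \<open>After all n factors are traced out, the last one first, no factor is left to act in and
  only a left multiplication remains.\<close>

lemma trN_rep: "trN n (rep n A) = Lmul (tr n A)"
proof (induction n arbitrary: A)
  case 0
  show ?case by (rule lop_eqI) (simp add: app_rep app_Lmul tr_def pre_def upd_0)
next
  case (Suc n)
  then show ?case by (simp add: trm_rep tr_def sum_lists_snoc)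
qed

section \<open>Evaluation of braid words\<close>

fun gact :: "'v::finite op2 \<Rightarrow> braid_gen \<Rightarrow> ('v, 'x) lop" where
  "gact R (Sig i) = act2 R i"
| "gact R (SigInv i) = act2 (matrix_inv R) i"

definition wact :: "'v::finite op2 \<Rightarrow> braid_gen word \<Rightarrow> ('v, 'x) lop" where
  "wact R w = prod_list (map (gact R) (letters w))"

definition ev :: "'v::finite op2 \<Rightarrow> braid_alg \<Rightarrow> ('v, 'x) lop" where
  "ev R \<alpha> = (\<Sum>w\<in>Poly_Mapping.keys \<alpha>. Poly_Mapping.lookup \<alpha> w \<odot> wact R w)"

lemma ev_superset:
  assumes "finite W" "Poly_Mapping.keys \<alpha> \<subseteq> W"
  shows "ev R \<alpha> = (\<Sum>w\<in>W. Poly_Mapping.lookup \<alpha> w \<odot> wact R w)"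
  unfolding ev_def using assms by (intro sum.mono_neutral_left) (auto simp: in_keys_iff)

lemma ev_add: "ev R (\<alpha> + \<beta>) = ev R \<alpha> + ev R \<beta>"
proof -
  let ?W = "Poly_Mapping.keys \<alpha> \<union> Poly_Mapping.keys \<beta>"
  have "ev R (\<alpha> + \<beta>) = (\<Sum>w\<in>?W. Poly_Mapping.lookup (\<alpha> + \<beta>) w \<odot> wact R w)"
    by (rule ev_superset) (use keys_add[of \<alpha> \<beta>] in auto)
  also have "\<dots> = (\<Sum>w\<in>?W. Poly_Mapping.lookup \<alpha> w \<odot> wact R w) + (\<Sum>w\<in>?W. Poly_Mapping.lookup \<beta> w \<odot> wact R w)"
    by (simp add: lookup_add lop.scale_left_distrib sum.distrib)
  also have "\<dots> = ev R \<alpha> + ev R \<beta>"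
    by (simp add: ev_superset[of ?W])
  finally show ?thesis .
qed

lemma ev_single: "ev R (Poly_Mapping.single w c) = c \<odot> wact R w"
  by (subst ev_superset[of "{w}"]) auto

lemma wact_add: "wact R (v + w) = wact R v * wact R w"
  by (simp add: wact_def plus_word_def)

lemma ev_mult: "ev R (\<alpha> * \<beta>) = ev R \<alpha> * ev R \<beta>"
proof (induction \<alpha> rule: poly_mapping_add_induct)
  case (single w c)
  show ?case
    by (induction \<beta> rule: poly_mapping_add_induct)
      (simp_all add: mult_single ev_single ev_add wact_add distrib_left)
qed (simp add: distrib_right ev_add)

lemma ev_scalar: "ev R (scalar c) = c \<odot> 1"
  by (simp add: scalar_def ev_single wact_def zero_word_def)

lemma ev_1: "ev R 1 = 1"
  using ev_scalar[of R 1] by simp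

lemma ev_sigma: "ev R (sigma i) = act2 R i"
  by (simp add: sigma_def gen_def ev_single wact_def)

lemma ev_diff: "ev R (\<alpha> - \<beta>) = ev R \<alpha> - ev R \<beta>"
  by (metis add_diff_cancel_right' diff_add_cancel ev_add)

fun gen_in :: "nat \<Rightarrow> braid_gen \<Rightarrow> bool" where
  "gen_in n (Sig i) = (1 \<le> i \<and> i < n)"
| "gen_in n (SigInv i) = (1 \<le> i \<and> i < n)"

text \<open>Outside the range 1 \<le> i < n, \<open>site R i\<close> on lists of length n is no
  longer R in two neighbouring factors, so \<open>rho\<close> is compared with \<open>ev\<close>
  under this condition.\<close>

definition strands :: "nat \<Rightarrow> braid_alg \<Rightarrow> bool" where
  "strands n \<alpha> \<longleftrightarrow> (\<forall>w\<in>Poly_Mapping.keys \<alpha>. \<forall>g\<in>set (letters w). gen_in n g)"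

lemma strands_add: "strands n \<alpha> \<Longrightarrow> strands n \<beta> \<Longrightarrow> strands n (\<alpha> + \<beta>)"
  unfolding strands_def using keys_add[of \<alpha> \<beta>] by blast

lemma strands_mult: "strands n \<alpha> \<Longrightarrow> strands n \<beta> \<Longrightarrow> strands n (\<alpha> * \<beta>)"
  unfolding strands_def using keys_mult[of \<alpha> \<beta>] by (fastforce simp: plus_word_def)

lemma strands_scalar: "strands n (scalar c)"
  by (auto simp: strands_def scalar_def zero_word_def split: if_splits)

lemma strands_1: "strands n 1"
  using strands_scalar[of n 1] by simp

lemma strands_sigma: "1 \<le> i \<Longrightarrow> i < n \<Longrightarrow> strands n (sigma i)"
  by (auto simp: strands_def sigma_def gen_def)

lemma strands_diff: "strands n \<alpha> \<Longrightarrow> strands n \<beta> \<Longrightarrow> strands n (\<alpha> - \<beta>)"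
  using strands_add[of n \<alpha> "scalar (-1) * \<beta>"] strands_mult[OF strands_scalar, of n \<beta> "-1"]
    free.scale_minus_left[of 1 \<beta>] by simp

lemma rep_lift_sum:
  assumes "finite W"
  shows "rep n (lift (\<lambda>xs ys. \<Sum>w\<in>W. c w * A w xs ys)) = (\<Sum>w\<in>W. c w \<odot> rep n (lift (A w)))"
  by (rule lop_eqI)
    (simp add: app_rep app_sum_left lscale.rep_eq lift_def scalar_sum scalar_mult sum_distrib_left
      sum_distrib_right mult.assoc del: free.scale_scale, rule sum.swap)

lemma rep_rho:
  assumes "strands n \<alpha>"
  shows "rep n (lift (rho R \<alpha>)) = (ev R \<alpha> :: ('v::finite, 'x) lop)"
proof -
  have g: "rep n (lift (gen_op R g)) = (gact R g :: ('v, 'x) lop)" if "gen_in n g" for g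
    using that by (cases g) (simp_all add: rep_site[simplified])
  have w: "rep n (lift (foldr (\<lambda>g A. gen_op R g \<bullet>\<bullet> A) gs tid)) = (prod_list (map (gact R) gs) :: ('v, 'x) lop)"
    if "\<forall>g\<in>set gs. gen_in n g" for gs
    using that by (induction gs) (simp_all add: lift_tid rep_tid lift_tmul rep_tmul g)
  have "(rep n (lift (rho R \<alpha>)) :: ('v, 'x) lop) = (\<Sum>w\<in>Poly_Mapping.keys \<alpha>. Poly_Mapping.lookup \<alpha> w \<odot>
      rep n (lift (foldr (\<lambda>g A. gen_op R g \<bullet>\<bullet> A) (letters w) tid)))"
    unfolding rho_def by (rule rep_lift_sum) simp
  then show ?thesis
    using assms w by (simp add: ev_def wact_def strands_def)
qed

section \<open>Transport of relations to all positions, and sums over indices\<close>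

lemma shift_inj: "shift g = shift h \<Longrightarrow> g = h"
proof (rule lop_eqI)
  fix f :: "(nat \<Rightarrow> 'a) \<Rightarrow> 'b free_algebra" and x :: "nat \<Rightarrow> 'a"
  assume eq: "shift g = shift h"
  let ?f = "\<lambda>z. f (\<lambda>n. z (Suc n))" and ?x = "case_nat (x 0) x"
  have "app (shift g) ?f ?x = app (shift h) ?f ?x" using eq by simp
  then show "app g f x = app h f x" by (simp add: shift.rep_eq)
qed

text \<open>Hypotheses on three tensor factors are relations at index 1. Shifting gives the larger
  indices and injectivity of \<open>shift\<close> gives index 0.\<close>

lemma shift_transfer:
  assumes "\<And>i. shift (g i) = g (Suc i)" "\<And>i. shift (h i) = h (Suc i)" and "g 1 = h (1 :: nat)"
  shows "g i = h i"
proof (induction i)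
  case 0
  show ?case by (rule shift_inj) (use assms in simp)
next
  case (Suc i)
  then show ?case using assms by metis
qed

lemma rep_teq3:
  assumes "teq 3 A B"
  shows "rep 3 (lift A) = rep 3 (lift B)"
  by (rule rep_lift_cong[OF assms])

lemma sum_pairs:
  fixes h :: "'v::finite \<Rightarrow> 'v \<Rightarrow> 'a::comm_monoid_add"
  shows "(\<Sum>c\<in>UNIV. \<Sum>d\<in>UNIV. h c d) = (\<Sum>r\<in>UNIV. h (fst r) (snd r))"
  by (simp add: sum.cartesian_product case_prod_unfold)

lemma sum_lists_3:
  fixes h :: "'v::finite list \<Rightarrow> 'a::comm_monoid_add"
  shows "(\<Sum>zs | length zs = Suc (Suc (Suc 0)). h zs) = (\<Sum>x\<in>UNIV. \<Sum>y\<in>UNIV. \<Sum>z\<in>UNIV. h [x, y, z])"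
  by (simp add: sum_lists_snoc)

lemma sum_of_bool_mult:
  fixes h :: "'v::finite \<Rightarrow> 'a::semiring_1"
  shows "(\<Sum>c\<in>UNIV. h c * of_bool (c = b)) = h b" "(\<Sum>c\<in>UNIV. h c * of_bool (b = c)) = h b"
    "(\<Sum>c\<in>UNIV. of_bool (c = b) * h c) = h b" "(\<Sum>c\<in>UNIV. of_bool (b = c) * h c) = h b"
  by (simp_all add: of_bool_def if_distrib[of "\<lambda>z. _ * z"] if_distrib[of "\<lambda>z. z * _"] cong: if_cong)

section \<open>The R-trace\<close>

lemma ptr_site2_product:
  fixes X Y :: "'v::finite op2"
  shows "ptr 2 (site2 X 1 2 \<bullet>\<bullet> site2 Y 2 3) [a, c] [b, d] = (\<Sum>r\<in>UNIV. X $ (a, fst r) $ (b, snd r) * Y $ (snd r, c) $ (fst r, d))"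
proof -
  have "ptr 2 (site2 X 1 2 \<bullet>\<bullet> site2 Y 2 3) [a, c] [b, d] = (\<Sum>k\<in>UNIV. \<Sum>x\<in>UNIV. \<Sum>y\<in>UNIV. \<Sum>z\<in>UNIV.
      X $ (a, k) $ (x, y) * of_bool (c = z) * (Y $ (y, z) $ (k, d) * of_bool (x = b)))"
    by (simp add: ptr_def tmul_def site2_def sum_lists_3 eval_nat_numeral All_less_Suc)
  also have "\<dots> = (\<Sum>k\<in>UNIV. \<Sum>x\<in>UNIV. (\<Sum>y\<in>UNIV. X $ (a, k) $ (x, y) * Y $ (y, c) $ (k, d)) * of_bool (x = b))"
    by (intro sum.cong refl) (simp add: of_bool_def sum_distrib_right if_distrib[of "\<lambda>z. _ * z"] if_distrib[of "\<lambda>z. z * _"] cong: if_cong)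
  finally show ?thesis by (simp add: sum_of_bool_mult sum_pairs)
qed

lemma flip_entry: "site2 flip 1 2 [a, c] [b, d] = of_bool (a = d \<and> c = b)"
  by (auto simp: site2_def flip_def less_Suc_eq)

lemma
  fixes R :: "'v::finite op2"
  assumes "skew_invertible R"
  shows skew_1: "(\<Sum>r\<in>UNIV. R $ (a, fst r) $ (b, snd r) * Psi R $ (snd r, c) $ (fst r, d)) = of_bool (a = d \<and> c = b)"
    and skew_2: "(\<Sum>r\<in>UNIV. Psi R $ (a, fst r) $ (b, snd r) * R $ (snd r, c) $ (fst r, d)) = of_bool (a = d \<and> c = b)"
proof -
  have "skew_inverse R (Psi R)"
    using assms unfolding skew_invertible_def Psi_def by (rule someI_ex)
  then have "ptr 2 (site2 R 1 2 \<bullet>\<bullet> site2 (Psi R) 2 3) [a, c] [b, d] = site2 flip 1 2 [a, c] [b, d]"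
    "ptr 2 (site2 (Psi R) 1 2 \<bullet>\<bullet> site2 R 2 3) [a, c] [b, d] = site2 flip 1 2 [a, c] [b, d]"
    unfolding skew_inverse_def teq_def by (metis length_Cons list.size(3) numeral_2_eq_2)+
  then show "(\<Sum>r\<in>UNIV. R $ (a, fst r) $ (b, snd r) * Psi R $ (snd r, c) $ (fst r, d)) = of_bool (a = d \<and> c = b)"
    "(\<Sum>r\<in>UNIV. Psi R $ (a, fst r) $ (b, snd r) * R $ (snd r, c) $ (fst r, d)) = of_bool (a = d \<and> c = b)"
    unfolding ptr_site2_product flip_entry by simp_all
qed

lemma D_entry: "D_op R $ a $ b = (\<Sum>c\<in>UNIV. Psi R $ (a, c) $ (b, c))"
  by (simp add: D_op_def ptr_def site2_def less_Suc_eq)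

lemma sum_swap_mult:
  fixes h :: "'a \<Rightarrow> 'b \<Rightarrow> 'c::comm_semiring_0"
  shows "(\<Sum>r\<in>A. d r * (\<Sum>t\<in>B. c t * h t r)) = (\<Sum>t\<in>B. c t * (\<Sum>r\<in>A. d r * h t r))"
  unfolding sum_distrib_left by (subst sum.swap) (simp add: mult.left_commute)

text \<open>The identity Tr_{R(2)} R_1 = I. As D_R is a partial trace of the skew inverse, the sum
  is the flip traced over its second factor.\<close>

lemma partial_trace_D:
  assumes "skew_invertible R"
  shows "(\<Sum>r\<in>UNIV. D_op R $ snd r $ fst r * R $ (y, fst r) $ (z, snd r)) = of_bool (y = z)"
proof -
  have "(\<Sum>r\<in>UNIV. D_op R $ snd r $ fst r * R $ (y, fst r) $ (z, snd r))
    = (\<Sum>r\<in>UNIV. \<Sum>c\<in>UNIV. R $ (y, fst r) $ (z, snd r) * Psi R $ (snd r, c) $ (fst r, c))"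
    by (simp add: D_entry sum_distrib_left mult.commute)
  also have "\<dots> = (\<Sum>c\<in>UNIV. of_bool (y = c \<and> c = z))"
    by (subst sum.swap) (simp add: skew_1[OF assms])
  also have "\<dots> = (\<Sum>c\<in>UNIV. of_bool (y = c) * of_bool (c = z))"
    by (simp add: of_bool_conj)
  finally show ?thesis by (simp add: sum_of_bool_mult)
qed

text \<open>Contraction with R in these positions is inverted by contraction with
  \<open>Psi R\<close>, and the inverse takes the identity matrix to D_R.\<close>

lemma skew_cancel:
  fixes R :: "'v::finite op2" and H :: "'v \<times> 'v \<Rightarrow> complex"
  assumes R: "skew_invertible R"
    and eq: "\<And>a b. (\<Sum>t\<in>UNIV. R $ (a, fst t) $ (b, snd t) * H t) = of_bool (a = b) * c"
  shows "H (y, z) = D_op R $ z $ y * c"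
proof -
  have "(\<Sum>r\<in>UNIV. Psi R $ (z, fst r) $ (y, snd r) * (\<Sum>t\<in>UNIV. H t * R $ (snd r, fst t) $ (fst r, snd t)))
     = (\<Sum>t\<in>UNIV. H t * of_bool (z = snd t \<and> fst t = y))"
    unfolding sum_swap_mult skew_2[OF R] ..
  also have "\<dots> = (\<Sum>t\<in>UNIV. H t * of_bool (t = (y, z)))"
    by (intro sum.cong) (auto simp: prod_eq_iff of_bool_def)
  also have "\<dots> = H (y, z)" by (rule sum_of_bool_mult)
  finally have "H (y, z) = (\<Sum>r\<in>UNIV. Psi R $ (z, fst r) $ (y, snd r) * (of_bool (snd r = fst r) * c))"
    by (simp add: eq mult.commute[of "H _"])
  also have "\<dots> = (\<Sum>k\<in>UNIV. \<Sum>l\<in>UNIV. Psi R $ (z, k) $ (y, l) * c * of_bool (l = k))"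
    unfolding sum_pairs by (simp add: mult_ac)
  also have "\<dots> = D_op R $ z $ y * c"
    by (simp add: sum_of_bool_mult D_entry sum_distrib_right)
  finally show ?thesis .
qed

lemma scalar_inject: "scalar a = scalar b \<Longrightarrow> a = b"
  by (metis lookup_single_eq scalar_def)

lemma app_act2_delta:
  fixes X :: "'v::finite op2"
  shows "app (act2 X 0) (\<lambda>y. of_bool (y 0 = b1 \<and> y 1 = b2 \<and> y 2 = b3)) z = scalar (X $ (z 0, z 1) $ (b1, b2)) * of_bool (z 2 = b3)"
    and "app (act2 X 1) (\<lambda>y. of_bool (y 0 = b1 \<and> y 1 = b2 \<and> y 2 = b3)) z = scalar (X $ (z 1, z 2) $ (b2, b3)) * of_bool (z 0 = b1)"
proof -
  have "app (act2 X 0) (\<lambda>y. of_bool (y 0 = b1 \<and> y 1 = b2 \<and> y 2 = b3)) z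
    = (\<Sum>r\<in>UNIV. scalar (X $ (z 0, z 1) $ r) * of_bool (z 2 = b3) * of_bool (r = (b1, b2)))"
    unfolding app_act2 sum_pairs by (intro sum.cong) (auto simp: prod_eq_iff of_bool_def)
  then show "app (act2 X 0) (\<lambda>y. of_bool (y 0 = b1 \<and> y 1 = b2 \<and> y 2 = b3)) z = scalar (X $ (z 0, z 1) $ (b1, b2)) * of_bool (z 2 = b3)"
    by (simp only: sum_of_bool_mult)
  have "app (act2 X 1) (\<lambda>y. of_bool (y 0 = b1 \<and> y 1 = b2 \<and> y 2 = b3)) z
    = (\<Sum>r\<in>UNIV. scalar (X $ (z 1, z 2) $ r) * of_bool (z 0 = b1) * of_bool (r = (b2, b3)))"
    unfolding app_act2 sum_pairs by (intro sum.cong) (auto simp: prod_eq_iff of_bool_def eval_nat_numeral)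
  then show "app (act2 X 1) (\<lambda>y. of_bool (y 0 = b1 \<and> y 1 = b2 \<and> y 2 = b3)) z = scalar (X $ (z 1, z 2) $ (b2, b3)) * of_bool (z 0 = b1)"
    by (simp only: sum_of_bool_mult)
qed

text \<open>\<open>rel\<close> read at one matrix entry: both sides are applied to the indicator
  function of the column (b1, b2, b3) and evaluated at the row (a1, a2, a3).\<close>

lemma twist_entries:
  fixes R F G :: "'v::finite op2"
  assumes rel: "act2 G 0 * (act2 R 1 * act2 F 0) = (act2 F 1 * (act2 R 0 * act2 G 1) :: ('v, 'x) lop)"
  shows "(\<Sum>t\<in>UNIV. R $ (fst t, a3) $ (snd t, b3) * (\<Sum>x\<in>UNIV. G $ (a1, a2) $ (x, fst t) * F $ (x, snd t) $ (b1, b2)))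
    = (\<Sum>t\<in>UNIV. R $ (a1, fst t) $ (b1, snd t) * (\<Sum>w\<in>UNIV. F $ (a2, a3) $ (fst t, w) * G $ (snd t, w) $ (b2, b3)))"
proof -
  define f :: "(nat \<Rightarrow> 'v) \<Rightarrow> 'x free_algebra" where "f = (\<lambda>y. of_bool (y 0 = b1 \<and> y 1 = b2 \<and> y 2 = b3))"
  define x where "x = (\<lambda>k. [a1, a2, a3] ! k)"
  have x: "x 0 = a1" "x 1 = a2" "x (Suc 0) = a2" "x 2 = a3" "x (Suc (Suc 0)) = a3"
    by (simp_all add: x_def)
  have F0: "app (act2 F 0) f = (\<lambda>z. scalar (F $ (z 0, z 1) $ (b1, b2)) * of_bool (z 2 = b3))"
    and G1: "app (act2 G 1) f = (\<lambda>z. scalar (G $ (z 1, z 2) $ (b2, b3)) * of_bool (z 0 = b1))"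
    unfolding f_def app_act2_delta[abs_def] by simp_all
  have R1: "app (act2 R 1) (app (act2 F 0) f) = (\<lambda>z. scalar (\<Sum>c\<in>UNIV. R $ (z 1, z 2) $ (c, b3) * F $ (z 0, c) $ (b1, b2)))"
    unfolding F0 by (rule ext)
      (simp add: app_act2 eval_nat_numeral sum_of_bool_mult scalar_sum scalar_mult del: free.scale_scale flip: mult.assoc)
  have R0: "app (act2 R 0) (app (act2 G 1) f) = (\<lambda>z. scalar (\<Sum>d\<in>UNIV. R $ (z 0, z 1) $ (b1, d) * G $ (d, z 2) $ (b2, b3)))"
    unfolding G1 by (rule ext, simp only: app_act2, subst sum.swap)
      (simp add: eval_nat_numeral sum_of_bool_mult scalar_sum scalar_mult del: free.scale_scale flip: mult.assoc)
  have "app (act2 G 0 * (act2 R 1 * act2 F 0)) f x = scalar (\<Sum>c\<in>UNIV. \<Sum>d\<in>UNIV. G $ (a1, a2) $ (c, d) *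
      (\<Sum>e\<in>UNIV. R $ (d, a3) $ (e, b3) * F $ (c, e) $ (b1, b2)))"
    unfolding times_lop.rep_eq R1 app_act2 by (simp add: x eval_nat_numeral scalar_sum scalar_mult del: free.scale_scale)
  also have "(\<Sum>c\<in>UNIV. \<Sum>d\<in>UNIV. G $ (a1, a2) $ (c, d) * (\<Sum>e\<in>UNIV. R $ (d, a3) $ (e, b3) * F $ (c, e) $ (b1, b2)))
     = (\<Sum>c\<in>UNIV. \<Sum>t\<in>UNIV. R $ (fst t, a3) $ (snd t, b3) * (G $ (a1, a2) $ (c, fst t) * F $ (c, snd t) $ (b1, b2)))"
  proof (intro sum.cong refl)
    fix c
    show "(\<Sum>d\<in>UNIV. G $ (a1, a2) $ (c, d) * (\<Sum>e\<in>UNIV. R $ (d, a3) $ (e, b3) * F $ (c, e) $ (b1, b2)))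
      = (\<Sum>t\<in>UNIV. R $ (fst t, a3) $ (snd t, b3) * (G $ (a1, a2) $ (c, fst t) * F $ (c, snd t) $ (b1, b2)))"
      using sum_pairs[of "\<lambda>d e. R $ (d, a3) $ (e, b3) * (G $ (a1, a2) $ (c, d) * F $ (c, e) $ (b1, b2))"]
      by (simp add: sum_distrib_left mult_ac)
  qed
  also have "\<dots> = (\<Sum>t\<in>UNIV. R $ (fst t, a3) $ (snd t, b3) * (\<Sum>x\<in>UNIV. G $ (a1, a2) $ (x, fst t) * F $ (x, snd t) $ (b1, b2)))"
    unfolding sum_distrib_left by (rule sum.swap)
  finally have 1: "app (act2 G 0 * (act2 R 1 * act2 F 0)) f x = scalar \<dots>" .
  have "app (act2 F 1 * (act2 R 0 * act2 G 1)) f x = scalar (\<Sum>c\<in>UNIV. \<Sum>w\<in>UNIV. F $ (a2, a3) $ (c, w) *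
      (\<Sum>d\<in>UNIV. R $ (a1, c) $ (b1, d) * G $ (d, w) $ (b2, b3)))"
    unfolding times_lop.rep_eq R0 app_act2 by (simp add: x eval_nat_numeral scalar_sum scalar_mult del: free.scale_scale)
  also have "(\<Sum>c\<in>UNIV. \<Sum>w\<in>UNIV. F $ (a2, a3) $ (c, w) * (\<Sum>d\<in>UNIV. R $ (a1, c) $ (b1, d) * G $ (d, w) $ (b2, b3)))
     = (\<Sum>c\<in>UNIV. \<Sum>d\<in>UNIV. R $ (a1, c) $ (b1, d) * (\<Sum>w\<in>UNIV. F $ (a2, a3) $ (c, w) * G $ (d, w) $ (b2, b3)))"
    by (intro sum.cong refl sum_swap_mult)
  finally have 2: "app (act2 F 1 * (act2 R 0 * act2 G 1)) f x = scalar (\<Sum>t\<in>UNIV. R $ (a1, fst t) $ (b1, snd t) *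
      (\<Sum>w\<in>UNIV. F $ (a2, a3) $ (fst t, w) * G $ (snd t, w) $ (b2, b3)))" unfolding sum_pairs .
  show ?thesis
    by (rule scalar_inject, rule trans[OF 1[symmetric] trans[OF _ 2]]) (simp only: rel)
qed

text \<open>Entry form of Tr_{R(2)} F_1 X_1 F_1^{-1} = Tr_R(X) I, with G as the inverse of F. After
  contraction with R, \<open>twist_entries\<close> moves R to the traced factor,
  \<open>partial_trace_D\<close> removes it and G F = 1 remains; \<open>skew_cancel\<close> undoes
  the contraction.\<close>

lemma twist_trace:
  fixes R F G :: "'v::finite op2"
  assumes R: "skew_invertible R" and GF: "G ** F = mat 1"
    and rel: "act2 G 0 * (act2 R 1 * act2 F 0) = (act2 F 1 * (act2 R 0 * act2 G 1) :: ('v, 'v \<times> 'v) lop)"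
  shows "(\<Sum>r\<in>UNIV. D_op R $ snd r $ fst r * (\<Sum>w\<in>UNIV. F $ (p, fst r) $ (y, w) * G $ (z, w) $ (u, snd r)))
    = D_op R $ z $ y * of_bool (p = u)"
proof -
  let ?h = "\<lambda>t r. \<Sum>w\<in>UNIV. F $ (p, fst r) $ (fst t, w) * G $ (snd t, w) $ (u, snd r)"
  let ?H = "\<lambda>t. \<Sum>r\<in>UNIV. D_op R $ snd r $ fst r * ?h t r"
  have "?H (y, z) = D_op R $ z $ y * of_bool (p = u)"
  proof (rule skew_cancel[OF R])
    fix a b
    let ?g = "\<lambda>t. \<Sum>x\<in>UNIV. G $ (a, p) $ (x, fst t) * F $ (x, snd t) $ (b, u)"
    have "(\<Sum>t\<in>UNIV. R $ (a, fst t) $ (b, snd t) * ?H t)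
      = (\<Sum>r\<in>UNIV. D_op R $ snd r $ fst r * (\<Sum>t\<in>UNIV. R $ (a, fst t) $ (b, snd t) * ?h t r))"
      by (rule sum_swap_mult[symmetric])
    also have "\<dots> = (\<Sum>r\<in>UNIV. D_op R $ snd r $ fst r * (\<Sum>t\<in>UNIV. R $ (fst t, fst r) $ (snd t, snd r) * ?g t))"
      unfolding twist_entries[OF rel] ..
    also have "\<dots> = (\<Sum>r\<in>UNIV. D_op R $ snd r $ fst r * (\<Sum>t\<in>UNIV. ?g t * R $ (fst t, fst r) $ (snd t, snd r)))"
      by (simp add: mult.commute)
    also have "\<dots> = (\<Sum>t\<in>UNIV. ?g t * of_bool (fst t = snd t))"
      unfolding sum_swap_mult partial_trace_D[OF R] ..
    also have "\<dots> = (\<Sum>c\<in>UNIV. \<Sum>x\<in>UNIV. G $ (a, p) $ (x, c) * F $ (x, c) $ (b, u))"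
      unfolding sum_pairs[symmetric, of "\<lambda>c d. (\<Sum>x\<in>UNIV. G $ (a, p) $ (x, c) * F $ (x, d) $ (b, u)) * of_bool (c = d)"]
      by (simp add: sum_of_bool_mult)
    also have "\<dots> = (\<Sum>x\<in>UNIV. \<Sum>c\<in>UNIV. G $ (a, p) $ (x, c) * F $ (x, c) $ (b, u))"
      by (rule sum.swap)
    also have "\<dots> = (G ** F) $ (a, p) $ (b, u)"
      unfolding sum_pairs by (simp add: matrix_matrix_mult_def)
    also have "\<dots> = of_bool (a = b) * of_bool (p = u)"
      unfolding GF by (simp add: mat_def)
    finally show "(\<Sum>t\<in>UNIV. R $ (a, fst t) $ (b, snd t) * ?H t) = of_bool (a = b) * of_bool (p = u)" .
  qed
  then show ?thesis by simp
qed

text \<open>h acts trivially in factor m. Commuting with the matrix units of that factor is the form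
  in which partial traces use it.\<close>

definition idle :: "nat \<Rightarrow> ('v, 'x) lop \<Rightarrow> bool" where
  "idle m h \<longleftrightarrow> (\<forall>a b. munit m a b * h = h * munit m a b)"

lemma idleD: "idle m h \<Longrightarrow> munit m a b * h = h * munit m a b"
  by (simp add: idle_def)

lemma idle_1 [simp]: "idle m 1"
  and idle_mult: "idle m g \<Longrightarrow> idle m h \<Longrightarrow> idle m (g * h)"
  and idle_add: "idle m g \<Longrightarrow> idle m h \<Longrightarrow> idle m (g + h)"
  and idle_scale: "idle m g \<Longrightarrow> idle m (c \<odot> g)"
  by (simp_all add: idle_def comm_mult algebra_simps)

lemma idle_sum: "(\<And>a. a \<in> A \<Longrightarrow> idle m (h a)) \<Longrightarrow> idle m (sum h A)"
  by (simp add: idle_def sum_distrib_left sum_distrib_right)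

lemma idle_act2: "j \<noteq> m \<Longrightarrow> j \<noteq> Suc m \<Longrightarrow> idle j (act2 X m)"
  and idle_act1: "j \<noteq> m \<Longrightarrow> idle j (act1 Y m)"
  and idle_munit: "j \<noteq> m \<Longrightarrow> idle j (munit m a b)"
  and idle_Lmul: "idle j (Lmul c)"
  by (simp_all add: idle_def act2_munit_comm act1_munit_comm munit_comm munit_Lmul)

lemma idle_actA: "j \<noteq> m \<Longrightarrow> idle j (actA Y m)"
  unfolding actA_def by (intro idle_sum idle_mult idle_Lmul idle_munit)

lemma idle_comm_act2: "idle m h \<Longrightarrow> idle (Suc m) h \<Longrightarrow> act2 X m * h = h * act2 X m"
  by (rule comm_act2) (simp_all add: idleD)

lemma trm_sum: "trm m (sum h A) = (\<Sum>a\<in>A. trm m (h a))"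
  by (simp add: trm_def sum_distrib_left sum_distrib_right) (subst sum.swap, subst sum.swap[of _ _ A], simp)

lemma trm_add: "trm m (g + h) = trm m g + trm m h"
  by (simp add: trm_def distrib_left distrib_right sum.distrib)

lemma trm_scale: "trm m (c \<odot> h) = c \<odot> trm m h"
  by (simp add: trm_def lop.scale_sum_right)

lemma trm_left: "idle m u \<Longrightarrow> trm m (u * h) = u * trm m h"
  unfolding trm_def sum_distrib_left
  by (intro sum.cong refl) (simp add: idleD flip: mult.assoc)

lemma trm_right: "idle m u \<Longrightarrow> trm m (h * u) = trm m h * u"
  unfolding trm_def sum_distrib_right
  by (intro sum.cong refl) (simp add: idleD mult.assoc)

lemma trm_cyc: "trm m (munit m a b * h) = trm m (h * munit m a b)"
proof -
  have "trm m (munit m a b * h) = (\<Sum>x\<in>UNIV. \<Sum>c\<in>UNIV. if x = a then munit m c b * h * munit m a c else 0)"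
    unfolding trm_def by (intro sum.cong refl) (simp add: munit_mult flip: mult.assoc)
  also have "\<dots> = (\<Sum>x\<in>UNIV. if x = a then \<Sum>c\<in>UNIV. munit m c b * h * munit m a c else 0)"
    by (intro sum.cong refl) simp
  also have "\<dots> = (\<Sum>c\<in>UNIV. munit m c b * h * munit m a c)" by simp
  also have "\<dots> = (\<Sum>x\<in>UNIV. if b = x then \<Sum>c\<in>UNIV. munit m c b * h * munit m a c else 0)" by simp
  also have "\<dots> = (\<Sum>x\<in>UNIV. \<Sum>c\<in>UNIV. if b = x then munit m c b * h * munit m a c else 0)"
    by (intro sum.cong refl) simp
  also have "\<dots> = trm m (h * munit m a b)"
    unfolding trm_def by (intro sum.cong refl) (simp add: munit_mult mult.assoc)
  finally show ?thesis .
qed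

lemma idle_trm_same: "idle m (trm m h)"
  unfolding idle_def
proof (intro allI)
  fix p r
  have "munit m p r * trm m h = (\<Sum>a\<in>UNIV. \<Sum>c\<in>UNIV. if r = c then munit m p a * h * munit m a r else 0)"
    unfolding trm_def sum_distrib_left by (intro sum.cong refl) (simp add: munit_mult flip: mult.assoc)
  also have "\<dots> = (\<Sum>a\<in>UNIV. \<Sum>c\<in>UNIV. if c = p then munit m p a * h * munit m a r else 0)"
    by simp
  also have "\<dots> = trm m h * munit m p r"
    unfolding trm_def sum_distrib_right by (intro sum.cong refl) (simp add: munit_mult mult.assoc)
  finally show "munit m p r * trm m h = trm m h * munit m p r" .
qed

lemma idle_trm: "idle j h \<Longrightarrow> idle j (trm m h)"
proof (cases "j = m")
  case False
  assume "idle j h"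
  with False show ?thesis unfolding trm_def by (intro idle_sum idle_mult idle_munit)
qed (simp add: idle_trm_same)

lemma trN_sum: "trN n (sum h A) = (\<Sum>a\<in>A. trN n (h a))"
  by (induction n arbitrary: h) (simp_all add: trm_sum)

lemma trN_scale: "trN n (c \<odot> h) = c \<odot> trN n h"
  by (induction n arbitrary: h) (simp_all add: trm_scale)

text \<open>\<open>trm\<close> is cyclic for matrix units of its own factor, and those of another
  factor pass out of it unchanged.\<close>

lemma trN_cyc_munit: "1 \<le> m \<Longrightarrow> m \<le> n \<Longrightarrow> trN n (munit m a b * h) = trN n (h * munit m a b)"
proof (induction n arbitrary: h)
  case (Suc n)
  then show ?case
    by (cases "m = Suc n") (simp_all add: trm_cyc trm_left trm_right idle_munit)
qed simp

lemma trN_cyc_act2: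
  assumes "1 \<le> i" "i < n"
  shows "trN n (act2 X i * h) = trN n (h * act2 X i)"
proof -
  have "trN n (munit i a c * (munit (Suc i) b d * h)) = trN n (h * (munit i a c * munit (Suc i) b d))" for a b c d
    using assms by (simp add: trN_cyc_munit mult.assoc)
  then show ?thesis
    unfolding act2_def sum_distrib_left sum_distrib_right trN_sum
    by (intro sum.cong refl) (simp add: trN_scale mult.assoc)
qed

lemma trm_D:
  "trm m (act1 D m * h) = (\<Sum>r\<in>UNIV. D $ snd r $ fst r \<odot> (\<Sum>c\<in>UNIV. munit m c (fst r) * h * munit m (snd r) c))"
proof -
  have e: "munit m c a * act1 D m = (\<Sum>v\<in>UNIV. D $ a $ v \<odot> munit m c v)" for c a
  proof -
    have "munit m c a * act1 D m = (\<Sum>x\<in>UNIV. \<Sum>v\<in>UNIV. if a = x then D $ a $ v \<odot> munit m c v else 0)"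
      unfolding act1_def sum_distrib_left by (intro sum.cong refl) (simp add: munit_mult)
    also have "\<dots> = (\<Sum>x\<in>UNIV. if a = x then \<Sum>v\<in>UNIV. D $ a $ v \<odot> munit m c v else 0)"
      by (intro sum.cong refl) simp
    finally show ?thesis by simp
  qed
  have "trm m (act1 D m * h) = (\<Sum>a\<in>UNIV. \<Sum>c\<in>UNIV. \<Sum>v\<in>UNIV. D $ a $ v \<odot> (munit m c v * h * munit m a c))"
    unfolding trm_def by (intro sum.cong refl) (simp add: e sum_distrib_right flip: mult.assoc)
  also have "\<dots> = (\<Sum>a\<in>UNIV. \<Sum>v\<in>UNIV. D $ a $ v \<odot> (\<Sum>c\<in>UNIV. munit m c v * h * munit m a c))"
    unfolding lop.scale_sum_right by (intro sum.cong refl sum.swap)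
  also have "\<dots> = (\<Sum>v\<in>UNIV. \<Sum>a\<in>UNIV. D $ a $ v \<odot> (\<Sum>c\<in>UNIV. munit m c v * h * munit m a c))"
    by (rule sum.swap)
  finally show ?thesis unfolding sum_pairs .
qed

lemma trm_D_munit: "trm m (act1 D m * munit m b d) = (D $ d $ b \<odot> 1 :: ('v::finite, 'x) lop)"
proof -
  have "(\<Sum>c\<in>UNIV. munit m c (fst r) * munit m b d * munit m (snd r) c) = (if r = (b, d) then 1 else (0 :: ('v, 'x) lop))" for r
    by (cases r, cases "fst r = b") (auto simp: munit_mult munit_1)
  then have "trm m (act1 D m * munit m b d) = (\<Sum>r\<in>UNIV. if r = (b, d) then D $ snd r $ fst r \<odot> 1 else (0 :: ('v, 'x) lop))"
    unfolding trm_D by (intro sum.cong refl) simp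
  then show ?thesis by simp
qed

lemma sum_permute:
  fixes h :: "'v::finite \<Rightarrow> 'v \<Rightarrow> 'v \<Rightarrow> 'v \<Rightarrow> 'v \<Rightarrow> 'v \<Rightarrow> 'v \<Rightarrow> 'a::comm_monoid_add"
  shows "(\<Sum>p\<in>UNIV. \<Sum>b\<in>UNIV. \<Sum>x\<in>UNIV. \<Sum>s\<in>UNIV. \<Sum>u\<in>UNIV. \<Sum>w\<in>UNIV. \<Sum>d\<in>UNIV. h p b x s u w d)
    = (\<Sum>p\<in>UNIV. \<Sum>x\<in>UNIV. \<Sum>u\<in>UNIV. \<Sum>w\<in>UNIV. \<Sum>b\<in>UNIV. \<Sum>d\<in>UNIV. \<Sum>s\<in>UNIV. h p b x s u w d)"
  unfolding sum.cartesian_product UNIV_Times_UNIV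
  by (rule sum.reindex_bij_witness[of _ "\<lambda>(p, x, u, w, b, d, s). (p, b, x, s, u, w, d)"
        "\<lambda>(p, b, x, s, u, w, d). (p, x, u, w, b, d, s)"]) auto

text \<open>Expand F_m and G_m in matrix units. Z commutes with those of factor m + 1, so the trace
  there involves only F, G and D_R, and \<open>twist_trace\<close> evaluates it.\<close>

lemma partial_twist:
  fixes R F G :: "'v::finite op2" and Z :: "('v, 'v \<times> 'v) lop"
  assumes R: "skew_invertible R" and GF: "G ** F = mat 1"
    and rel: "act2 G 0 * (act2 R 1 * act2 F 0) = (act2 F 1 * (act2 R 0 * act2 G 1) :: ('v, 'v \<times> 'v) lop)"
    and Z: "idle (Suc m) Z"
  shows "trm (Suc m) (act1 (D_op R) (Suc m) * (act2 F m * (Z * act2 G m))) = trm m (act1 (D_op R) m * Z)"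
proof -
  let ?e = "munit m" and ?e' = "munit (Suc m)" and ?D = "D_op R"
  let ?D' = "act1 ?D (Suc m)"
  define Y where "Y p x u w = ?e p x * (Z * ?e u w)" for p x u w
  have Y: "idle (Suc m) (Y p x u w)" for p x u w
    unfolding Y_def by (intro idle_mult Z idle_munit) auto
  have summand: "trm (Suc m) (?D' * (?e p x * ?e' b s * (Z * (?e u w * ?e' t d))))
      = (if s = t then ?D $ d $ b \<odot> Y p x u w else 0)" for p x b s u w t d
  proof -
    have "?D' * (?e p x * ?e' b s * (Z * (?e u w * ?e' t d))) = ?D' * (?e p x * (?e' b s * (Z * ?e u w)) * ?e' t d)"
      by (simp only: mult.assoc)
    also have "?e' b s * (Z * ?e u w) = Z * ?e u w * ?e' b s"
      using idleD[OF idle_mult[OF Z idle_munit]] by (metis n_not_Suc_n)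
    also have "?e p x * (Z * ?e u w * ?e' b s) * ?e' t d = Y p x u w * (?e' b s * ?e' t d)"
      by (simp only: Y_def mult.assoc)
    also have "?D' * \<dots> = Y p x u w * (?D' * (?e' b s * ?e' t d))"
      using comm_act1[of "Suc m" "Y p x u w" ?D] idleD[OF Y] by (simp only: mult.assoc[symmetric])
    finally show ?thesis
      by (simp add: trm_left[OF Y] munit_mult trm_D_munit) (simp add: trm_def)
  qed
  have "trm (Suc m) (?D' * (act2 F m * (Z * act2 G m))) =
    (\<Sum>p\<in>UNIV. \<Sum>b\<in>UNIV. \<Sum>x\<in>UNIV. \<Sum>s\<in>UNIV. \<Sum>u\<in>UNIV. \<Sum>t\<in>UNIV. \<Sum>w\<in>UNIV. \<Sum>d\<in>UNIV.
      if s = t then (F $ (p, b) $ (x, s) * G $ (u, t) $ (w, d) * ?D $ d $ b) \<odot> Y p x u w else 0)"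
  proof -
    have 1: "act2 F m * h = (\<Sum>p\<in>UNIV. \<Sum>b\<in>UNIV. \<Sum>x\<in>UNIV. \<Sum>s\<in>UNIV. F $ (p, b) $ (x, s) \<odot> (?e p x * ?e' b s * h))" for h
      by (simp add: act2_def sum_distrib_right)
    have 2: "g * (Z * act2 G m) = (\<Sum>u\<in>UNIV. \<Sum>t\<in>UNIV. \<Sum>w\<in>UNIV. \<Sum>d\<in>UNIV.
        G $ (u, t) $ (w, d) \<odot> (g * (Z * (?e u w * ?e' t d))))" for g
      by (simp add: act2_def sum_distrib_left)
    show ?thesis
      unfolding 1 unfolding 2 lop.scale_sum_right sum_distrib_left trm_sum
      by (intro sum.cong refl) (simp add: trm_scale summand)
  qed
  also have "\<dots> = (\<Sum>p\<in>UNIV. \<Sum>b\<in>UNIV. \<Sum>x\<in>UNIV. \<Sum>s\<in>UNIV. \<Sum>u\<in>UNIV. \<Sum>t\<in>UNIV.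
      if s = t then \<Sum>w\<in>UNIV. \<Sum>d\<in>UNIV. (F $ (p, b) $ (x, s) * G $ (u, t) $ (w, d) * ?D $ d $ b) \<odot> Y p x u w else 0)"
    by (intro sum.cong refl) simp
  also have "\<dots> = (\<Sum>p\<in>UNIV. \<Sum>b\<in>UNIV. \<Sum>x\<in>UNIV. \<Sum>s\<in>UNIV. \<Sum>u\<in>UNIV. \<Sum>w\<in>UNIV. \<Sum>d\<in>UNIV.
      (F $ (p, b) $ (x, s) * G $ (u, s) $ (w, d) * ?D $ d $ b) \<odot> Y p x u w)"
    by simp
  also have "\<dots> = (\<Sum>p\<in>UNIV. \<Sum>x\<in>UNIV. \<Sum>u\<in>UNIV. \<Sum>w\<in>UNIV. \<Sum>b\<in>UNIV. \<Sum>d\<in>UNIV. \<Sum>s\<in>UNIV.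
      (F $ (p, b) $ (x, s) * G $ (u, s) $ (w, d) * ?D $ d $ b) \<odot> Y p x u w)"
    by (rule sum_permute)
  also have "\<dots> = (\<Sum>p\<in>UNIV. \<Sum>x\<in>UNIV. \<Sum>u\<in>UNIV. \<Sum>w\<in>UNIV. (?D $ u $ x * of_bool (p = w)) \<odot> Y p x u w)"
  proof (intro sum.cong refl)
    fix p x u w
    have "(\<Sum>b\<in>UNIV. \<Sum>d\<in>UNIV. \<Sum>s\<in>UNIV. F $ (p, b) $ (x, s) * G $ (u, s) $ (w, d) * ?D $ d $ b)
      = (\<Sum>b\<in>UNIV. \<Sum>d\<in>UNIV. ?D $ d $ b * (\<Sum>s\<in>UNIV. F $ (p, b) $ (x, s) * G $ (u, s) $ (w, d)))"
      by (simp add: sum_distrib_left mult_ac)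
    also have "\<dots> = ?D $ u $ x * of_bool (p = w)"
      unfolding sum_pairs by (rule twist_trace[OF R GF rel])
    finally show "(\<Sum>b\<in>UNIV. \<Sum>d\<in>UNIV. \<Sum>s\<in>UNIV. (F $ (p, b) $ (x, s) * G $ (u, s) $ (w, d) * ?D $ d $ b) \<odot> Y p x u w)
       = (?D $ u $ x * of_bool (p = w)) \<odot> Y p x u w"
      by (simp only: lop.scale_sum_left[symmetric])
  qed
  also have "\<dots> = (\<Sum>p\<in>UNIV. \<Sum>x\<in>UNIV. \<Sum>u\<in>UNIV. ?D $ u $ x \<odot> Y p x u p)"
    by (intro sum.cong refl) (simp add: of_bool_def if_distrib[of "\<lambda>c. c \<odot> _"] if_distrib[of "\<lambda>z. _ * z"] cong: if_cong)
  also have "\<dots> = (\<Sum>x\<in>UNIV. \<Sum>u\<in>UNIV. \<Sum>p\<in>UNIV. ?D $ u $ x \<odot> Y p x u p)"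
    by (subst sum.swap) (intro sum.cong refl sum.swap)
  also have "\<dots> = (\<Sum>r\<in>UNIV. ?D $ snd r $ fst r \<odot> (\<Sum>p\<in>UNIV. Y p (fst r) (snd r) p))"
    unfolding sum_pairs[of "\<lambda>x u. \<Sum>p\<in>UNIV. ?D $ u $ x \<odot> Y p x u p"] by (simp add: lop.scale_sum_right)
  also have "\<dots> = trm m (act1 ?D m * Z)"
    unfolding trm_D by (simp add: Y_def mult.assoc)
  finally show ?thesis .
qed

definition DD :: "'v::finite op2 \<Rightarrow> 'v op2" where
  "DD R = (\<chi> i j. D_op R $ fst i $ fst j * D_op R $ snd i $ snd j)"

lemma act2_DD: "act2 (DD R) m = (act1 (D_op R) m * act1 (D_op R) (Suc m) :: ('v::finite, 'x) lop)"
proof -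
  have "(act1 (D_op R) m * act1 (D_op R) (Suc m) :: ('v, 'x) lop) = (\<Sum>a\<in>UNIV. \<Sum>c\<in>UNIV. \<Sum>b\<in>UNIV. \<Sum>d\<in>UNIV.
      (D_op R $ a $ c * D_op R $ b $ d) \<odot> (munit m a c * munit (Suc m) b d))"
  proof -
    have 1: "act1 (D_op R) m * h = (\<Sum>a\<in>UNIV. \<Sum>c\<in>UNIV. D_op R $ a $ c \<odot> (munit m a c * h))" for h
      by (simp add: act1_def sum_distrib_right)
    have 2: "g * act1 (D_op R) (Suc m) = (\<Sum>b\<in>UNIV. \<Sum>d\<in>UNIV. D_op R $ b $ d \<odot> (g * munit (Suc m) b d))" for g
      by (simp add: act1_def sum_distrib_left)
    show ?thesis unfolding 1 unfolding 2 by (simp add: lop.scale_sum_right)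
  qed
  also have "\<dots> = act2 (DD R) m"
    unfolding act2_def DD_def by (rule sum.cong[OF refl], subst sum.swap) simp
  finally show ?thesis by simp
qed

text \<open>\<open>twist_trace\<close> for R and its inverse, in both orders, is contracted with
  \<open>Psi R\<close>. This expresses G D_2 (\<open>right\<close>) and D_2 G (\<open>left\<close>)
  by the skew inverse and one D. After multiplication by the missing D the two agree, so D_1 D_2
  commutes with G and hence with R.\<close>

lemma DD_comm:
  fixes R G :: "'v::finite op2"
  assumes R: "skew_invertible R" and GR: "G ** R = mat 1" and RG: "R ** G = mat 1"
    and rel: "act2 G 0 * (act2 R 1 * act2 R 0) = (act2 R 1 * (act2 R 0 * act2 G 1) :: ('v, 'v \<times> 'v) lop)"
    and rel': "act2 R 0 * (act2 R 1 * act2 G 0) = (act2 G 1 * (act2 R 0 * act2 R 1) :: ('v, 'v \<times> 'v) lop)"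
  shows "R ** DD R = DD R ** R"
proof -
  let ?D = "D_op R" and ?P = "Psi R"
  have right: "(\<Sum>b\<in>UNIV. G $ (z, p) $ (u, b) * ?D $ b $ s) = (\<Sum>y\<in>UNIV. ?D $ z $ y * ?P $ (p, y) $ (s, u))" for z p u s
  proof -
    let ?h = "\<lambda>t r. \<Sum>w\<in>UNIV. R $ (snd t, fst r) $ (fst t, w) * G $ (z, w) $ (u, snd r)"
    have "(\<Sum>t\<in>UNIV. ?P $ (p, fst t) $ (s, snd t) * (\<Sum>r\<in>UNIV. ?D $ snd r $ fst r * ?h t r))
      = (\<Sum>r\<in>UNIV. ?D $ snd r $ fst r * (\<Sum>t\<in>UNIV. ?P $ (p, fst t) $ (s, snd t) * ?h t r))"
      by (rule sum_swap_mult)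
    also have "\<dots> = (\<Sum>r\<in>UNIV. ?D $ snd r $ fst r * (of_bool (fst r = s) * G $ (z, p) $ (u, snd r)))"
    proof (intro sum.cong refl)
      fix r :: "'v \<times> 'v"
      have "(\<Sum>t\<in>UNIV. ?P $ (p, fst t) $ (s, snd t) * ?h t r)
        = (\<Sum>w\<in>UNIV. G $ (z, w) $ (u, snd r) * (\<Sum>t\<in>UNIV. ?P $ (p, fst t) $ (s, snd t) * R $ (snd t, fst r) $ (fst t, w)))"
        by (subst sum_swap_mult[symmetric]) (simp add: mult.commute)
      also have "\<dots> = (\<Sum>w\<in>UNIV. (of_bool (fst r = s) * G $ (z, w) $ (u, snd r)) * of_bool (p = w))"
        unfolding skew_2[OF R] by (intro sum.cong refl) (simp add: of_bool_conj mult_ac)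
      finally show "?D $ snd r $ fst r * (\<Sum>t\<in>UNIV. ?P $ (p, fst t) $ (s, snd t) * ?h t r)
        = ?D $ snd r $ fst r * (of_bool (fst r = s) * G $ (z, p) $ (u, snd r))"
        unfolding sum_of_bool_mult by simp
    qed
    also have "\<dots> = (\<Sum>a\<in>UNIV. \<Sum>b\<in>UNIV. ?D $ b $ a * (of_bool (a = s) * G $ (z, p) $ (u, b)))"
      by (simp add: sum_pairs)
    also have "\<dots> = (\<Sum>b\<in>UNIV. \<Sum>a\<in>UNIV. (?D $ b $ a * G $ (z, p) $ (u, b)) * of_bool (a = s))"
      by (subst sum.swap) (simp add: mult_ac)
    also have "\<dots> = (\<Sum>b\<in>UNIV. G $ (z, p) $ (u, b) * ?D $ b $ s)"
      unfolding sum_of_bool_mult by (simp add: mult.commute)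
    finally have "(\<Sum>b\<in>UNIV. G $ (z, p) $ (u, b) * ?D $ b $ s)
      = (\<Sum>t\<in>UNIV. ?P $ (p, fst t) $ (s, snd t) * (?D $ z $ fst t * of_bool (snd t = u)))"
      unfolding twist_trace[OF R GR rel] by simp
    also have "\<dots> = (\<Sum>y\<in>UNIV. \<Sum>a\<in>UNIV. (?D $ z $ y * ?P $ (p, y) $ (s, a)) * of_bool (a = u))"
      unfolding sum_pairs by (intro sum.cong refl) (simp only: mult_ac)
    finally show ?thesis unfolding sum_of_bool_mult .
  qed
  have left: "(\<Sum>a\<in>UNIV. ?D $ p $ a * G $ (v, a) $ (y, s)) = (\<Sum>z\<in>UNIV. ?P $ (p, v) $ (s, z) * ?D $ z $ y)" for p v y s
  proof -
    let ?h = "\<lambda>t r. \<Sum>w\<in>UNIV. G $ (v, fst r) $ (y, w) * R $ (snd t, w) $ (fst t, snd r)"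
    have "(\<Sum>t\<in>UNIV. ?P $ (p, fst t) $ (s, snd t) * (\<Sum>r\<in>UNIV. ?D $ snd r $ fst r * ?h t r))
      = (\<Sum>r\<in>UNIV. ?D $ snd r $ fst r * (\<Sum>t\<in>UNIV. ?P $ (p, fst t) $ (s, snd t) * ?h t r))"
      by (rule sum_swap_mult)
    also have "\<dots> = (\<Sum>r\<in>UNIV. ?D $ snd r $ fst r * (of_bool (p = snd r) * G $ (v, fst r) $ (y, s)))"
    proof (intro sum.cong refl)
      fix r :: "'v \<times> 'v"
      have "(\<Sum>t\<in>UNIV. ?P $ (p, fst t) $ (s, snd t) * ?h t r)
        = (\<Sum>w\<in>UNIV. G $ (v, fst r) $ (y, w) * (\<Sum>t\<in>UNIV. ?P $ (p, fst t) $ (s, snd t) * R $ (snd t, w) $ (fst t, snd r)))"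
        by (rule sum_swap_mult)
      also have "\<dots> = (\<Sum>w\<in>UNIV. (of_bool (p = snd r) * G $ (v, fst r) $ (y, w)) * of_bool (w = s))"
        unfolding skew_2[OF R] by (intro sum.cong refl) (simp add: of_bool_conj mult_ac)
      finally show "?D $ snd r $ fst r * (\<Sum>t\<in>UNIV. ?P $ (p, fst t) $ (s, snd t) * ?h t r)
        = ?D $ snd r $ fst r * (of_bool (p = snd r) * G $ (v, fst r) $ (y, s))"
        unfolding sum_of_bool_mult by simp
    qed
    also have "\<dots> = (\<Sum>a\<in>UNIV. \<Sum>b\<in>UNIV. (?D $ b $ a * G $ (v, a) $ (y, s)) * of_bool (p = b))"
      unfolding sum_pairs by (intro sum.cong refl) (simp only: mult_ac)
    finally have "(\<Sum>a\<in>UNIV. ?D $ p $ a * G $ (v, a) $ (y, s))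
      = (\<Sum>t\<in>UNIV. ?P $ (p, fst t) $ (s, snd t) * (?D $ snd t $ y * of_bool (v = fst t)))"
      unfolding sum_of_bool_mult twist_trace[OF R RG rel'] by simp
    also have "\<dots> = (\<Sum>a\<in>UNIV. \<Sum>z\<in>UNIV. (?P $ (p, a) $ (s, z) * ?D $ z $ y) * of_bool (v = a))"
      unfolding sum_pairs by (intro sum.cong refl) (simp only: mult_ac)
    also have "\<dots> = (\<Sum>z\<in>UNIV. \<Sum>a\<in>UNIV. (?P $ (p, a) $ (s, z) * ?D $ z $ y) * of_bool (v = a))"
      by (rule sum.swap)
    finally show ?thesis unfolding sum_of_bool_mult .
  qed
  have "(DD R ** G) $ (z, p) $ (b, s) = (G ** DD R) $ (z, p) $ (b, s)" for z p b s
  proof -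
    have "(DD R ** G) $ (z, p) $ (b, s) = (\<Sum>v\<in>UNIV. ?D $ z $ v * (\<Sum>a\<in>UNIV. ?D $ p $ a * G $ (v, a) $ (b, s)))"
      by (simp add: matrix_matrix_mult_def DD_def sum_distrib_left mult.assoc sum_pairs)
    also have "\<dots> = (\<Sum>v\<in>UNIV. ?D $ z $ v * (\<Sum>x\<in>UNIV. ?D $ x $ b * ?P $ (p, v) $ (s, x)))"
      unfolding left by (simp add: mult.commute)
    also have "\<dots> = (\<Sum>x\<in>UNIV. ?D $ x $ b * (\<Sum>v\<in>UNIV. ?D $ z $ v * ?P $ (p, v) $ (s, x)))"
      by (rule sum_swap_mult)
    also have "\<dots> = (\<Sum>x\<in>UNIV. ?D $ x $ b * (\<Sum>a\<in>UNIV. G $ (z, p) $ (x, a) * ?D $ a $ s))"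
      unfolding right ..
    also have "\<dots> = (G ** DD R) $ (z, p) $ (b, s)"
      by (simp add: matrix_matrix_mult_def DD_def sum_distrib_left mult_ac sum_pairs)
    finally show ?thesis .
  qed
  then have "DD R ** G = G ** DD R" by (simp add: vec_eq_iff)
  then show ?thesis
    by (metis GR RG matrix_mul_assoc matrix_mul_lid matrix_mul_rid)
qed

lemma matrix_inv_unfold:
  assumes "invertible A"
  shows "A ** matrix_inv A = mat 1" "matrix_inv A ** A = mat 1"
  using assms someI_ex[of "\<lambda>B. A ** B = mat 1 \<and> B ** A = mat 1"]
  unfolding invertible_def matrix_inv_def by auto

lemma act2_inverse:
  assumes "invertible A"
  shows "act2 A i * act2 (matrix_inv A) i = 1" "act2 (matrix_inv A) i * act2 A i = 1"
  using matrix_inv_unfold[OF assms] by (simp_all add: act2_mat flip: act2_mult)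

lemma rep3_site:
  "rep (Suc (Suc (Suc 0))) (lift (site2 X (Suc 0) (Suc (Suc 0)))) = act2 X (Suc 0)"
  "rep (Suc (Suc (Suc 0))) (lift (site2 X (Suc (Suc 0)) (Suc (Suc (Suc 0))))) = act2 X (Suc (Suc 0))"
  using rep_site[of "Suc 0" "Suc (Suc (Suc 0))" X] rep_site[of "Suc (Suc 0)" "Suc (Suc (Suc 0))" X]
  by simp_all

lemma teq_act2:
  assumes "teq 3 (site A 1 \<bullet>\<bullet> site B 2 \<bullet>\<bullet> site C 1) (site A' 2 \<bullet>\<bullet> site B' 1 \<bullet>\<bullet> site C' 2)"
  shows "act2 A i * (act2 B (Suc i) * act2 C i) = (act2 A' (Suc i) * (act2 B' i * act2 C' (Suc i)) :: ('v::finite, 'x) lop)"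
proof -
  have 1: "(act2 A 1 * (act2 B 2 * act2 C 1) :: ('v, 'x) lop) = act2 A' 2 * (act2 B' 1 * act2 C' 2)"
    using rep_teq3[OF assms, where 'b = 'x]
    by (simp add: lift_tmul rep_tmul mult.assoc eval_nat_numeral rep3_site)
  show ?thesis
    by (rule shift_transfer[of "\<lambda>i. act2 A i * (act2 B (Suc i) * act2 C i)"
          "\<lambda>i. act2 A' (Suc i) * (act2 B' i * act2 C' (Suc i))"])
      (use 1 in \<open>simp_all add: shift_mult shift_act2 eval_nat_numeral\<close>)
qed

section \<open>The copies of the matrix of generators\<close>

locale qm_data =
  fixes R F :: "'v::finite op2"
  assumes R: "R_matrix R" and R_skew: "skew_invertible R" and F: "R_matrix F" and RF: "compatible R F"
begin

abbreviation r :: "nat \<Rightarrow> ('v, 'v \<times> 'v) lop" where "r \<equiv> act2 R"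
abbreviation r' :: "nat \<Rightarrow> ('v, 'v \<times> 'v) lop" where "r' \<equiv> act2 (matrix_inv R)"
abbreviation f :: "nat \<Rightarrow> ('v, 'v \<times> 'v) lop" where "f \<equiv> act2 F"
abbreviation f' :: "nat \<Rightarrow> ('v, 'v \<times> 'v) lop" where "f' \<equiv> act2 (matrix_inv F)"
abbreviation D :: "nat \<Rightarrow> ('v, 'v \<times> 'v) lop" where "D \<equiv> act1 (D_op R)"

lemma rr' [simp]: "r i * r' i = 1" and r'r [simp]: "r' i * r i = 1"
  and ff' [simp]: "f i * f' i = 1" and f'f [simp]: "f' i * f i = 1"
  using act2_inverse R F by (auto simp: R_matrix_def)

lemma cancel_left [simp]: "r i * (r' i * x) = x" "r' i * (r i * x) = x" "f i * (f' i * x) = x" "f' i * (f i * x) = x"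
  by (simp_all flip: mult.assoc)

lemma r_braid: "r i * (r (Suc i) * r i) = r (Suc i) * (r i * r (Suc i))"
  using R by (intro teq_act2) (simp add: R_matrix_def)

lemma f_braid: "f i * (f (Suc i) * f i) = f (Suc i) * (f i * f (Suc i))"
  using F by (intro teq_act2) (simp add: R_matrix_def)

lemma rff: "r i * (f (Suc i) * f i) = f (Suc i) * (f i * r (Suc i))"
  using RF by (intro teq_act2) (simp add: compatible_def)

lemma ffr: "f i * (f (Suc i) * r i) = r (Suc i) * (f i * f (Suc i))"
  using RF by (intro teq_act2) (simp add: compatible_def teq_def)

lemma twist1: "f' i * (r (Suc i) * f i) = f (Suc i) * (r i * f' (Suc i))"
proof -
  have "f' i * (r (Suc i) * f i) = f' i * (r (Suc i) * (f i * f (Suc i))) * f' (Suc i)"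
    by (simp add: mult.assoc)
  then show ?thesis unfolding ffr[symmetric] by (simp add: mult.assoc)
qed

lemma twist_rr: "r' i * (r (Suc i) * r i) = r (Suc i) * (r i * r' (Suc i))"
proof -
  have "r' i * (r (Suc i) * r i) = r' i * (r (Suc i) * (r i * r (Suc i))) * r' (Suc i)"
    by (simp add: mult.assoc)
  then show ?thesis unfolding r_braid[symmetric] by (simp add: mult.assoc)
qed

lemma twist_rr': "r i * (r (Suc i) * r' i) = r' (Suc i) * (r i * r (Suc i))"
proof -
  have "r i * (r (Suc i) * r' i) = r' (Suc i) * (r (Suc i) * (r i * r (Suc i))) * r' i"
    by (simp add: mult.assoc)
  then show ?thesis unfolding r_braid[symmetric] by (simp add: mult.assoc)
qed

section \<open>R-traces over one factor and over blocks of factors\<close>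

definition PT :: "nat \<Rightarrow> ('v, 'v \<times> 'v) lop \<Rightarrow> ('v, 'v \<times> 'v) lop" where
  "PT m Z = trm m (D m * Z)"

lemma PT_twist:
  assumes "idle (Suc m) Z"
  shows "PT (Suc m) (f m * (Z * f' m)) = PT m Z"
  unfolding PT_def
  by (rule partial_twist[OF R_skew _ _ assms])
    (use F twist1[of 0] in \<open>auto simp: R_matrix_def matrix_inv_unfold\<close>)

lemma r_DD: "r i * (D i * D (Suc i)) = D i * (D (Suc i) * r i)"
proof -
  have "R ** DD R = DD R ** R"
    by (rule DD_comm[OF R_skew, of "matrix_inv R"])
      (use R twist_rr[of 0] twist_rr'[of 0] in \<open>auto simp: R_matrix_def matrix_inv_unfold\<close>)
  then have "act2 (R ** DD R) i = act2 (DD R ** R) i" by simp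
  then show ?thesis unfolding act2_mult act2_DD by (simp add: mult.assoc)
qed

lemma idle_PT: "idle j Z \<Longrightarrow> idle j (PT m Z)"
  unfolding PT_def
  by (cases "j = m") (auto intro: idle_trm_same idle_trm idle_mult idle_act1)

lemma idle_PT_same: "idle m (PT m Z)"
  unfolding PT_def by (rule idle_trm_same)

lemma PT_left: "idle m u \<Longrightarrow> PT m (u * Z) = u * PT m Z"
proof -
  assume u: "idle m u"
  have "D m * (u * Z) = u * (D m * Z)"
    using comm_act1[of m u "D_op R"] idleD[OF u] by (simp flip: mult.assoc)
  then show ?thesis by (simp add: PT_def trm_left[OF u])
qed

lemma PT_right: "idle m u \<Longrightarrow> PT m (Z * u) = PT m Z * u"
  by (simp add: PT_def trm_right flip: mult.assoc)

text \<open>The trace over the block of \<open>n\<close> strands starting at strand \<open>j\<close>.\<close>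

fun PTN :: "nat \<Rightarrow> nat \<Rightarrow> ('v, 'v \<times> 'v) lop \<Rightarrow> ('v, 'v \<times> 'v) lop" where
  "PTN j 0 Z = Z"
| "PTN j (Suc n) Z = PTN j n (PT (j + n) Z)"

lemma PTN_left: "(\<And>m. j \<le> m \<Longrightarrow> m < j + n \<Longrightarrow> idle m u) \<Longrightarrow> PTN j n (u * Z) = u * PTN j n Z"
  by (induction n arbitrary: Z) (simp_all add: PT_left)

lemma PTN_right: "(\<And>m. j \<le> m \<Longrightarrow> m < j + n \<Longrightarrow> idle m u) \<Longrightarrow> PTN j n (Z * u) = PTN j n Z * u"
  by (induction n arbitrary: Z) (simp_all add: PT_right)

lemma PTN_split: "PTN j (m + n) Z = PTN j m (PTN (j + m) n Z)"
  by (induction n arbitrary: Z) (simp_all add: add.assoc)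

fun Dn :: "nat \<Rightarrow> ('v, 'v \<times> 'v) lop" where
  "Dn 0 = 1"
| "Dn (Suc n) = Dn n * D (Suc n)"

lemma idle_Dn: "n < m \<Longrightarrow> idle m (Dn n)"
  by (induction n) (auto intro: idle_mult idle_act1)

lemma PTN_trN: "PTN (Suc 0) n Z = trN n (Dn n * Z)"
proof (induction n arbitrary: Z)
  case (Suc n)
  have "trm (Suc n) (Dn n * (D (Suc n) * Z)) = Dn n * trm (Suc n) (D (Suc n) * Z)"
    by (rule trm_left[OF idle_Dn]) simp
  then show ?case by (simp add: Suc PT_def mult.assoc)
qed simp

lemma r_Dn: "1 \<le> i \<Longrightarrow> i < n \<Longrightarrow> r i * Dn n = Dn n * r i"
proof (induction n)
  case (Suc n)
  show ?case
  proof (cases "i = n")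
    case False
    have "r i * D (Suc n) = D (Suc n) * r i"
      using False Suc.prems by (intro idle_comm_act2 idle_act1) auto
    then show ?thesis using Suc False by (simp, metis mult.assoc less_antisym)
  next
    case True
    then obtain k where k: "n = Suc k" using Suc.prems by (cases n) auto
    have "r n * Dn k = Dn k * r n"
      using k by (intro idle_comm_act2 idle_Dn) auto
    then have "r n * (Dn k * (D n * D (Suc n))) = Dn k * (r n * (D n * D (Suc n)))"
      by (metis mult.assoc)
    then show ?thesis using True k r_DD[of n] by (simp add: mult.assoc)
  qed
qed simp

text \<open>R_i passes the product of the D's by \<open>r_Dn\<close>, so cyclicity of the ordinary
  trace suffices.\<close>

lemma PTN_cyc: "1 \<le> i \<Longrightarrow> i < n \<Longrightarrow> PTN (Suc 0) n (Z * r i) = PTN (Suc 0) n (r i * Z)"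
proof -
  assume i: "1 \<le> i" "i < n"
  have "trN n (Dn n * (Z * r i)) = trN n (r i * (Dn n * Z))"
    using trN_cyc_act2[OF i, of R "Dn n * Z"] by (simp add: mult.assoc)
  also have "r i * (Dn n * Z) = Dn n * (r i * Z)"
    using r_Dn[OF i] by (simp flip: mult.assoc)
  finally show ?thesis by (simp add: PTN_trN)
qed

section \<open>Moving blocks of factors by F\<close>

fun h :: "nat \<Rightarrow> nat \<Rightarrow> ('v, 'v \<times> 'v) lop" where
  "h j 0 = 1"
| "h j (Suc k) = h j k * f (j + k)"

fun h' :: "nat \<Rightarrow> nat \<Rightarrow> ('v, 'v \<times> 'v) lop" where
  "h' j 0 = 1"
| "h' j (Suc k) = f' (j + k) * h' j k"

lemma hh': "h j k * h' j k = 1"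
  by (induction k) (simp_all add: mult.assoc)

lemma idle_h: "j + k < m \<Longrightarrow> idle m (h j k)" and idle_h': "j + k < m \<Longrightarrow> idle m (h' j k)"
  by (induction k) (auto intro!: idle_mult idle_act2)

text \<open>The product f_j ... f_{j+k-1} moves a block up by one place. The top factor is traced
  first: \<open>PT_twist\<close> removes the last f, and what is left no longer acts in factor j +
  k.\<close>

lemma PTN_conj:
  "(\<And>m. j + k \<le> m \<Longrightarrow> idle m W) \<Longrightarrow> PTN (Suc j) k (h j k * (W * h' j k)) = PTN j k W"
proof (induction k arbitrary: W)
  case (Suc k)
  have "PT (Suc j + k) (h j (Suc k) * (W * h' j (Suc k)))
    = PT (Suc (j + k)) (h j k * ((f (j + k) * (W * f' (j + k))) * h' j k))"
    by (simp add: mult.assoc)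
  also have "\<dots> = h j k * (PT (Suc (j + k)) (f (j + k) * (W * f' (j + k))) * h' j k)"
    by (simp add: PT_left PT_right idle_h idle_h')
  also have "PT (Suc (j + k)) (f (j + k) * (W * f' (j + k))) = PT (j + k) W"
    using Suc.prems by (intro PT_twist) simp
  finally have "PTN (Suc j) (Suc k) (h j (Suc k) * (W * h' j (Suc k))) = PTN (Suc j) k (h j k * (PT (j + k) W * h' j k))"
    by simp
  also have "\<dots> = PTN j k (PT (j + k) W)"
  proof (rule Suc.IH)
    fix m assume "j + k \<le> m"
    then show "idle m (PT (j + k) W)"
      using Suc.prems[of m] by (cases "m = j + k") (auto intro: idle_PT idle_PT_same)
  qed
  finally show ?case by simp
qed simp

text \<open>x_i passes the factors f_m that are far from it, and the pair f_i f_{i+1} raises its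
  index.\<close>

lemma h_shift:
  assumes braid: "\<And>i. f i * (f (Suc i) * x i) = x (Suc i) * (f i * f (Suc i))"
    and far: "\<And>i m. Suc i < m \<Longrightarrow> x i * f m = f m * x i" "\<And>i m. Suc m < i \<Longrightarrow> f m * x i = x i * f m"
    and "j \<le> i" "Suc i < j + k"
  shows "h j k * x i = x (Suc i) * h j k"
  using assms(4,5)
proof (induction k)
  case (Suc k)
  show ?case
  proof (cases "Suc i = j + k")
    case False
    then have "f (j + k) * x i = x i * f (j + k)" using Suc.prems by (simp add: far(1))
    then show ?thesis using Suc False by (simp add: mult.assoc) (metis less_antisym mult.assoc add_Suc_right)
  next
    case True
    then obtain k' where k: "k = Suc k'" "j + k' = i" using Suc.prems by (cases k) auto
    have "h j n * x (Suc i) = x (Suc i) * h j n" if "j + n \<le> i" for n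
      using that
    proof (induction n)
      case (Suc n)
      then have "f (j + n) * x (Suc i) = x (Suc i) * f (j + n)" by (simp add: far(2))
      then show ?case using Suc by (simp add: mult.assoc) (simp flip: mult.assoc)
    qed simp
    then have comm: "h j k' * x (Suc i) = x (Suc i) * h j k'" using k(2) by simp
    have hk: "h j k = h j k' * f i" and jk: "j + k = Suc i"
      using True by (simp_all add: k(1) flip: k(2))
    have "h j (Suc k) * x i = h j k' * (f i * (f (Suc i) * x i))"
      unfolding h.simps hk jk by (simp only: mult.assoc)
    also have "\<dots> = x (Suc i) * (h j k' * (f i * f (Suc i)))"
      unfolding braid by (simp add: comm flip: mult.assoc)
    finally show ?thesis unfolding h.simps hk jk by (simp only: mult.assoc)
  qed
qed simp

lemma h_r: "j \<le> i \<Longrightarrow> Suc i < j + k \<Longrightarrow> h j k * r i = r (Suc i) * h j k"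
  by (rule h_shift[OF ffr]) (auto intro: act2_far act2_far[symmetric])

fun Mb :: "nat \<Rightarrow> ('v, 'v \<times> 'v) lop" where
  "Mb 0 = 1"
| "Mb (Suc i) = (if i = 0 then actA M_mat 1 else f i * (Mb i * f' i))"

fun MP :: "nat \<Rightarrow> ('v, 'v \<times> 'v) lop" where
  "MP 0 = 1"
| "MP (Suc n) = MP n * Mb (Suc n)"

lemma idle_Mb: "i < m \<Longrightarrow> idle m (Mb i)"
  by (induction i) (auto intro!: idle_mult idle_act2 idle_actA)

lemma idle_MP: "n < m \<Longrightarrow> idle m (MP n)"
  by (induction n) (auto intro!: idle_mult idle_Mb simp del: Mb.simps)

lemma Mb_comm_high: "i < m \<Longrightarrow> act2 X m * Mb i = Mb i * act2 X m"
  by (intro idle_comm_act2 idle_Mb) auto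

text \<open>The critical case is l = m + 2: conjugation by f_{m+1} f_m turns X_{m+1}, which does not
  meet copy m, into X_m. For larger l, X_m is far from every new F. Applied to X = R (compatibility)
  and X = F (braid relation).\<close>

lemma Mb_comm_low:
  assumes X: "\<And>i. act2 X i * (f (Suc i) * f i) = f (Suc i) * (f i * act2 X (Suc i))"
    and "1 \<le> m" "Suc m < l"
  shows "act2 X m * Mb l = Mb l * act2 X m"
  using assms(3)
proof (induction l)
  case (Suc l)
  show ?case
  proof (cases "l = Suc m")
    case True
    let ?u = "f (Suc m) * f m" and ?u' = "f' m * f' (Suc m)"
    have Mb: "Mb (Suc l) = ?u * Mb m * ?u'"
      using True \<open>1 \<le> m\<close> by (simp add: mult.assoc)
    have uu': "?u' * ?u = 1" "?u * ?u' = 1" by (simp_all add: mult.assoc)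
    have 1: "act2 X m * ?u = ?u * act2 X (Suc m)" using X by (simp add: mult.assoc)
    have 2: "act2 X (Suc m) * ?u' = ?u' * act2 X m"
    proof -
      have "act2 X (Suc m) * ?u' = ?u' * (?u * act2 X (Suc m)) * ?u'"
        using uu' by (simp only: mult.assoc[symmetric] mult_1_left)
      also have "\<dots> = ?u' * act2 X m * (?u * ?u')"
        unfolding 1[symmetric] by (simp only: mult.assoc)
      finally show ?thesis unfolding uu' by simp
    qed
    have 3: "act2 X (Suc m) * Mb m = Mb m * act2 X (Suc m)" by (rule Mb_comm_high) simp
    have "act2 X m * (?u * Mb m * ?u') = (act2 X m * ?u) * (Mb m * ?u')" by (simp only: mult.assoc)
    also have "\<dots> = ?u * ((act2 X (Suc m) * Mb m) * ?u')" unfolding 1 by (simp only: mult.assoc)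
    also have "\<dots> = ?u * (Mb m * (act2 X (Suc m) * ?u'))" unfolding 3 by (simp only: mult.assoc)
    also have "\<dots> = ?u * Mb m * ?u' * act2 X m" unfolding 2 by (simp only: mult.assoc)
    finally show ?thesis unfolding Mb .
  next
    case False
    then have l: "Suc m < l" using Suc.prems by simp
    have "act2 X m * f l = f l * act2 X m" "act2 X m * f' l = f' l * act2 X m"
      by (rule act2_far[OF l])+
    then show ?thesis using Suc.IH[OF l] l by simp (metis mult.assoc)
  qed
qed simp

text \<open>f_i takes copy i to copy i + 1 by definition. The factors of h to its right commute with
  copy i by \<open>Mb_comm_high\<close>, those to its left with copy i + 1 by
  \<open>Mb_comm_low\<close>.\<close>

lemma h_Mb: "1 \<le> j \<Longrightarrow> j \<le> i \<Longrightarrow> i < j + k \<Longrightarrow> h j k * Mb i = Mb (Suc i) * h j k"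
proof (induction k)
  case (Suc k)
  show ?case
  proof (cases "i = j + k")
    case False
    then have "f (j + k) * Mb i = Mb i * f (j + k)" using Suc.prems by (intro Mb_comm_high) auto
    then show ?thesis using Suc False by (simp add: mult.assoc del: Mb.simps) (metis less_antisym mult.assoc add_Suc_right)
  next
    case True
    have "h j n * Mb (Suc i) = Mb (Suc i) * h j n" if "j + n \<le> i" for n
      using that
    proof (induction n)
      case (Suc n)
      have "f (j + n) * Mb (Suc i) = Mb (Suc i) * f (j + n)"
        using Suc.prems \<open>1 \<le> j\<close> f_braid by (intro Mb_comm_low) auto
      then show ?case using Suc by (simp add: mult.assoc del: Mb.simps) (metis Suc_leD mult.assoc)
    qed simp
    then have comm: "h j k * Mb (Suc i) = Mb (Suc i) * h j k" using True by simp
    have "f i * Mb i = Mb (Suc i) * f i" using True Suc.prems by (simp add: mult.assoc)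
    then show ?thesis using comm True by (simp add: mult.assoc del: Mb.simps) (metis mult.assoc)
  qed
qed simp

end

lemma rep2_site1: "rep (Suc (Suc 0)) (lift (site2 X (Suc 0) (Suc (Suc 0)))) = act2 X (Suc 0)"
  using rep_site[of "Suc 0" "Suc (Suc 0)" X] by simp

lemma iterate_shift_1 [simp]: "(shift ^^ n) 1 = 1"
  and iterate_shift_mult: "(shift ^^ n) (g * h) = (shift ^^ n) g * (shift ^^ n) h"
  and iterate_shift_add: "(shift ^^ n) (g + h) = (shift ^^ n) g + (shift ^^ n) h"
  and iterate_shift_scale: "(shift ^^ n) (c \<odot> h) = c \<odot> (shift ^^ n) h"
  and iterate_shift_act2: "(shift ^^ n) (act2 X i) = act2 X (n + i)"
  by (induction n) (simp_all add: shift_mult shift_add shift_scale shift_act2)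

lemma minimal_cubic:
  assumes "poly_at_matrix ([:- q, 1:] * [:inverse q, 1:] * [:- \<mu>, 1:]) A = 0"
  shows "(\<mu> * (q * inverse q)) \<odot> 1 + (- (q * inverse q) - \<mu> * (inverse q - q)) \<odot> act2 A i
    + (inverse q - q - \<mu>) \<odot> (act2 A i * act2 A i) + act2 A i * (act2 A i * act2 A i) = (0 :: ('v::finite, 'x) lop)"
proof -
  let ?p = "[:\<mu> * (q * inverse q), - (q * inverse q) - \<mu> * (inverse q - q), inverse q - q - \<mu>, 1:]"
  have "[:- q, 1:] * [:inverse q, 1:] * [:- \<mu>, 1:] = ?p"
    by (simp add: algebra_simps)
  then have "poly_at_matrix ?p A = 0" using assms by (simp only:)
  moreover have "degree ?p = Suc (Suc (Suc 0))" by simp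
  ultimately have "mat (\<mu> * (q * inverse q)) ** mat 1 + mat (- (q * inverse q) - \<mu> * (inverse q - q)) ** (A ** mat 1)
    + mat (inverse q - q - \<mu>) ** (A ** (A ** mat 1)) + mat 1 ** (A ** (A ** (A ** mat 1))) = 0"
    unfolding poly_at_matrix_def by (simp add: atMost_Suc algebra_simps del: degree_pCons_eq_if)
  then have "act2 (mat (\<mu> * (q * inverse q)) ** mat 1 + mat (- (q * inverse q) - \<mu> * (inverse q - q)) ** (A ** mat 1)
    + mat (inverse q - q - \<mu>) ** (A ** (A ** mat 1)) + mat 1 ** (A ** (A ** (A ** mat 1)))) i = (act2 0 i :: ('v, 'x) lop)"
    by (simp only:)
  moreover have "act2 0 i = (0 :: ('v, 'x) lop)" by (simp add: act2_def)
  ultimately show ?thesis by (simp add: act2_add act2_mult act2_mat)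
qed

section \<open>The BMW relations for the operators, and the product formula for characters\<close>

locale qm_bmw = qm_data R F for R F :: "'v::finite op2" +
  fixes q \<mu> :: complex
  assumes q: "q \<notin> {0, 1, -1}" and \<mu>: "\<mu> \<notin> {0, q, - inverse q}" and BMW: "BMW_type q \<mu> R"
begin

abbreviation K :: "nat \<Rightarrow> ('v, 'v \<times> 'v) lop" where "K \<equiv> act2 (K_op q \<mu> R)"

lemma K_eq: "K i = (1 / (\<mu> * (q - inverse q))) \<odot> ((q \<odot> 1 - r i) * (inverse q \<odot> 1 + r i))"
  by (simp add: K_op_def act2_mult act2_mat act2_add act2_diff mult.assoc divide_inverse)

text \<open>The cubic relation for R in the form K (\<mu> - R) = 0.\<close>

lemma K_r: "K i * r i = \<mu> \<odot> K i"
proof -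
  let ?A = "q \<odot> 1 - r i" and ?B = "inverse q \<odot> 1 + r i"
  have cubic: "(\<mu> * (q * inverse q)) \<odot> 1 + (- (q * inverse q) - \<mu> * (inverse q - q)) \<odot> r i
    + (inverse q - q - \<mu>) \<odot> (r i * r i) + r i * (r i * r i) = 0"
    using BMW by (intro minimal_cubic) (simp add: BMW_type_def is_minimal_polynomial_def)
  have "?A * ?B * r i - \<mu> \<odot> (?A * ?B) = - ((\<mu> * (q * inverse q)) \<odot> 1 + (- (q * inverse q) - \<mu> * (inverse q - q)) \<odot> r i
    + (inverse q - q - \<mu>) \<odot> (r i * r i) + r i * (r i * r i))"
    by (simp add: algebra_simps)
  then have "?A * ?B * r i = \<mu> \<odot> (?A * ?B)" unfolding cubic by simp
  then show ?thesis unfolding K_eq by (simp only: lop.mult_scale_left lop.scale_scale mult.commute)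
qed

lemma KK: "K (Suc i) * K i = r i * (r (Suc i) * K i)"
  and KK': "K (Suc i) * K i = r' i * (r' (Suc i) * K i)"
  and KKK: "K i * (K (Suc i) * K i) = K i"
proof -
  let ?K = "K_op q \<mu> R" and ?R' = "matrix_inv R"
  have "teq 3 (site ?K 2 \<bullet>\<bullet> site ?K 1) (site R 1 \<bullet>\<bullet> site R 2 \<bullet>\<bullet> site ?K 1)"
    and "teq 3 (site ?K 2 \<bullet>\<bullet> site ?K 1) (site ?R' 1 \<bullet>\<bullet> site ?R' 2 \<bullet>\<bullet> site ?K 1)"
    and "teq 3 (site ?K 1 \<bullet>\<bullet> site ?K 2 \<bullet>\<bullet> site ?K 1) (site ?K 1)"
    using BMW by (simp_all add: BMW_type_def Let_def)
  note rel = this[THEN rep_teq3]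
  show "K (Suc i) * K i = r i * (r (Suc i) * K i)"
    by (rule shift_transfer[of "\<lambda>i. K (Suc i) * K i" "\<lambda>i. r i * (r (Suc i) * K i)"])
      (use rel(1)[where 'b = "'v \<times> 'v"] in \<open>simp_all add: shift_mult shift_act2 lift_tmul rep_tmul mult.assoc eval_nat_numeral rep3_site\<close>)
  show "K (Suc i) * K i = r' i * (r' (Suc i) * K i)"
    by (rule shift_transfer[of "\<lambda>i. K (Suc i) * K i" "\<lambda>i. r' i * (r' (Suc i) * K i)"])
      (use rel(2)[where 'b = "'v \<times> 'v"] in \<open>simp_all add: shift_mult shift_act2 lift_tmul rep_tmul mult.assoc eval_nat_numeral rep3_site\<close>)
  show "K i * (K (Suc i) * K i) = K i"
    by (rule shift_transfer[of "\<lambda>i. K i * (K (Suc i) * K i)" K])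
      (use rel(3)[where 'b = "'v \<times> 'v"] in \<open>simp_all add: shift_mult shift_act2 lift_tmul rep_tmul mult.assoc eval_nat_numeral rep3_site\<close>)
qed

sublocale alg: bmw "lscale :: complex \<Rightarrow> ('v, 'v \<times> 'v) lop \<Rightarrow> _" r r' K q \<mu>
proof
  show "q \<noteq> 0" "q\<^sup>2 \<noteq> 1" "\<mu> \<noteq> 0" "\<mu> \<noteq> q" "\<mu> \<noteq> - inverse q"
    using q \<mu> by (auto simp: power2_eq_1_iff)
qed (auto intro: act2_far KK KK' KKK K_r K_eq r_braid)

text \<open>\<open>Uh n k\<close> moves the first \<open>k\<close> strands, by means of \<open>F\<close>, past \<open>n\<close> others; conjugation by it turns
  an element of the block \<open>1, \<dots>, k\<close> into the same element of the block \<open>n + 1, \<dots>, n + k\<close>.\<close>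

fun Uh :: "nat \<Rightarrow> nat \<Rightarrow> ('v, 'v \<times> 'v) lop" where
  "Uh 0 k = 1"
| "Uh (Suc n) k = h (Suc n) k * Uh n k"

fun Uh' :: "nat \<Rightarrow> nat \<Rightarrow> ('v, 'v \<times> 'v) lop" where
  "Uh' 0 k = 1"
| "Uh' (Suc n) k = Uh' n k * h' (Suc n) k"

lemma UhUh': "Uh n k * Uh' n k = 1"
proof (induction n)
  case (Suc n)
  have "Uh (Suc n) k * Uh' (Suc n) k = h (Suc n) k * ((Uh n k * Uh' n k) * h' (Suc n) k)"
    by (simp only: Uh.simps Uh'.simps mult.assoc)
  then show ?case by (simp add: Suc hh')
qed simp

lemma idle_Uh: "n + k < m \<Longrightarrow> idle m (Uh n k)" and idle_Uh': "n + k < m \<Longrightarrow> idle m (Uh' n k)"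
  by (induction n) (auto intro!: idle_mult idle_h idle_h' simp del: h.simps h'.simps)

lemma Uh_r: "1 \<le> i \<Longrightarrow> i < k \<Longrightarrow> Uh n k * r i = r (n + i) * Uh n k"
proof (induction n)
  case (Suc n)
  have "h (Suc n) k * r (n + i) = r (Suc (n + i)) * h (Suc n) k"
    using Suc.prems by (intro h_r) auto
  then show ?case using Suc by (simp add: mult.assoc) (simp flip: mult.assoc)
qed simp

lemma Uh_Mb: "1 \<le> i \<Longrightarrow> i \<le> k \<Longrightarrow> Uh n k * Mb i = Mb (n + i) * Uh n k"
proof (induction n)
  case (Suc n)
  have "h (Suc n) k * Mb (n + i) = Mb (Suc (n + i)) * h (Suc n) k"
    using Suc.prems by (intro h_Mb) auto
  then show ?case using Suc by (simp add: mult.assoc del: Mb.simps) (simp del: Mb.simps flip: mult.assoc)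
qed simp

lemma PTN_Uh:
  assumes "\<And>m. k < m \<Longrightarrow> idle m W"
  shows "PTN (Suc n) k (Uh n k * (W * Uh' n k)) = PTN (Suc 0) k W"
proof (induction n)
  case (Suc n)
  have "PTN (Suc (Suc n)) k (Uh (Suc n) k * (W * Uh' (Suc n) k))
    = PTN (Suc (Suc n)) k (h (Suc n) k * ((Uh n k * (W * Uh' n k)) * h' (Suc n) k))"
    by (simp add: mult.assoc)
  also have "\<dots> = PTN (Suc n) k (Uh n k * (W * Uh' n k))"
    using assms by (intro PTN_conj idle_mult idle_Uh idle_Uh') auto
  finally show ?case using Suc by simp
qed simp

fun MPS :: "nat \<Rightarrow> nat \<Rightarrow> ('v, 'v \<times> 'v) lop" where
  "MPS n 0 = 1"
| "MPS n (Suc j) = MPS n j * Mb (n + Suc j)"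

lemma MP_add: "MP (n + j) = MP n * MPS n j"
  by (induction j) (simp_all add: mult.assoc del: Mb.simps)

lemma Uh_MP: "j \<le> k \<Longrightarrow> Uh n k * MP j = MPS n j * Uh n k"
proof (induction j)
  case (Suc j)
  have "Uh n k * MP (Suc j) = MPS n j * (Uh n k * Mb (Suc j))"
    using Suc by (simp del: Mb.simps flip: mult.assoc)
  also have "Uh n k * Mb (Suc j) = Mb (n + Suc j) * Uh n k"
    using Suc.prems by (intro Uh_Mb) auto
  finally show ?case by (simp add: mult.assoc del: Mb.simps)
qed simp

lemma Uh_B: "y \<in> alg.B k \<Longrightarrow> Uh n k * y = (shift ^^ n) y * Uh n k"
proof (induction rule: alg.B.induct)
  case (B_s i)
  then show ?case by (simp add: Uh_r iterate_shift_act2)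
next
  case (B_si i)
  then show ?case using alg.conj_si[OF Uh_r] by (simp add: iterate_shift_act2)
next
  case (B_mult x y)
  have "Uh n k * (x * y) = (shift ^^ n) x * (Uh n k * y)"
    using B_mult.IH(1) by (simp flip: mult.assoc)
  then show ?case using B_mult.IH(2) by (simp add: iterate_shift_mult mult.assoc)
qed (simp_all add: iterate_shift_add iterate_shift_scale algebra_simps)

lemma B_Mb: "x \<in> alg.B n \<Longrightarrow> n < l \<Longrightarrow> Mb l * x = x * Mb l"
proof (induction rule: alg.B.induct)
  case (B_s i)
  then show ?case using Mb_comm_low[OF rff, of i l] by simp
next
  case (B_si i)
  then have "Mb l * r i = r i * Mb l" using Mb_comm_low[OF rff, of i l] by simp
  then show ?case by (rule alg.conj_si)
next
  case (B_mult x y)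
  then show ?case by (metis mult.assoc)
qed (simp_all add: algebra_simps)

lemma B_MPS: "x \<in> alg.B n \<Longrightarrow> MPS n j * x = x * MPS n j"
proof (induction j)
  case (Suc j)
  have "MPS n (Suc j) * x = MPS n j * (Mb (n + Suc j) * x)" by (simp add: mult.assoc del: Mb.simps)
  also have "Mb (n + Suc j) * x = x * Mb (n + Suc j)" by (rule B_Mb) (use Suc in auto)
  finally show ?case using Suc by (simp del: Mb.simps flip: mult.assoc)
qed simp

lemma idle_B: "x \<in> alg.B n \<Longrightarrow> n < m \<Longrightarrow> idle m x"
  by (induction rule: alg.B.induct) (auto intro: idle_mult idle_add idle_scale idle_act2)

text \<open>\<open>Uh\<close> carries the first k copies of M, together with y, to the strands n +
  1, ..., n + k. By \<open>PTN_Uh\<close> the trace over that block is the trace over the strands 1,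
  ..., k.\<close>

lemma PTN_product:
  assumes x: "x \<in> alg.B n" and y: "y \<in> alg.B k"
  shows "PTN (Suc 0) (n + k) (MP (n + k) * (x * (shift ^^ n) y))
    = PTN (Suc 0) n (MP n * x * PTN (Suc 0) k (MP k * y))"
proof -
  let ?W = "Uh n k * (MP k * y * Uh' n k)"
  have "MPS n k * (shift ^^ n) y = MPS n k * ((shift ^^ n) y * (Uh n k * Uh' n k))"
    by (simp add: UhUh')
  also have "\<dots> = MPS n k * (Uh n k * y) * Uh' n k"
    unfolding Uh_B[OF y] by (simp add: mult.assoc)
  also have "\<dots> = MPS n k * Uh n k * (y * Uh' n k)" by (simp add: mult.assoc)
  also have "\<dots> = ?W"
    unfolding Uh_MP[OF order_refl, symmetric] by (simp add: mult.assoc)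
  finally have W: "MPS n k * (shift ^^ n) y = ?W" .
  have "MP (n + k) * (x * (shift ^^ n) y) = MP n * (MPS n k * x) * (shift ^^ n) y"
    unfolding MP_add by (simp add: mult.assoc)
  also have "\<dots> = (MP n * x) * ?W"
    unfolding B_MPS[OF x] W[symmetric] by (simp add: mult.assoc)
  finally have "PTN (Suc 0) (n + k) (MP (n + k) * (x * (shift ^^ n) y))
    = PTN (Suc 0) n (PTN (Suc n) k ((MP n * x) * ?W))"
    by (simp add: PTN_split)
  also have "PTN (Suc n) k ((MP n * x) * ?W) = (MP n * x) * PTN (Suc n) k ?W"
    by (intro PTN_left idle_mult idle_MP idle_B[OF x]) auto
  also have "PTN (Suc n) k ?W = PTN (Suc 0) k (MP k * y)"
    by (intro PTN_Uh idle_mult idle_MP idle_B[OF y]) auto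
  finally show ?thesis .
qed

lemma rep_Mbar: "1 \<le> i \<Longrightarrow> i \<le> N \<Longrightarrow> rep N (Mbar F i) = Mb i"
proof (induction i)
  case (Suc i)
  show ?case
  proof (cases "i = 0")
    case True
    then show ?thesis using Suc rep_site1[of "Suc 0" N M_mat] by simp
  next
    case False
    then show ?thesis using Suc by (simp add: rep_tmul mult.assoc rep_site[of i N, simplified])
  qed
qed simp

lemma rep_Mprod: "n \<le> N \<Longrightarrow> rep N (Mprod F n) = MP n"
  by (induction n) (simp_all add: rep_tid rep_tmul rep_Mbar del: Mb.simps Mbar.simps)

lemma rep_D_prod: "n \<le> N \<Longrightarrow> rep N (lift (D_prod R n)) = Dn n"
  by (induction n) (simp_all add: lift_tid rep_tid lift_tmul rep_tmul rep_lift_site1)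

lemma PTN_R_trace: "PTN (Suc 0) n (rep n X) = Lmul (R_trace R n X)"
proof -
  have "Dn n * rep n X = rep n (lift (D_prod R n) \<bullet>\<bullet> X)"
    by (simp add: rep_tmul rep_D_prod)
  then show ?thesis by (simp add: PTN_trN[simplified] R_trace_def trN_rep)
qed

lemma B_ev: "x \<in> alg.B n \<Longrightarrow> \<exists>\<alpha>. strands n \<alpha> \<and> x = ev R \<alpha>"
proof (induction rule: alg.B.induct)
  case B_1
  then show ?case using strands_1 ev_1 by metis
next
  case (B_s i)
  then show ?case using strands_sigma ev_sigma by metis
next
  case (B_si i)
  then have "strands n (gen (SigInv i))" "ev R (gen (SigInv i)) = r' i"
    by (auto simp: strands_def gen_def ev_single wact_def)
  then show ?case by metis
next
  case (B_scale x c)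
  then obtain \<alpha> where "strands n \<alpha>" "x = ev R \<alpha>" by blast
  then have "strands n (scalar c * \<alpha>)" "c \<odot> x = ev R (scalar c * \<alpha>)"
    by (simp_all add: strands_mult strands_scalar ev_mult ev_scalar)
  then show ?case by blast
next
  case (B_add x y)
  then show ?case using strands_add ev_add by metis
next
  case (B_mult x y)
  then show ?case using strands_mult ev_mult by metis
qed

text \<open>For x in \<open>B n\<close> the traced operator is a left multiplication
  (\<open>PTN_tau\<close>), so the constant 1 shows the multiplier and the point
  \<open>undefined\<close> is harmless. Additivity and homogeneity hold for all x.\<close>

definition tau :: "nat \<Rightarrow> ('v, 'v \<times> 'v) lop \<Rightarrow> 'v entry_alg" where
  "tau n x = app (PTN (Suc 0) n (MP n * x)) (\<lambda>_. 1) undefined"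

lemma PTN_tau: "x \<in> alg.B n \<Longrightarrow> PTN (Suc 0) n (MP n * x) = Lmul (tau n x)"
proof -
  assume "x \<in> alg.B n"
  then obtain \<alpha> where a: "strands n \<alpha>" "x = ev R \<alpha>" using B_ev by blast
  then have "MP n * x = rep n (Mprod F n \<bullet>\<bullet> lift (rho R \<alpha>))"
    by (simp add: rep_tmul rep_Mprod rep_rho)
  then have "\<exists>c. PTN (Suc 0) n (MP n * x) = Lmul c" using PTN_R_trace by metis
  then show ?thesis by (auto simp: tau_def app_Lmul)
qed

lemma tau_ev: "strands n \<alpha> \<Longrightarrow> tau n (ev R \<alpha>) = R_trace R n (Mprod F n \<bullet>\<bullet> lift (rho R \<alpha>))"
proof -
  assume a: "strands n \<alpha>"
  then have "MP n * ev R \<alpha> = rep n (Mprod F n \<bullet>\<bullet> lift (rho R \<alpha>))"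
    by (simp add: rep_tmul rep_Mprod rep_rho)
  then show ?thesis by (simp add: tau_def PTN_R_trace app_Lmul)
qed

lemma tau_product:
  assumes "x \<in> alg.B n" "y \<in> alg.B k"
  shows "tau n x * tau k y = tau (n + k) (x * (shift ^^ n) y)"
proof -
  have "PTN (Suc 0) (n + k) (MP (n + k) * (x * (shift ^^ n) y)) = PTN (Suc 0) n (MP n * x) * Lmul (tau k y)"
    unfolding PTN_product[OF assms] PTN_tau[OF assms(2)]
    by (rule PTN_right) (rule idle_Lmul)
  also have "\<dots> = Lmul (tau n x * tau k y)"
    by (simp add: PTN_tau[OF assms(1)] Lmul_mult)
  finally show ?thesis by (simp add: tau_def app_Lmul)
qed

lemma PTN_add: "PTN j n (x + y) = PTN j n x + PTN j n y"
  by (induction n arbitrary: x y) (simp_all add: PT_def trm_add distrib_left)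

lemma PTN_scale: "PTN j n (c \<odot> x) = c \<odot> PTN j n x"
  by (induction n arbitrary: x) (simp_all add: PT_def trm_scale)

lemma tau_add: "tau n (x + y) = tau n x + tau n y"
  by (simp add: tau_def distrib_left PTN_add app_simps)

lemma tau_scale: "tau n (c \<odot> x) = scalar c * tau n x"
  by (simp add: tau_def PTN_scale lscale.rep_eq)

end

section \<open>The ideal of relations, and cyclicity modulo it\<close>

context qm_data
begin

abbreviation I :: "'v entry_alg set" where "I \<equiv> qm_ideal R F"

lemma ideal_I: "ideal I (free_ring :: 'v entry_alg ring)"
  unfolding qm_ideal_def by (intro ring.genideal_ideal ring_free_ring) (simp add: free_ring_def)

lemma I_relations: "x \<in> qm_relations R F \<Longrightarrow> x \<in> I"
  unfolding qm_ideal_def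
  using ring.genideal_self[OF ring_free_ring, of "qm_relations R F"] by (auto simp: free_ring_def)

lemma I_left: "x \<in> I \<Longrightarrow> a * x \<in> I" and I_right: "x \<in> I \<Longrightarrow> x * a \<in> I"
  using ideal.I_l_closed[OF ideal_I, of x a] ideal.I_r_closed[OF ideal_I, of x a]
  by (simp_all add: free_ring_def)

lemma I_add: "x \<in> I \<Longrightarrow> y \<in> I \<Longrightarrow> x + y \<in> I"
  using additive_subgroup.a_closed[OF ideal.axioms(1)[OF ideal_I], of x y] by (simp add: free_ring_def)

lemma I_0: "0 \<in> I"
  using additive_subgroup.zero_closed[OF ideal.axioms(1)[OF ideal_I]] by (simp add: free_ring_def)

lemma I_sum: "(\<And>a. a \<in> A \<Longrightarrow> g a \<in> I) \<Longrightarrow> sum g A \<in> I"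
  by (induction A rule: infinite_finite_induct) (auto intro: I_0 I_add)

definition into_I :: "('v, 'v \<times> 'v) lop \<Rightarrow> bool" where
  "into_I z \<longleftrightarrow> (\<forall>g x. app z g x \<in> I)"

text \<open>\<open>into_I\<close> survives any composition on the right; on the left it needs an
  operator that keeps values in the ideal.\<close>

definition preserves_I :: "('v, 'v \<times> 'v) lop \<Rightarrow> bool" where
  "preserves_I z \<longleftrightarrow> (\<forall>g. (\<forall>x. g x \<in> I) \<longrightarrow> (\<forall>x. app z g x \<in> I))"

lemma preserves_I_1: "preserves_I 1" and preserves_I_mult: "preserves_I w \<Longrightarrow> preserves_I z \<Longrightarrow> preserves_I (w * z)"
  by (auto simp: preserves_I_def app_simps)

lemma preserves_I_act2: "preserves_I (act2 X m)"
  by (auto simp: preserves_I_def app_act2 intro!: I_sum I_left)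

lemma preserves_I_act1: "preserves_I (act1 X m)"
  by (auto simp: preserves_I_def app_act1 intro!: I_sum I_left)

lemma preserves_I_munit: "preserves_I (munit m a b)"
  by (auto simp: preserves_I_def munit.rep_eq I_0)

lemma preserves_I_actA: "preserves_I (actA X m)"
  by (auto simp: preserves_I_def app_actA intro!: I_sum I_left)

lemma preserves_I_h: "preserves_I (h j k)"
  by (induction k) (auto intro: preserves_I_1 preserves_I_mult preserves_I_act2)

lemma preserves_I_Mb: "preserves_I (Mb i)"
  by (induction i) (auto intro: preserves_I_1 preserves_I_mult preserves_I_act2 preserves_I_actA)

lemma preserves_I_MP: "preserves_I (MP n)"
  by (induction n) (auto intro: preserves_I_1 preserves_I_mult preserves_I_Mb simp del: Mb.simps)

lemma into_I_left: "preserves_I w \<Longrightarrow> into_I z \<Longrightarrow> into_I (w * z)" and into_I_right: "into_I z \<Longrightarrow> into_I (z * w)"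
  by (auto simp: preserves_I_def into_I_def app_simps)

lemma into_I_PTN: "into_I z \<Longrightarrow> into_I (PTN j n z)"
proof (induction n arbitrary: z)
  case (Suc n)
  have "into_I (munit m c a * (D m * z) * munit m a c)" for m a c
    by (intro into_I_right into_I_left preserves_I_munit preserves_I_act1 Suc.prems)
  then have "into_I (PT m z)" for m
    unfolding PT_def trm_def into_I_def by (auto simp: app_sum_left intro!: I_sum)
  then show ?case using Suc.IH by simp
qed simp

text \<open>The generators of the ideal concern the first two copies only. Conjugation by
  \<open>h 1 (Suc i)\<close> raises all indices by one and so yields the following
  relations.\<close>

lemma relation_into_I: "1 \<le> i \<Longrightarrow> into_I (r i * (Mb i * Mb (Suc i)) - Mb i * (Mb (Suc i) * r i))"
proof (induction i rule: dec_induct)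
  case base
  have r1: "rep (Suc (Suc 0)) (lift (site R 1)) = r 1"
    using rep_site[of 1 "Suc (Suc 0)" R] by simp
  have Mbar: "rep (Suc (Suc 0)) (Mbar F 1) = Mb 1" "rep (Suc (Suc 0)) (Mbar F 2) = Mb (Suc 1)"
  proof -
    show 1: "rep (Suc (Suc 0)) (Mbar F 1) = Mb 1"
      using rep_site1[of 1 "Suc (Suc 0)" M_mat] by simp
    then show "rep (Suc (Suc 0)) (Mbar F 2) = Mb (Suc 1)"
      by (simp add: eval_nat_numeral rep_tmul mult.assoc rep2_site1)
  qed
  let ?X = "lift (site R 1) \<bullet>\<bullet> Mbar F 1 \<bullet>\<bullet> Mbar F 2" and ?Y = "Mbar F 1 \<bullet>\<bullet> Mbar F 2 \<bullet>\<bullet> lift (site R 1)"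
  have "r 1 * (Mb 1 * Mb (Suc 1)) = rep (Suc (Suc 0)) ?X" "Mb 1 * (Mb (Suc 1) * r 1) = rep (Suc (Suc 0)) ?Y"
    unfolding rep_tmul r1 Mbar by (simp_all only: mult.assoc)
  then have "app (r 1 * (Mb 1 * Mb (Suc 1)) - Mb 1 * (Mb (Suc 1) * r 1)) g x
    = (\<Sum>ys | length ys = Suc (Suc 0). (?X (pre (Suc (Suc 0)) x) ys - ?Y (pre (Suc (Suc 0)) x) ys) * g (upd (Suc (Suc 0)) ys x))" for g x
    by (simp only: app_simps app_rep left_diff_distrib sum_subtractf)
  moreover have "?X xs ys - ?Y xs ys \<in> I" if "length xs = Suc (Suc 0)" "length ys = Suc (Suc 0)" for xs ys
    by (rule I_relations) (use that in \<open>auto simp: qm_relations_def eval_nat_numeral\<close>)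
  ultimately show ?case
    unfolding into_I_def by (auto intro!: I_sum I_right)
next
  case (step i)
  let ?h = "h 1 (Suc i)" and ?h' = "h' 1 (Suc i)"
  have c: "?h * r i = r (Suc i) * ?h" "?h * Mb i = Mb (Suc i) * ?h" "?h * Mb (Suc i) = Mb (Suc (Suc i)) * ?h"
    using step.hyps by (intro h_r h_Mb; simp)+
  note c' = c[THEN arg_cong, of "\<lambda>z. z * w" for w, unfolded mult.assoc]
  have "?h * (r i * (Mb i * Mb (Suc i)) - Mb i * (Mb (Suc i) * r i)) * ?h'
    = (r (Suc i) * (Mb (Suc i) * Mb (Suc (Suc i))) - Mb (Suc i) * (Mb (Suc (Suc i)) * r (Suc i))) * (?h * ?h')"
    by (simp only: right_diff_distrib left_diff_distrib mult.assoc c')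
  moreover have "into_I (?h * (r i * (Mb i * Mb (Suc i)) - Mb i * (Mb (Suc i) * r i)) * ?h')"
    by (intro into_I_right into_I_left preserves_I_h step.IH)
  ultimately show ?case by (simp only: hh' mult_1_right)
qed

text \<open>R_i commutes exactly with every copy other than i and i + 1, and with the product of
  these two modulo the ideal.\<close>

lemma MP_into_I: "1 \<le> i \<Longrightarrow> i < n \<Longrightarrow> into_I (r i * MP n - MP n * r i)"
proof (induction n)
  case (Suc n)
  show ?case
  proof (cases "i = n")
    case False
    have "r i * Mb (Suc n) = Mb (Suc n) * r i"
      using False Suc.prems by (intro Mb_comm_low rff) auto
    then have "r i * MP (Suc n) - MP (Suc n) * r i = (r i * MP n - MP n * r i) * Mb (Suc n)"
      by (simp add: left_diff_distrib mult.assoc del: Mb.simps)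
    then show ?thesis using Suc False by (simp add: into_I_right del: Mb.simps)
  next
    case True
    then obtain k where k: "n = Suc k" using Suc.prems by (cases n) auto
    have "r n * MP k = MP k * r n"
      using k by (intro idle_comm_act2 idle_MP) auto
    then have "r n * (MP k * z) = MP k * (r n * z)" for z by (simp flip: mult.assoc)
    then have "r i * MP (Suc n) - MP (Suc n) * r i = MP k * (r n * (Mb n * Mb (Suc n)) - Mb n * (Mb (Suc n) * r n))"
      unfolding True MP.simps(2)[of n] by (simp only: k MP.simps mult.assoc right_diff_distrib)
    then show ?thesis
      using relation_into_I[of n] Suc.prems True by (simp only: into_I_left preserves_I_MP)
  qed
qed simp

end

context qm_bmw
begin

lemma PTN_into_I: "into_I z \<Longrightarrow> app (PTN (Suc 0) n z) g x \<in> I"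
  using into_I_PTN into_I_def by blast

text \<open>Taken around the trace, R_i arrives in front of the copies of M; passing it behind them
  costs an element of the ideal.\<close>

lemma tau_cyc_r:
  assumes "1 \<le> i" "i < n"
  shows "tau n (r i * x) - tau n (x * r i) \<in> I"
proof -
  have "PTN (Suc 0) n (MP n * x * r i) = PTN (Suc 0) n (r i * (MP n * x))"
    by (rule PTN_cyc[OF assms])
  then have "tau n (x * r i) = app (PTN (Suc 0) n (r i * MP n * x)) (\<lambda>_. 1) undefined"
    by (simp add: tau_def mult.assoc)
  then have "tau n (x * r i) - tau n (r i * x) = app (PTN (Suc 0) n (r i * MP n * x) - PTN (Suc 0) n (MP n * r i * x)) (\<lambda>_. 1) undefined"
    by (simp add: tau_def app_simps mult.assoc)
  also have "PTN (Suc 0) n (r i * MP n * x) - PTN (Suc 0) n (MP n * r i * x) = PTN (Suc 0) n ((r i * MP n - MP n * r i) * x)"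
    using PTN_add[of "Suc 0" n "(r i * MP n - MP n * r i) * x" "MP n * r i * x"] by (simp add: algebra_simps)
  finally have "tau n (x * r i) - tau n (r i * x) \<in> I"
    using PTN_into_I into_I_right MP_into_I[OF assms] by simp
  then show ?thesis using I_left[of "tau n (x * r i) - tau n (r i * x)" "-1"] by simp
qed

lemma tau_cyc:
  assumes "y \<in> alg.B n"
  shows "tau n (y * x) - tau n (x * y) \<in> I"
  using assms
proof (induction arbitrary: x rule: alg.B.induct)
  case B_1
  then show ?case by (simp add: I_0)
next
  case (B_s i)
  then show ?case by (rule tau_cyc_r)
next
  case (B_si i)
  \<comment> \<open>The case of R_i, used for R_i^{-1} x R_i^{-1}.\<close>
  have "tau n (r i * (r' i * x * r' i)) - tau n (r' i * x * r' i * r i) \<in> I"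
    by (rule tau_cyc_r[OF B_si])
  then have "tau n (x * r' i) - tau n (r' i * x) \<in> I" by (simp add: mult.assoc)
  then show ?case using I_left[of "tau n (x * r' i) - tau n (r' i * x)" "-1"] by simp
next
  case (B_scale y c)
  then have "scalar c * (tau n (y * x) - tau n (x * y)) \<in> I" by (intro I_left)
  then show ?case by (simp add: tau_scale right_diff_distrib)
next
  case (B_add y z)
  then show ?case using I_add[OF B_add.IH(1)[of x] B_add.IH(2)[of x]]
    by (simp add: distrib_left distrib_right tau_add algebra_simps)
next
  case (B_mult y z)
  then show ?case using I_add[OF B_mult.IH(1)[of "z * x"] B_mult.IH(2)[of "x * y"]]
    by (simp add: mult.assoc)
qed

section \<open>Commutativity of characters: rotating the strands\<close>

fun dl :: "nat \<Rightarrow> ('v, 'v \<times> 'v) lop" where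
  "dl 0 = 1"
| "dl (Suc n) = dl n * r (Suc n)"

fun dl' :: "nat \<Rightarrow> ('v, 'v \<times> 'v) lop" where
  "dl' 0 = 1"
| "dl' (Suc n) = r' (Suc n) * dl' n"

lemma dldl' : "dl n * dl' n = 1"
  by (induction n) (simp_all add: mult.assoc)

lemma dl_B: "dl n \<in> alg.B (Suc n)" "dl' n \<in> alg.B (Suc n)"
  by (induction n) (auto intro!: alg.B_intros dest: alg.B_mono[of _ "Suc n" "Suc (Suc n)" for n])

text \<open>{R, R} is itself a compatible pair, and for it \<open>h 1 n\<close> is
  \<open>dl n\<close>; so this is \<open>h_r\<close> again.\<close>

lemma dl_r: "1 \<le> i \<Longrightarrow> i < n \<Longrightarrow> dl n * r i = r (Suc i) * dl n"
proof -
  interpret RR: qm_bmw R R q \<mu>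
    by unfold_locales (use R R_skew q \<mu> BMW in \<open>auto simp: compatible_def R_matrix_def teq_def\<close>)
  assume "1 \<le> i" "i < n"
  moreover have "RR.h 1 n = dl n" by (induction n) simp_all
  ultimately show ?thesis using RR.h_r[of 1 i n] by simp
qed

lemma dl_B_shift: "x \<in> alg.B n \<Longrightarrow> dl n * x = shift x * dl n"
proof (induction rule: alg.B.induct)
  case (B_s i)
  then show ?case by (simp add: dl_r shift_act2)
next
  case (B_si i)
  then show ?case using alg.conj_si[OF dl_r] by (simp add: shift_act2)
next
  case (B_mult x y)
  have "dl n * (x * y) = shift x * (dl n * y)" using B_mult.IH(1) by (simp flip: mult.assoc)
  then show ?case using B_mult.IH(2) by (simp add: shift_mult mult.assoc)
qed (simp_all add: shift_add shift_scale algebra_simps)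

lemma shift_B: "x \<in> alg.B n \<Longrightarrow> shift x \<in> alg.B (Suc n)"
  by (induction rule: alg.B.induct)
    (auto simp: shift_mult shift_add shift_scale shift_act2 intro: alg.B.intros)

lemma iterate_shift_B: "x \<in> alg.B n \<Longrightarrow> (shift ^^ m) x \<in> alg.B (m + n)"
  by (induction m) (auto dest: shift_B)

lemma dl_power_shift: "x \<in> alg.B k \<Longrightarrow> m + k \<le> Suc n \<Longrightarrow> dl n ^ m * x = (shift ^^ m) x * dl n ^ m"
proof (induction m)
  case (Suc m)
  have "dl n ^ Suc m * x = dl n * (shift ^^ m) x * dl n ^ m"
    using Suc by (simp add: mult.assoc)
  also have "dl n * (shift ^^ m) x = shift ((shift ^^ m) x) * dl n"
    using Suc.prems by (intro dl_B_shift alg.B_mono[OF iterate_shift_B]) auto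
  finally show ?case by (simp add: mult.assoc power_commutes)
qed simp

lemma dl_front: "dl (Suc n) = r 1 * shift (dl n)"
proof (induction n)
  case (Suc n)
  have "dl (Suc (Suc n)) = r 1 * shift (dl n) * r (Suc (Suc n))"
    by (simp only: dl.simps(2)[of "Suc n"] Suc)
  also have "\<dots> = r 1 * shift (dl (Suc n))"
    by (simp only: dl.simps(2) shift_mult shift_act2 mult.assoc)
  finally show ?case .
qed simp

text \<open>\<open>dl\<close> raises the index of a crossing while there is room; its square takes
  the last crossing back to the first, as a rotation would.\<close>

lemma dl_square: "dl (Suc n) * (dl (Suc n) * r (Suc n)) = r 1 * (dl (Suc n) * dl (Suc n))"
proof -
  have "r 1 * (dl (Suc n) * dl (Suc n)) = r 1 * (dl (Suc n) * dl n) * r (Suc n)"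
    by (simp add: mult.assoc)
  also have "dl (Suc n) * dl n = shift (dl n) * dl (Suc n)"
    by (rule dl_B_shift) (rule dl_B)
  also have "r 1 * (shift (dl n) * dl (Suc n)) * r (Suc n) = dl (Suc n) * (dl (Suc n) * r (Suc n))"
    by (simp only: dl_front mult.assoc)
  finally show ?thesis by simp
qed

text \<open>\<open>dl n ^ Suc n\<close> is the full twist.\<close>

lemma dl_central:
  assumes "x \<in> alg.B (Suc n)"
  shows "dl n ^ Suc n * x = x * dl n ^ Suc n"
proof -
  have r: "dl n ^ Suc n * r i = r i * dl n ^ Suc n" if i: "1 \<le> i" "i < Suc n" for i
  proof -
    obtain p where p: "n = Suc p" using i by (cases n) auto
    let ?d = "dl n"
    \<comment> \<open>n - i single steps take R_i to R_n, the square takes R_n to R_1, and i - 1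
      steps lead back to R_i.\<close>
    have n: "Suc n = (i - 1) + (2 + (n - i))" using i by simp
    have r_B: "r i \<in> alg.B (Suc i)" "r 1 \<in> alg.B 2"
      using i by (auto intro: alg.B_intros)
    have a: "?d ^ (n - i) * r i = r n * ?d ^ (n - i)"
      using dl_power_shift[OF r_B(1), of "n - i" n] i by (simp add: iterate_shift_act2)
    have b: "?d ^ 2 * r n = r 1 * ?d ^ 2"
      using dl_square[of p] by (simp add: p power2_eq_square mult.assoc del: dl.simps)
    have c: "?d ^ (i - 1) * r 1 = r i * ?d ^ (i - 1)"
      using dl_power_shift[OF r_B(2), of "i - 1" n] i by (simp add: iterate_shift_act2)
    have "?d ^ Suc n * r i = ?d ^ (i - 1) * (?d ^ 2 * (?d ^ (n - i) * r i))"
      by (subst n) (simp only: power_add mult.assoc)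
    also have "\<dots> = ?d ^ (i - 1) * ((?d ^ 2 * r n) * ?d ^ (n - i))" unfolding a by (simp only: mult.assoc)
    also have "\<dots> = (?d ^ (i - 1) * r 1) * (?d ^ 2 * ?d ^ (n - i))" unfolding b by (simp only: mult.assoc)
    also have "\<dots> = r i * ?d ^ ((i - 1) + (2 + (n - i)))" unfolding c by (simp only: power_add mult.assoc)
    finally show ?thesis unfolding n[symmetric] .
  qed
  show ?thesis using assms
  proof (induction rule: alg.B.induct)
    case (B_s i)
    then show ?case by (rule r)
  next
    case (B_si i)
    then show ?case by (intro alg.conj_si r)
  next
    case (B_mult x y)
    then show ?case by (metis mult.assoc)
  qed (simp_all add: algebra_simps del: power_Suc)
qed

lemma B_shift_comm:
  assumes "y \<in> alg.B k" "x \<in> alg.B n"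
  shows "(shift ^^ k) x * y = y * (shift ^^ k) x"
  using assms(2)
proof (induction rule: alg.B.induct)
  case (B_s i)
  then show ?case using alg.B_comm[OF assms(1), of "k + i"] by (simp add: iterate_shift_act2)
next
  case (B_si i)
  then show ?case using alg.B_comm_si[OF assms(1), of "k + i"] by (simp add: iterate_shift_act2)
next
  case (B_mult x z)
  have "(shift ^^ k) (x * z) * y = (shift ^^ k) x * ((shift ^^ k) z * y)"
    by (simp only: iterate_shift_mult mult.assoc)
  also have "\<dots> = ((shift ^^ k) x * y) * (shift ^^ k) z" unfolding B_mult.IH(2) by (simp only: mult.assoc)
  finally show ?case unfolding B_mult.IH(1) by (simp only: iterate_shift_mult mult.assoc)
qed (simp_all add: iterate_shift_add iterate_shift_scale algebra_simps)

text \<open>Conjugation by the \<open>k\<close>-th power of \<open>dl (n + k - 1)\<close> exchanges a block of \<open>n\<close> strands with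
  a block of \<open>k\<close> strands.\<close>

lemma tau_commute:
  assumes x: "x \<in> alg.B n" and y: "y \<in> alg.B k"
  shows "tau n x * tau k y - tau k y * tau n x \<in> I"
proof (cases "n + k = 0")
  case True
  then have n: "n = 0" "k = 0" by auto
  have "z \<in> alg.B 0 \<Longrightarrow> z * w = w * z" if "w \<in> alg.B 0" for z w
    using B_shift_comm[of w 0 z 0] that by simp
  then show ?thesis
    using assms tau_product[OF assms] tau_product[OF y x] unfolding n by (simp add: I_0)
next
  case False
  then obtain p where p: "n + k = Suc p" by (cases "n + k") auto
  let ?d = "dl p" and ?d' = "dl' p"
  have dd': "?d ^ m * ?d' ^ m = 1" for m
  proof (induction m)
    case (Suc m)
    have "?d ^ Suc m * ?d' ^ Suc m = ?d ^ m * (?d * ?d') * ?d' ^ m"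
      by (simp only: power_Suc2[of ?d] power_Suc[of ?d'] mult.assoc)
    then show ?case by (simp add: dldl' Suc)
  qed simp
  have BN: "x * (shift ^^ n) y \<in> alg.B (n + k)" "y * (shift ^^ k) x \<in> alg.B (n + k)"
    using x y iterate_shift_B[OF y, of n] iterate_shift_B[OF x, of k]
    by (auto intro!: alg.B_mult simp: add.commute dest: alg.B_mono[of _ n "n + k"] alg.B_mono[of _ k "n + k"])
  have pow: "?d ^ m \<in> alg.B (n + k)" "?d' ^ m \<in> alg.B (n + k)" for m
    by (induction m) (use dl_B[of p] p in \<open>auto intro!: alg.B_intros\<close>)
  have sh: "(shift ^^ n) y * ?d ^ n = ?d ^ n * y"
    using dl_power_shift[OF y, of n p] p by simp
  \<comment> \<open>The n-th power of \<open>?d\<close> completes both sides to the full twist,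
    which commutes with y.\<close>
  have "?d ^ k * (shift ^^ n) y = y * ?d ^ k"
  proof -
    have "?d ^ k * (shift ^^ n) y = ?d ^ k * ((shift ^^ n) y * ?d ^ n) * ?d' ^ n"
      using dd'[of n] by (simp add: mult.assoc)
    also have "\<dots> = (?d ^ (n + k) * y) * ?d' ^ n"
      unfolding sh by (simp add: power_add mult.assoc add.commute[of n])
    also have "?d ^ (n + k) * y = y * ?d ^ (n + k)"
      unfolding p by (rule dl_central) (use y p alg.B_mono in auto)
    also have "y * ?d ^ (n + k) * ?d' ^ n = y * ?d ^ k * (?d ^ n * ?d' ^ n)"
      by (simp add: power_add mult.assoc add.commute[of n])
    finally show ?thesis by (simp add: dd')
  qed
  note 1 = this
  have 2: "?d ^ k * x = (shift ^^ k) x * ?d ^ k"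
    using dl_power_shift[OF x, of k p] p by simp
  have "?d ^ k * (x * (shift ^^ n) y) = (shift ^^ k) x * (?d ^ k * (shift ^^ n) y)"
    by (simp only: 2 flip: mult.assoc)
  also have "\<dots> = (shift ^^ k) x * y * ?d ^ k" unfolding 1 by (simp only: mult.assoc)
  also have "(shift ^^ k) x * y = y * (shift ^^ k) x" by (rule B_shift_comm[OF y x])
  finally have 3: "?d ^ k * (x * (shift ^^ n) y) = y * (shift ^^ k) x * ?d ^ k" .
  then have conj: "?d ^ k * (x * (shift ^^ n) y) * ?d' ^ k = y * (shift ^^ k) x"
    using dd'[of k] by (simp add: mult.assoc)
  have "tau (n + k) (?d' ^ k * (?d ^ k * (x * (shift ^^ n) y))) - tau (n + k) (?d ^ k * (x * (shift ^^ n) y) * ?d' ^ k) \<in> I"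
    by (rule tau_cyc[OF pow(2)])
  moreover have "?d' ^ k * (?d ^ k * (x * (shift ^^ n) y)) = x * (shift ^^ n) y"
  proof -
    have "dl' p * dl p = 1"
    proof (induction p)
      case (Suc m)
      have "dl' (Suc m) * dl (Suc m) = r' (Suc m) * ((dl' m * dl m) * r (Suc m))" by (simp add: mult.assoc)
      then show ?case by (simp add: Suc)
    qed simp
    then have "?d' ^ m * ?d ^ m = 1" for m
    proof (induction m)
      case (Suc m)
      have "?d' ^ Suc m * ?d ^ Suc m = ?d' ^ m * (?d' * ?d) * ?d ^ m"
        by (simp only: power_Suc2[of ?d'] power_Suc[of ?d] mult.assoc)
      then show ?case using Suc by simp
    qed simp
    then show ?thesis by (simp flip: mult.assoc)
  qed
  ultimately show ?thesis
    using tau_product[OF x y] tau_product[OF y x] by (simp add: conj add.commute)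
qed

end

text \<open>An identity modulo a subspace \<open>J\<close> holds as soon as all functionals in \<open>separating J\<close> confirm it.\<close>

definition separating :: "'x free_algebra set \<Rightarrow> ('x free_algebra \<Rightarrow> complex) set" where
  "separating J = {l. (\<forall>x y. l (x + y) = l x + l y) \<and> (\<forall>c x. l (scalar c * x) = c * l x) \<and> (\<forall>x\<in>J. l x = 0)}"

lemma separating_add: "l \<in> separating J \<Longrightarrow> l (x + y) = l x + l y"
  and separating_scale: "l \<in> separating J \<Longrightarrow> l (scalar c * x) = c * l x"
  and separating_zero: "l \<in> separating J \<Longrightarrow> x \<in> J \<Longrightarrow> l x = 0"
  by (simp_all add: separating_def)

lemma separating_0: "l \<in> separating J \<Longrightarrow> l 0 = 0"
  using separating_scale[of l J 0 0] by simp

lemma separating_diff: "l \<in> separating J \<Longrightarrow> l (x - y) = l x - l y"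
  using separating_add[of l J "x - y" y] by simp

lemma separating_sum: "l \<in> separating J \<Longrightarrow> l (sum g A) = (\<Sum>a\<in>A. l (g a))"
  by (induction A rule: infinite_finite_induct) (simp_all add: separating_0 separating_add)

text \<open>If x is outside J, a basis of J stays independent when x is added, so some functional is
  1 at x and vanishes on J.\<close>

lemma separating_complete:
  assumes J: "0 \<in> J" "\<And>x y. x \<in> J \<Longrightarrow> y \<in> J \<Longrightarrow> x + y \<in> J" "\<And>c x. x \<in> J \<Longrightarrow> scalar c * x \<in> J"
    and l: "\<And>l. l \<in> separating J \<Longrightarrow> l x = 0"
  shows "x \<in> J"
proof (rule ccontr)
  assume x: "x \<notin> J"
  interpret vector_space_pair "\<lambda>c (x :: 'a free_algebra). scalar c * x" "(*) :: complex \<Rightarrow> complex \<Rightarrow> complex"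
    by unfold_locales (simp_all add: algebra_simps)
  have sub: "free.subspace J" using J by (auto simp: free.subspace_def)
  obtain B where B: "B \<subseteq> J" "free.independent B" "J \<subseteq> free.span B"
    using free.maximal_independent_subset by blast
  have span: "free.span B = J"
    using B(3) free.span_minimal[OF B(1) sub] by auto
  have ind: "free.independent (insert x B)"
    using B x span by (intro free.independent_insertI) auto
  then obtain g where g: "Vector_Spaces.linear (\<lambda>c (x :: 'a free_algebra). scalar c * x) (*) g"
    and gB: "\<forall>y\<in>insert x B. g y = (if y = x then 1 else 0)"
    using linear_independent_extend[OF ind, of "\<lambda>y. if y = x then 1 else 0"] by blast
  have "g y = 0" if "y \<in> J" for y
  proof (rule linear_eq_0_on_span[OF g])
    show "y \<in> free.span B" using that span by simp
    show "g z = 0" if "z \<in> B" for z using that gB x B(1) by auto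
  qed
  moreover have "g (y + z) = g y + g z" "g (scalar c * y) = c * g y" for y z c
    using g by (simp_all add: linear_add linear_scale)
  ultimately have "g \<in> separating J" by (simp add: separating_def)
  then show False using l[of g] gB by simp
qed

section \<open>The alternating relation from the two Newton relations\<close>

lemma sum_double_reindex:
  fixes X :: "nat \<Rightarrow> nat \<Rightarrow> complex"
  shows "(\<Sum>m\<le>n. \<Sum>t\<in>{1..m div 2}. X m t) = (\<Sum>t\<in>{1..n div 2}. \<Sum>i\<le>n - 2 * t. X (i + 2 * t) t)"
proof -
  have "(\<Sum>m\<le>n. \<Sum>t\<in>{1..m div 2}. X m t) = (\<Sum>(m, t)\<in>(SIGMA m:{..n}. {1..m div 2}). X m t)"
    by (rule sum.Sigma) auto
  also have "\<dots> = (\<Sum>(t, i)\<in>(SIGMA t:{1..n div 2}. {..n - 2 * t}). X (i + 2 * t) t)"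
    by (rule sum.reindex_bij_witness[where i = "\<lambda>(t, i). (i + 2 * t, t)" and j = "\<lambda>(m, t). (t, m - 2 * t)"]) auto
  also have "\<dots> = (\<Sum>t\<in>{1..n div 2}. \<Sum>i\<le>n - 2 * t. X (i + 2 * t) t)"
    by (rule sum.Sigma[symmetric]) auto
  finally show ?thesis .
qed

lemma sum_flip: "(\<Sum>i\<le>n. (X :: nat \<Rightarrow> complex) i) = (\<Sum>i\<le>n. X (n - i))"
  by (rule sum.reindex_bij_witness[where i = "\<lambda>i. n - i" and j = "\<lambda>i. n - i"]) auto

text \<open>Combines the coefficients which the two evaluations below give to a_i s_j for i + j =
  n.\<close>

lemma qnum_add:
  assumes "q \<noteq> 0"
  shows "qnum q (i + j) = q powi (- int j) * qnum q i + q ^ i * qnum q j"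
proof -
  have "q ^ (i + j) - inverse q ^ (i + j) = inverse q ^ j * (q ^ i - inverse q ^ i) + q ^ i * (q ^ j - inverse q ^ j)"
    by (simp add: power_add algebra_simps)
  then show ?thesis
    by (simp add: qnum_def power_int_minus power_inverse flip: add_divide_distrib)
qed

text \<open>The sum of the \<open>(- q)^i q^{- j} a_i s_j p_k\<close> over \<open>i + j + k = n\<close>, \<open>k \<ge> 1\<close>, is evaluated in two ways.\<close>

lemma wronski_of_newton:
  fixes a s p :: "nat \<Rightarrow> 'f::ring_1" and g :: 'f and L :: "('f \<Rightarrow> complex) set" and q \<mu> :: complex
  assumes q: "q \<noteq> 0"
    and closed: "\<And>l u v. l \<in> L \<Longrightarrow> (\<lambda>x. l (u * x * v)) \<in> L"
    and comm: "\<And>l i j. l \<in> L \<Longrightarrow> l (s j * a i) = l (a i * s j)"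
    and newton_a: "\<And>l m. l \<in> L \<Longrightarrow> m \<le> n \<Longrightarrow> (\<Sum>i<m. (- q) ^ i * l (a i * p (m - i))) =
      (-1) powi (int m - 1) * qnum q m * l (a m) + (-1) ^ m * (\<Sum>t\<in>{1..m div 2}.
      (\<mu> * q powi (int m - 2 * int t) - q powi (1 - int m + 2 * int t)) * l (a (m - 2 * t) * g ^ t))"
    and newton_s: "\<And>l m. l \<in> L \<Longrightarrow> m \<le> n \<Longrightarrow> (\<Sum>i<m. q powi (- int i) * l (s i * p (m - i))) =
      qnum q m * l (s m) + (\<Sum>t\<in>{1..m div 2}.
      (\<mu> * q powi (2 * int t - int m) + q powi (int m - 2 * int t - 1)) * l (s (m - 2 * t) * g ^ t))"
    and qn: "\<And>m. 1 \<le> m \<Longrightarrow> m \<le> n \<Longrightarrow> qnum q m \<noteq> 0"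
    and q2: "2 \<le> n \<Longrightarrow> qnum q 2 = q + inverse q"
    and a0: "a 0 = 1" and s0: "s 0 = 1"
    and l: "l \<in> L"
  shows "(\<Sum>i\<le>n. (-1) ^ i * l (a i * s (n - i))) = of_bool (n = 0) * l 1 - of_bool (n = 2) * l g"
  using newton_a newton_s qn q2 l
proof (induction n arbitrary: l rule: less_induct)
  case (less n)
  show ?case
  proof (cases "n = 0")
    case False
    note na = less.prems(1) and ns = less.prems(2) and l = less.prems(5)
    define c where "c i j t = l (a i * s j * g ^ t)" for i j t
    have comm': "l (s j * (a i * v)) = l (a i * (s j * v))" for i j v
      using comm[OF closed[OF l, of 1 v], of j i] by (simp add: mult.assoc)
    let ?A = "\<lambda>m t. \<mu> * q powi (int m - 2 * int t) - q powi (1 - int m + 2 * int t)"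
    let ?B = "\<lambda>m t. \<mu> * q powi (2 * int t - int m) + q powi (int m - 2 * int t - 1)"
    \<comment> \<open>Two groupings of one triple sum: \<open>?P\<close> fixes s_{n-m} and pairs a
      with p, \<open>?Q\<close> fixes a_{n-m} and pairs s with p.\<close>
    let ?P = "\<lambda>m i. q powi (- int (n - m)) * ((- q) ^ i * l (a i * (s (n - m) * p (m - i))))"
    let ?Q = "\<lambda>m i. (- q) ^ (n - m) * (q powi (- int i) * l (a (n - m) * (s i * p (m - i))))"
    have NA: "(\<Sum>i<m. ?P m i) = q powi (- int (n - m)) * ((-1) powi (int m - 1) * qnum q m * c m (n - m) 0
        + (-1) ^ m * (\<Sum>t\<in>{1..m div 2}. ?A m t * c (m - 2 * t) (n - m) t))" if "m \<le> n" for m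
    proof -
      have "(\<Sum>i<m. ?P m i) = q powi (- int (n - m)) * (\<Sum>i<m. (- q) ^ i * l (s (n - m) * (a i * p (m - i)) * 1))"
        by (simp add: sum_distrib_left comm' mult_ac)
      also note na[OF closed[OF l] that]
      finally show ?thesis by (simp add: c_def comm' mult.assoc) (simp add: comm'[of _ _ 1, simplified])
    qed
    have NS: "(\<Sum>i<m. ?Q m i) = (- q) ^ (n - m) * (qnum q m * c (n - m) m 0
        + (\<Sum>t\<in>{1..m div 2}. ?B m t * c (n - m) (m - 2 * t) t))" if "m \<le> n" for m
    proof -
      have "(\<Sum>i<m. ?Q m i) = (- q) ^ (n - m) * (\<Sum>i<m. q powi (- int i) * l (a (n - m) * (s i * p (m - i)) * 1))"
        by (simp add: sum_distrib_left mult_ac)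
      also note ns[OF closed[OF l] that]
      finally show ?thesis by (simp add: c_def mult.assoc)
    qed
    have PQ: "(\<Sum>m\<le>n. \<Sum>i<m. ?P m i) = (\<Sum>m\<le>n. \<Sum>i<m. ?Q m i)"
    proof -
      have "(\<Sum>m\<le>n. \<Sum>i<m. ?P m i) = (\<Sum>(m, i)\<in>(SIGMA m:{..n}. {..<m}). ?P m i)"
        by (rule sum.Sigma) auto
      also have "\<dots> = (\<Sum>(m, i)\<in>(SIGMA m:{..n}. {..<m}). ?Q m i)"
      \<comment> \<open>The triple of indices of a, s, p is (i, n - m, m - i) in the first grouping
        and (n - m, i, m - i) in the second.\<close>
      proof (rule sum.reindex_bij_witness[where i = "\<lambda>(m, i). (n - i, n - m)" and j = "\<lambda>(m, i). (n - i, n - m)"])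
        fix x assume x: "x \<in> (SIGMA m:{..n}. {..<m})"
        obtain m i where mi: "x = (m, i)" "m \<le> n" "i < m" using x by auto
        have "n - i - (n - m) = m - i" "n - (n - i) = i" using mi by auto
        then show "(case (case x of (m, i) \<Rightarrow> (n - i, n - m)) of (m, i) \<Rightarrow> ?Q m i) = (case x of (m, i) \<Rightarrow> ?P m i)"
          by (simp add: mi mult_ac)
      qed auto
      also have "\<dots> = (\<Sum>m\<le>n. \<Sum>i<m. ?Q m i)"
        by (rule sum.Sigma[symmetric]) auto
      finally show ?thesis .
    qed
    have P: "(\<Sum>m\<le>n. \<Sum>i<m. ?P m i) = (\<Sum>i\<le>n. (- ((-1) ^ i)) * (q powi (- int (n - i)) * qnum q i) * c i (n - i) 0)
       + (\<Sum>t\<in>{1..n div 2}. \<Sum>i\<le>n - 2 * t. q powi (- int (n - 2 * t - i)) * (-1) ^ i * ?A (i + 2 * t) t * c i (n - 2 * t - i) t)"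
    proof -
      have "(\<Sum>m\<le>n. \<Sum>i<m. ?P m i) = (\<Sum>m\<le>n. (- ((-1) ^ m)) * (q powi (- int (n - m)) * qnum q m) * c m (n - m) 0)
        + (\<Sum>m\<le>n. \<Sum>t\<in>{1..m div 2}. q powi (- int (n - m)) * (-1) ^ m * ?A m t * c (m - 2 * t) (n - m) t)"
        unfolding sum.distrib[symmetric]
      proof (intro sum.cong refl)
        fix m assume "m \<in> {..n}"
        moreover have "(-1) powi (int m - 1) = - ((-1 :: complex) ^ m)"
          by (cases "even m") (simp_all add: power_int_minus_left)
        ultimately show "(\<Sum>i<m. ?P m i) = (- ((-1) ^ m)) * (q powi (- int (n - m)) * qnum q m) * c m (n - m) 0
          + (\<Sum>t\<in>{1..m div 2}. q powi (- int (n - m)) * (-1) ^ m * ?A m t * c (m - 2 * t) (n - m) t)"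
          using NA[of m] by (simp only: atMost_iff distrib_left sum_distrib_left mult_minus_left mult_minus_right mult.assoc mult.left_commute)
      qed
      also have "(\<Sum>m\<le>n. \<Sum>t\<in>{1..m div 2}. q powi (- int (n - m)) * (-1) ^ m * ?A m t * c (m - 2 * t) (n - m) t)
        = (\<Sum>t\<in>{1..n div 2}. \<Sum>i\<le>n - 2 * t. q powi (- int (n - (i + 2 * t))) * (-1) ^ (i + 2 * t) * ?A (i + 2 * t) t * c (i + 2 * t - 2 * t) (n - (i + 2 * t)) t)"
        by (rule sum_double_reindex)
      also have "\<dots> = (\<Sum>t\<in>{1..n div 2}. \<Sum>i\<le>n - 2 * t. q powi (- int (n - 2 * t - i)) * (-1) ^ i * ?A (i + 2 * t) t * c i (n - 2 * t - i) t)"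
      proof (intro sum.cong refl)
        fix t i
        have "n - (i + 2 * t) = n - 2 * t - i" "i + 2 * t - 2 * t = i" by auto
        then show "q powi (- int (n - (i + 2 * t))) * (-1) ^ (i + 2 * t) * ?A (i + 2 * t) t * c (i + 2 * t - 2 * t) (n - (i + 2 * t)) t
          = q powi (- int (n - 2 * t - i)) * (-1) ^ i * ?A (i + 2 * t) t * c i (n - 2 * t - i) t"
          by (simp only: power_add power_mult) simp
      qed
      finally show ?thesis .
    qed
    have Q: "(\<Sum>m\<le>n. \<Sum>i<m. ?Q m i) = (\<Sum>i\<le>n. (-1) ^ i * (q ^ i * qnum q (n - i)) * c i (n - i) 0)
       + (\<Sum>t\<in>{1..n div 2}. \<Sum>i\<le>n - 2 * t. (- q) ^ i * ?B (n - i) t * c i (n - 2 * t - i) t)"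
    proof -
      have "(\<Sum>m\<le>n. \<Sum>i<m. ?Q m i) = (\<Sum>m\<le>n. (- q) ^ (n - m) * qnum q m * c (n - m) m 0)
        + (\<Sum>m\<le>n. \<Sum>t\<in>{1..m div 2}. (- q) ^ (n - m) * (?B m t * c (n - m) (m - 2 * t) t))"
        unfolding sum.distrib[symmetric]
      proof (intro sum.cong refl)
        fix m assume "m \<in> {..n}"
        then show "(\<Sum>i<m. ?Q m i) = (- q) ^ (n - m) * qnum q m * c (n - m) m 0
          + (\<Sum>t\<in>{1..m div 2}. (- q) ^ (n - m) * (?B m t * c (n - m) (m - 2 * t) t))"
          using NS[of m] by (simp only: atMost_iff distrib_left[of "(- q) ^ (n - m)"] sum_distrib_left mult.assoc)
      qed
      also have "(\<Sum>m\<le>n. (- q) ^ (n - m) * qnum q m * c (n - m) m 0) = (\<Sum>i\<le>n. (-1) ^ i * (q ^ i * qnum q (n - i)) * c i (n - i) 0)"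
        by (subst sum_flip) (intro sum.cong refl, simp add: power_minus[of q] mult.assoc)
      also have "(\<Sum>m\<le>n. \<Sum>t\<in>{1..m div 2}. (- q) ^ (n - m) * (?B m t * c (n - m) (m - 2 * t) t))
        = (\<Sum>t\<in>{1..n div 2}. \<Sum>i\<le>n - 2 * t. (- q) ^ (n - (i + 2 * t)) * (?B (i + 2 * t) t * c (n - (i + 2 * t)) (i + 2 * t - 2 * t) t))"
        by (rule sum_double_reindex)
      also have "\<dots> = (\<Sum>t\<in>{1..n div 2}. \<Sum>i\<le>n - 2 * t. (- q) ^ i * ?B (n - i) t * c i (n - 2 * t - i) t)"
      proof (rule sum.cong[OF refl], subst sum_flip, intro sum.cong refl)
        fix t i assume "t \<in> {1..n div 2}" "i \<in> {..n - 2 * t}"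
        then have "n - 2 * t - i + 2 * t = n - i" "n - (n - i) = i" "n - i - 2 * t = n - 2 * t - i" by auto
        then show "(- q) ^ (n - (n - 2 * t - i + 2 * t)) * (?B (n - 2 * t - i + 2 * t) t * c (n - (n - 2 * t - i + 2 * t)) (n - 2 * t - i + 2 * t - 2 * t) t)
          = (- q) ^ i * ?B (n - i) t * c i (n - 2 * t - i) t"
          by (simp add: mult.assoc)
      qed
      finally show ?thesis .
    qed
    let ?H = "\<lambda>t. \<Sum>i\<le>n - 2 * t. (-1) ^ i * c i (n - 2 * t - i) t"
    let ?e = "\<lambda>t. q powi (1 - int (n - 2 * t)) + q powi (int (n - 2 * t) - 1)"
    have first: "(\<Sum>i\<le>n. (-1) ^ i * (q ^ i * qnum q (n - i)) * c i (n - i) 0)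
      - (\<Sum>i\<le>n. (- ((-1) ^ i)) * (q powi (- int (n - i)) * qnum q i) * c i (n - i) 0) = qnum q n * (\<Sum>i\<le>n. (-1) ^ i * c i (n - i) 0)"
      unfolding sum_subtractf[symmetric] sum_distrib_left
    proof (intro sum.cong refl)
      fix i assume "i \<in> {..n}"
      then have "qnum q n = q powi (- int (n - i)) * qnum q i + q ^ i * qnum q (n - i)"
        using qnum_add[OF q, of i "n - i"] by simp
      then show "(-1) ^ i * (q ^ i * qnum q (n - i)) * c i (n - i) 0 - (- ((-1) ^ i)) * (q powi (- int (n - i)) * qnum q i) * c i (n - i) 0
        = qnum q n * ((-1) ^ i * c i (n - i) 0)"
        by (simp only:) (simp add: algebra_simps)
    qed
    \<comment> \<open>The terms with \<mu> cancel. The remaining coefficient depends on n - 2 t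
      only, which leaves alternating sums for n - 2 t.\<close>
    have second: "(\<Sum>t\<in>{1..n div 2}. \<Sum>i\<le>n - 2 * t. (- q) ^ i * ?B (n - i) t * c i (n - 2 * t - i) t)
      - (\<Sum>t\<in>{1..n div 2}. \<Sum>i\<le>n - 2 * t. q powi (- int (n - 2 * t - i)) * (-1) ^ i * ?A (i + 2 * t) t * c i (n - 2 * t - i) t)
      = (\<Sum>t\<in>{1..n div 2}. ?e t * ?H t)"
      unfolding sum_subtractf[symmetric] sum_distrib_left
    proof (intro sum.cong refl)
      fix t i assume t: "t \<in> {1..n div 2}" and i: "i \<in> {..n - 2 * t}"
      then obtain j where j: "n = i + j + 2 * t"
        by (metis atLeastAtMost_iff atMost_iff le_add_diff_inverse le_add_diff_inverse2 times_div_less_eq_dividend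
            mult_le_mono2 order_trans)
      have A: "?A (i + 2 * t) t = \<mu> * q ^ i - q * inverse q ^ i"
      proof -
        have "1 - int (i + 2 * t) + 2 * int t = 1 + - int i" by simp
        moreover have "q powi (1 + - int i) = q * inverse q ^ i"
          using q by (subst power_int_add) (auto simp: power_int_minus power_inverse)
        ultimately have "q powi (1 - int (i + 2 * t) + 2 * int t) = q * inverse q ^ i" by (simp only:)
        then show ?thesis by simp
      qed
      have q_minus: "q powi (- int j) = inverse q ^ j" for j
        by (simp add: power_int_minus power_inverse)
      have q_pred: "q powi (int j + - 1) = q ^ j * inverse q" for j
        using q by (subst power_int_add) (auto simp: power_int_minus)
      have q_succ: "q powi (1 + - int j) = q * inverse q ^ j" for j
        using q by (subst power_int_add) (auto simp: q_minus)
      have B: "?B (n - i) t = \<mu> * inverse q ^ j + q ^ j * inverse q"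
      proof -
        have 1: "2 * int t - int (n - i) = - int j" and 2: "int (n - i) - 2 * int t - 1 = int j + - 1"
          by (simp_all add: j)
        show ?thesis unfolding 1 2 q_minus q_pred ..
      qed
      have e: "?e t = q * (inverse q ^ i * inverse q ^ j) + q ^ i * q ^ j * inverse q"
      proof -
        have 1: "1 - int (n - 2 * t) = 1 + - int (i + j)" and 2: "int (n - 2 * t) - 1 = int (i + j) + - 1"
          by (simp_all add: j)
        show ?thesis unfolding 1 2 q_succ q_pred power_add ..
      qed
      have pj: "q powi (- int (n - 2 * t - i)) = inverse q ^ j" by (simp add: j power_int_minus power_inverse)
      have qi: "q ^ i * inverse q ^ i = 1" using q by (simp flip: power_mult_distrib)
      have m: "(- q) ^ i = (-1) ^ i * q ^ i" by (rule power_minus)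
      have "(- q) ^ i * ?B (n - i) t - q powi (- int (n - 2 * t - i)) * (-1) ^ i * ?A (i + 2 * t) t = ?e t * (-1) ^ i"
        unfolding A B e pj m using qi by (simp add: algebra_simps)
      then show "(- q) ^ i * ?B (n - i) t * c i (n - 2 * t - i) t
        - q powi (- int (n - 2 * t - i)) * (-1) ^ i * ?A (i + 2 * t) t * c i (n - 2 * t - i) t
        = ?e t * ((-1) ^ i * c i (n - 2 * t - i) t)"
        by (simp only: left_diff_distrib[symmetric] mult.assoc[symmetric])
    qed
    have total: "qnum q n * (\<Sum>i\<le>n. (-1) ^ i * c i (n - i) 0) + (\<Sum>t\<in>{1..n div 2}. ?e t * ?H t) = 0"
    proof -
      have "(u' - u) + (v' - v) = 0" if "x = u + v" "y = u' + v'" "x = y" for u u' v v' x y :: complex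
        using that by (simp add: algebra_simps)
      from this[OF P Q PQ] show ?thesis unfolding first second .
    qed
    \<comment> \<open>The induction hypothesis is applied to the functional x |-> l(x g^t); this is
      what \<open>closed\<close> is for.\<close>
    have H: "?H t = of_bool (n = 2 * t) * l (g ^ t) - of_bool (n = 2 * t + 2) * l (g ^ Suc t)" if t: "t \<in> {1..n div 2}" for t
    proof -
      have n': "n - 2 * t < n" "2 * t \<le> n" using t by auto
      have "(\<Sum>i\<le>n - 2 * t. (-1) ^ i * l (1 * (a i * s (n - 2 * t - i)) * g ^ t))
        = of_bool (n - 2 * t = 0) * l (1 * 1 * g ^ t) - of_bool (n - 2 * t = 2) * l (1 * g * g ^ t)"
        by (rule less.IH[OF n'(1)]) (use less.prems n' closed in \<open>auto simp del: mult_1_left\<close>)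
      moreover have "n - 2 * t = 0 \<longleftrightarrow> n = 2 * t" "n - 2 * t = 2 \<longleftrightarrow> n = 2 * t + 2" using n' by auto
      ultimately show ?thesis by (simp add: c_def)
    qed
    \<comment> \<open>Only n = 2 t and n = 2 t + 2 contribute, both with q + 1/q and with opposite
      signs. They cancel unless n = 2, where the second would need t = 0.\<close>
    have "(\<Sum>t\<in>{1..n div 2}. ?e t * ?H t) = of_bool (n = 2) * ((q + inverse q) * l g)"
    proof -
      have "(\<Sum>t\<in>{1..n div 2}. ?e t * ?H t) = (\<Sum>t\<in>{1..n div 2}. ?e t * (of_bool (n = 2 * t) * l (g ^ t) - of_bool (n = 2 * t + 2) * l (g ^ Suc t)))"
        by (rule sum.cong[OF refl]) (simp only: H)
      also have "\<dots> = of_bool (n = 2) * ((q + inverse q) * l g)"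
      proof (cases "odd n")
        case True
        then have "n \<noteq> 2 * t" "n \<noteq> 2 * t + 2" for t by auto
        moreover have "n \<noteq> 2" using True by auto
        ultimately show ?thesis by simp
      next
        case False
        then obtain k where k: "n = 2 * Suc k" using \<open>n \<noteq> 0\<close> by (metis evenE mult_0_right not0_implies_Suc)
        have "(\<Sum>t\<in>{1..Suc k}. ?e t * (of_bool (n = 2 * t) * l (g ^ t) - of_bool (n = 2 * t + 2) * l (g ^ Suc t)))
          = (\<Sum>t\<in>{1..Suc k}. (if t = Suc k then (q + inverse q) * l (g ^ Suc k) else 0) - (if t = k then (inverse q + q) * l (g ^ Suc k) else 0))"
          by (intro sum.cong refl) (auto simp: k power_int_minus)
        also have "\<dots> = of_bool (n = 2) * ((q + inverse q) * l g)"
          by (cases k) (simp_all add: sum_subtractf k)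
        finally show ?thesis by (simp add: k)
      qed
      finally show ?thesis .
    qed
    then have "qnum q n * (\<Sum>i\<le>n. (-1) ^ i * c i (n - i) 0) = - (of_bool (n = 2) * ((q + inverse q) * l g))"
      using total by (simp add: add_eq_0_iff)
    also have "\<dots> = qnum q n * (- of_bool (n = 2) * l g)"
      using less.prems(4) by auto
    finally have "(\<Sum>i\<le>n. (-1) ^ i * c i (n - i) 0) = - of_bool (n = 2) * l g"
      by (rule mult_left_cancel[THEN iffD1, rotated]) (use less.prems(3)[of n] \<open>n \<noteq> 0\<close> in simp)
    then show ?thesis using \<open>n \<noteq> 0\<close> by (simp add: c_def)
  qed (simp add: a0 s0)
qed

section \<open>Computing in the quotient ring with representatives\<close>

context qm_data
begin

abbreviation A :: "'v entry_alg set ring" where "A \<equiv> qm_algebra R F"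
abbreviation cl :: "'v entry_alg \<Rightarrow> 'v entry_alg set" where "cl \<equiv> qm_class R F"

lemma ring_A: "ring A" by (rule ring_qm_algebra)

lemma cl_hom: "cl \<in> ring_hom free_ring A"
  using ideal.rcos_ring_hom[OF ideal_I] unfolding qm_algebra_def qm_class_def[abs_def] .

lemma cl_closed [simp]: "cl x \<in> carrier A"
  using ring_hom_closed[OF cl_hom, of x] by (simp add: free_ring_def)

lemma cl_add: "cl x \<oplus>\<^bsub>A\<^esub> cl y = cl (x + y)"
  and cl_mult: "cl x \<otimes>\<^bsub>A\<^esub> cl y = cl (x * y)"
  and cl_1: "\<one>\<^bsub>A\<^esub> = cl 1"
  using ring_hom_add[OF cl_hom, of x y] ring_hom_mult[OF cl_hom, of x y] ring_hom_one[OF cl_hom]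
  by (simp_all add: free_ring_def)

lemma cl_eqI: "x - y \<in> I \<Longrightarrow> cl x = cl y"
proof -
  assume "x - y \<in> I"
  moreover have "x \<ominus>\<^bsub>free_ring\<^esub> y = x - y"
  proof -
    have "\<ominus>\<^bsub>free_ring\<^esub> y = - y"
      by (rule abelian_group.minus_equality[OF ring.is_abelian_group[OF ring_free_ring]])
        (simp_all add: free_ring_def)
    then show ?thesis by (simp add: a_minus_def) (simp add: free_ring_def)
  qed
  ultimately show ?thesis
    using ring.quotient_eq_iff_same_a_r_cos[OF ring_free_ring ideal_I, of x y]
    by (simp add: qm_class_def) (simp add: free_ring_def)
qed

lemma cl_minus: "cl x \<ominus>\<^bsub>A\<^esub> cl y = cl (x - y)"
proof -
  interpret A: ring A by (rule ring_A)
  have "cl x = cl (x - y) \<oplus>\<^bsub>A\<^esub> cl y" by (simp add: cl_add)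
  then show ?thesis by (simp add: a_minus_def A.a_assoc A.r_neg)
qed

lemma cl_0: "\<zero>\<^bsub>A\<^esub> = cl 0"
  using cl_minus[of 0 0] abelian_group.r_neg[OF ring.is_abelian_group[OF ring_A] cl_closed, of 0]
  by (simp add: a_minus_def)

lemma cl_scale: "qm_scale R F c (cl x) = cl (scalar c * x)"
  by (simp add: qm_scale_def cl_mult)

lemma cl_sum: "finite S \<Longrightarrow> (\<Oplus>\<^bsub>A\<^esub>i\<in>S. cl (w i)) = cl (\<Sum>i\<in>S. w i)"
proof (induction S rule: finite_induct)
  case empty
  then show ?case
    by (simp add: abelian_monoid.finsum_empty[OF abelian_group.axioms(1)[OF ring.is_abelian_group[OF ring_A]]] cl_0)
next
  case (insert i S)
  then show ?case
    by (simp add: abelian_monoid.finsum_insert[OF abelian_group.axioms(1)[OF ring.is_abelian_group[OF ring_A]]] cl_add)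
qed

lemma cl_power: "cl x [^]\<^bsub>A\<^esub> (m :: nat) = cl (x ^ m)"
  by (induction m)
    (simp_all add: monoid.nat_pow_0[OF ring.is_monoid[OF ring_A]] monoid.nat_pow_Suc[OF ring.is_monoid[OF ring_A]]
      cl_1 cl_mult power_Suc2 del: power_Suc)

lemma separating_I: "(\<And>l. l \<in> separating I \<Longrightarrow> l x = 0) \<Longrightarrow> x \<in> I"
  by (rule separating_complete) (auto intro: I_0 I_add I_left)

lemma separating_closed: "l \<in> separating I \<Longrightarrow> (\<lambda>x. l (u * x * w)) \<in> separating I"
  using I_right[OF I_left, of _ u w]
  by (auto simp: separating_def distrib_left distrib_right scalar_left_commute mult.assoc)

end

lemma shift_d: "(shift ^^ n) (prod_list (map (act2 X) (rev [i..<k])))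
  = (prod_list (map (act2 X) (rev [n + i..<n + k])) :: ('v::finite, 'x) lop)"
proof -
  have "(shift ^^ n) (prod_list (map (act2 X) xs)) = prod_list (map (act2 X) (map ((+) n) xs) :: ('v, 'x) lop list)" for xs
    by (induction xs) (simp_all add: iterate_shift_mult iterate_shift_act2)
  moreover have "map ((+) n) (rev [i..<k]) = rev [n + i..<n + k]"
    by (induction k) auto
  ultimately show ?thesis by (simp only:)
qed

section \<open>Representatives of a_i, p_i and g in the free algebra\<close>

context qm_bmw
begin

definition tp :: "nat \<Rightarrow> 'v entry_alg" where "tp k = tau k (alg.d k 1)"
definition ta :: "nat \<Rightarrow> 'v entry_alg" where "ta k = tau k (alg.asym k)"
definition tg :: "'v entry_alg" where "tg = scalar (inverse alg.eta) * tau 2 (K 1)"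

lemma tau_0: "tau 0 1 = 1"
  by (simp add: tau_def app_simps)

lemma trace_tau: "l \<in> separating I \<Longrightarrow> alg.trace_on n (\<lambda>x. l (tau n x))"
  unfolding alg.trace_on_def
  using separating_diff[of l I] separating_zero[of l I] tau_cyc[of _ n]
  by (force simp: tau_add tau_scale separating_add separating_scale)

lemma ta_tp: "i < m \<Longrightarrow> ta i * tp (m - i) = tau m (alg.asym i * alg.d m (Suc i))"
proof -
  assume "i < m"
  then have "(shift ^^ i) (alg.d (m - i) 1) = alg.d m (Suc i)"
    by (simp add: alg.d_def shift_d)
  then show ?thesis
    using \<open>i < m\<close> unfolding ta_def tp_def by (simp add: tau_product alg.asym_B alg.d_B)
qed

text \<open>Membership of \<open>kp\<close> is part of the induction because
  \<open>tau_product\<close>, which appends one more g, asks for it.\<close>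

lemma ta_tg: "2 * t \<le> m \<Longrightarrow> ta (m - 2 * t) * tg ^ t = scalar (inverse alg.eta ^ t) * tau m (alg.asym (m - 2 * t) * alg.kp m t)
    \<and> alg.kp m t \<in> alg.B m"
proof (induction t arbitrary: m)
  case 0
  then show ?case by (simp add: ta_def alg.B_1)
next
  case (Suc t)
  then obtain n where m: "m = n + 2" and t: "2 * t \<le> n" by (intro that[of "m - 2"]) auto
  note IH = Suc.IH[OF t]
  have K1: "K 1 \<in> alg.B 2" by (auto intro: alg.B_k)
  have B: "alg.asym (n - 2 * t) * alg.kp n t \<in> alg.B n"
    using IH by (auto intro!: alg.B_intros)
  have sub: "m - 2 * Suc t = n - 2 * t" by (simp add: m)
  have "ta (m - 2 * Suc t) * tg ^ Suc t = (ta (n - 2 * t) * tg ^ t) * tg"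
    by (simp only: sub power_Suc2 mult.assoc)
  also have "\<dots> = scalar (inverse alg.eta ^ t) * (scalar (inverse alg.eta) * (tau n (alg.asym (n - 2 * t) * alg.kp n t) * tau 2 (K 1)))"
    unfolding IH[THEN conjunct1] unfolding tg_def
    by (simp only: mult.assoc scalar_left_commute[of "tau n (alg.asym (n - 2 * t) * alg.kp n t)" _ "tau 2 (K 1)"])
  also have "tau n (alg.asym (n - 2 * t) * alg.kp n t) * tau 2 (K 1) = tau m (alg.asym (n - 2 * t) * alg.kp n t * K (n + 1))"
    by (subst tau_product[OF B K1]) (simp add: m iterate_shift_act2)
  finally have "ta (m - 2 * Suc t) * tg ^ Suc t = scalar (inverse alg.eta ^ Suc t) * tau m (alg.asym (m - 2 * Suc t) * alg.kp m (Suc t))"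
    by (simp add: m mult.assoc mult.commute)
  moreover have "alg.kp m (Suc t) \<in> alg.B m"
    using IH by (auto simp: m intro!: alg.B_intros intro: alg.B_mono)
  ultimately show ?case by blast
qed

lemma newton_sep:
  assumes l: "l \<in> separating I" and def: "alg.asym_defined m"
  shows "(\<Sum>i<m. (- q) ^ i * l (ta i * tp (m - i))) = (-1) powi (int m - 1) * qnum q m * l (ta m)
    + (-1) ^ m * (\<Sum>t\<in>{1..m div 2}. (\<mu> * q powi (int m - 2 * int t) - q powi (1 - int m + 2 * int t)) * l (ta (m - 2 * t) * tg ^ t))"
proof -
  have "l (ta (m - 2 * t) * tg ^ t) = l (tau m (alg.asym (m - 2 * t) * alg.kp m t)) / alg.eta ^ t" if "t \<in> {1..m div 2}" for t
  proof -
    have "2 * t \<le> m" using that by auto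
    then show ?thesis
      by (simp add: ta_tg separating_scale[OF l] divide_inverse power_inverse)
  qed
  then show ?thesis
    using alg.newton_trace[OF trace_tau[OF l] def] by (simp add: ta_tp) (simp add: ta_def)
qed

lemma ev_kappa: "ev R (kappa q \<mu> i) = K i"
  by (simp add: kappa_def ev_mult ev_scalar ev_add ev_diff ev_sigma K_eq)

lemma strands_kappa: "1 \<le> i \<Longrightarrow> i < n \<Longrightarrow> strands n (kappa q \<mu> i)"
  unfolding kappa_def by (intro strands_mult strands_scalar strands_diff strands_add strands_sigma)

text \<open>The strand count is carried along since \<open>tau_ev\<close> requires it.\<close>

lemma antisym_asym: "ev R (antisym q \<mu> i) = alg.asym i \<and> (i \<le> n \<longrightarrow> strands n (antisym q \<mu> i))"
proof (induction i)
  case 0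
  then show ?case by (simp add: ev_1 strands_1)
next
  case (Suc i)
  have x: "q powi (- 2 * int i) = alg.xq i"
    by (simp add: alg.xq_def power_int_minus power_inverse flip: of_nat_mult power_int_of_nat)
      (metis mult_minus_left of_nat_mult of_nat_numeral power_int_minus power_int_of_nat power_inverse)
  have "ev R (sigma_minus q \<mu> i (alg.xq i)) = alg.sm i (alg.xq i)"
    by (simp add: sigma_minus_def alg.sm_def ev_add ev_1 ev_mult ev_scalar ev_sigma ev_kappa alg.lam_def add.commute)
  moreover have "strands n (sigma_minus q \<mu> i y)" if "Suc i \<le> n" "i \<noteq> 0" for y
    using that unfolding sigma_minus_def by (intro strands_add strands_1 strands_mult strands_scalar strands_sigma strands_kappa) auto
  ultimately show ?case using Suc x
    by (auto simp: mult.assoc alg.asym.simps(2) ev_1 strands_1 ev_mult ev_scalar intro!: strands_mult strands_scalar)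
qed

lemma elem_a_ta: "elem_a R F q \<mu> i = cl (ta i)"
  using antisym_asym[of i i]
  by (auto simp: elem_a_def ch_def ta_def tau_0 cl_1 simp flip: tau_ev)

lemma elem_p_tp: "1 \<le> i \<Longrightarrow> elem_p R F i = cl (tp i)"
proof (cases "i = 1")
  case True
  have "rep 1 (site1 M_mat 1) = MP 1 * 1"
    using rep_site1[of 1 1 M_mat] by simp
  then have "tau 1 1 = app (PTN (Suc 0) 1 (rep 1 (site1 M_mat 1))) (\<lambda>_. 1) undefined"
    by (simp only: tau_def)
  also have "\<dots> = R_trace R 1 (site1 M_mat 1)"
    by (simp only: PTN_R_trace app_Lmul mult_1_right)
  finally have "tau 1 1 = R_trace R 1 (site1 M_mat 1)" .
  then show ?thesis using True by (simp add: elem_p_def tp_def)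
next
  case False
  assume "1 \<le> i"
  have "ev R (prod_list (map sigma xs)) = prod_list (map r xs)" for xs
    by (induction xs) (simp_all add: ev_1 ev_mult ev_sigma)
  moreover have "(\<forall>j\<in>set xs. 1 \<le> j \<and> j < i) \<Longrightarrow> strands i (prod_list (map sigma xs))" for xs
    by (induction xs) (simp_all add: strands_1 strands_mult strands_sigma)
  ultimately show ?thesis using False
    by (auto simp: elem_p_def ch_def tp_def alg.d_def simp flip: tau_ev)
qed

lemma elem_g_tg: "elem_g R F q \<mu> = cl tg"
  using strands_kappa[of 1 2]
  by (simp add: elem_g_def ch_def tg_def cl_scale alg.eta_def alg.lam_def eta_def flip: tau_ev)
    (simp add: ev_kappa)

end

section \<open>The substitution of - 1/q for q\<close>

lemma qnum_minus_inverse: "q \<noteq> 0 \<Longrightarrow> qnum (- inverse q) m = - ((-1) ^ m * qnum q m)"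
proof -
  have "(- inverse q) ^ m - inverse (- inverse q) ^ m = - ((-1) ^ m * (q ^ m - inverse q ^ m))"
    by (simp add: power_minus[of "inverse q"] power_minus[of q] algebra_simps)
  moreover have "- inverse q - inverse (- inverse q) = q - inverse q" by simp
  ultimately show ?thesis unfolding qnum_def by (simp only: minus_divide_left times_divide_eq_right)
qed

lemma act2_inject:
  fixes X Y :: "'v::finite op2"
  assumes "act2 X 0 = (act2 Y 0 :: ('v, 'x) lop)"
  shows "X = Y"
proof -
  have "X $ (a, b) $ (c, d) = Y $ (a, b) $ (c, d)" for a b c d
  proof (rule scalar_inject)
    define z where "z = (\<lambda>k :: nat. if k = 0 then a else b)"
    have "app (act2 X 0) (\<lambda>y. of_bool (y 0 = c \<and> y 1 = d \<and> y 2 = b)) z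
      = app (act2 Y 0) (\<lambda>y. of_bool (y 0 = c \<and> y 1 = d \<and> y 2 = b) :: 'x free_algebra) z"
      using assms by simp
    then show "scalar (X $ (a, b) $ (c, d)) = (scalar (Y $ (a, b) $ (c, d)) :: 'x free_algebra)"
      unfolding app_act2_delta by (simp add: z_def)
  qed
  then show ?thesis by (simp add: vec_eq_iff)
qed

context qm_bmw
begin

text \<open>The two factors of K change places, each with a sign, and q - 1/q stays the
  same.\<close>

lemma K_op_dual: "K_op (- inverse q) \<mu> R = K_op q \<mu> R"
proof (rule act2_inject)
  have "(- inverse q \<odot> 1 - r 0) * (- q \<odot> 1 + r 0) = (q \<odot> 1 - r 0) * (inverse q \<odot> 1 + r 0)"
    by (simp add: algebra_simps)
  then show "act2 (K_op (- inverse q) \<mu> R) 0 = K 0"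
    by (simp add: K_op_def act2_mult act2_mat act2_add act2_diff)
qed

lemma dual: "qm_bmw R F (- inverse q) \<mu>"
proof unfold_locales
  show "- inverse q \<notin> {0, 1, -1}"
  proof
    assume "- inverse q \<in> {0, 1, -1}"
    moreover have "q = - inverse (- inverse q)" by simp
    ultimately show False using q by (metis (no_types, lifting) insert_iff empty_iff inverse_1
        inverse_zero inverse_minus_eq minus_zero add.inverse_inverse)
  qed
  show "\<mu> \<notin> {0, - inverse q, - inverse (- inverse q)}"
    using \<mu> by auto
  have "[:- (- inverse q), 1:] * [:inverse (- inverse q), 1:] * [:- \<mu>, 1:] = [:- q, 1:] * [:inverse q, 1:] * [:- \<mu>, 1:]"
    by (simp add: mult.commute)
  then show "BMW_type (- inverse q) \<mu> R"
    using BMW unfolding BMW_type_def K_op_dual by (simp only:)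
qed

lemma tg_dual: "qm_bmw.tg R F (- inverse q) \<mu> = tg"
proof -
  interpret Q: qm_bmw R F "- inverse q" \<mu> by (rule dual)
  have "(- inverse q - \<mu>) * (inverse (- inverse q) + \<mu>) = (q - \<mu>) * (inverse q + \<mu>)"
    "- inverse q - inverse (- inverse q) = q - inverse q"
    by (simp_all add: algebra_simps)
  then have "Q.alg.eta = alg.eta"
    unfolding Q.alg.eta_def Q.alg.lam_def alg.eta_def alg.lam_def by (simp only:)
  then show ?thesis by (simp add: Q.tg_def tg_def K_op_dual)
qed

text \<open>\<sigma>_i^+ is \<sigma>_i^- for the parameter - 1/q, so symmetrizers are
  antisymmetrizers for that parameter (\<open>symm_asym\<close>).\<close>

definition ts :: "nat \<Rightarrow> 'v entry_alg" where
  "ts k = qm_bmw.ta R F (- inverse q) \<mu> k"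

definition symm_defined :: "nat \<Rightarrow> bool" where
  "symm_defined n \<longleftrightarrow> (\<forall>j\<in>{1..<n}. qnum q (Suc j) \<noteq> 0 \<and> 1 - inverse q * inverse \<mu> * q ^ (2 * j) \<noteq> 0)"

lemma asym_defined_dual: "bmw.asym_defined (- inverse q) \<mu> n \<longleftrightarrow> symm_defined n"
proof -
  interpret Q: qm_bmw R F "- inverse q" \<mu> by (rule dual)
  have "q \<noteq> 0" using q by simp
  then show ?thesis
    by (simp add: Q.alg.asym_defined_def symm_defined_def Q.alg.wq_def Q.alg.xq_def qnum_minus_inverse power_mult)
qed

lemma newton_dual:
  assumes l: "l \<in> separating I" and def: "symm_defined m"
  shows "(\<Sum>i<m. q powi (- int i) * l (ts i * tp (m - i))) = qnum q m * l (ts m)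
    + (\<Sum>t\<in>{1..m div 2}. (\<mu> * q powi (2 * int t - int m) + q powi (int m - 2 * int t - 1)) * l (ts (m - 2 * t) * tg ^ t))"
proof -
  interpret Q: qm_bmw R F "- inverse q" \<mu> by (rule dual)
  have q0: "q \<noteq> 0" using q by simp
  have def': "Q.alg.asym_defined m" using def by (simp only: asym_defined_dual)
  have N: "(\<Sum>i<m. (- (- inverse q)) ^ i * l (ts i * tp (m - i))) = (-1) powi (int m - 1) * qnum (- inverse q) m * l (ts m)
    + (-1) ^ m * (\<Sum>t\<in>{1..m div 2}. (\<mu> * (- inverse q) powi (int m - 2 * int t) - (- inverse q) powi (1 - int m + 2 * int t))
      * l (ts (m - 2 * t) * tg ^ t))"
    unfolding ts_def by (rule Q.newton_sep[OF l def', unfolded tg_dual])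
  have 1: "(- (- inverse q)) ^ i = q powi (- int i)" for i
    by (simp add: power_int_minus power_inverse)
  have 2: "(-1) powi (int m - 1) * qnum (- inverse q) m = qnum q m"
    unfolding qnum_minus_inverse[OF q0] by (cases "even m") (simp_all add: power_int_minus_left)
  have neg: "(- inverse q) powi k = (-1) powi k * q powi (- k)" for k
    using power_int_mult_distrib[of "-1" "inverse q" k] by (simp add: power_int_inverse power_int_minus)
  \<comment> \<open>The exponents m - 2 t and 1 - m + 2 t have opposite parity, which turns the
    minus sign of (i) into the plus sign of (ii).\<close>
  have 3: "(-1) ^ m * (\<mu> * (- inverse q) powi (int m - 2 * int t) - (- inverse q) powi (1 - int m + 2 * int t))
    = \<mu> * q powi (2 * int t - int m) + q powi (int m - 2 * int t - 1)" for t
  proof -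
    have "(-1 :: complex) powi (int m - 2 * int t) = (-1) ^ m" "(-1 :: complex) powi (1 - int m + 2 * int t) = - ((-1) ^ m)"
      by (cases "even m"; simp add: power_int_minus_left)+
    moreover have "- (int m - 2 * int t) = 2 * int t - int m" "- (1 - int m + 2 * int t) = int m - 2 * int t - 1" by simp_all
    ultimately have "(-1) ^ m * (\<mu> * (- inverse q) powi (int m - 2 * int t) - (- inverse q) powi (1 - int m + 2 * int t))
      = (-1) ^ m * (\<mu> * ((-1) ^ m * q powi (2 * int t - int m)) - (- ((-1) ^ m)) * q powi (int m - 2 * int t - 1))"
      by (simp only: neg[of "int m - 2 * int t"] neg[of "1 - int m + 2 * int t"])
    also have "\<dots> = ((-1) ^ m * (-1) ^ m) * (\<mu> * q powi (2 * int t - int m) + q powi (int m - 2 * int t - 1))"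
      by (simp add: algebra_simps)
    also have "(-1 :: complex) ^ m * (-1) ^ m = 1" by (simp flip: power_mult_distrib)
    finally show ?thesis by simp
  qed
  have 4: "(-1) ^ m * (\<Sum>t\<in>{1..m div 2}. (\<mu> * (- inverse q) powi (int m - 2 * int t) - (- inverse q) powi (1 - int m + 2 * int t))
      * l (ts (m - 2 * t) * tg ^ t))
    = (\<Sum>t\<in>{1..m div 2}. (\<mu> * q powi (2 * int t - int m) + q powi (int m - 2 * int t - 1)) * l (ts (m - 2 * t) * tg ^ t))"
    unfolding sum_distrib_left by (intro sum.cong refl) (simp only: 3 flip: mult.assoc)
  show ?thesis
    using N by (simp only: 1 2 4)
qed

lemma symm_asym: "ev R (symm q \<mu> i) = bmw.asym lscale r K (- inverse q) \<mu> i \<and> (i \<le> n \<longrightarrow> strands n (symm q \<mu> i))"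
proof (induction i)
  case 0
  interpret Q: qm_bmw R F "- inverse q" \<mu> by (rule dual)
  show ?case using Q.alg.asym.simps(1) by (simp add: ev_1 strands_1 K_op_dual)
next
  case (Suc i)
  interpret Q: qm_bmw R F "- inverse q" \<mu> by (rule dual)
  have q0: "q \<noteq> 0" using q by simp
  have x: "Q.alg.xq i = q ^ (2 * i)"
    by (simp add: Q.alg.xq_def power_mult)
  have c: "(- inverse q) ^ i / qnum (- inverse q) (i + 1) = q powi (- int i) / qnum q (i + 1)"
    unfolding qnum_minus_inverse[OF q0] power_minus[of "inverse q"]
    by (simp add: power_int_minus power_inverse)
  have "ev R (sigma_plus q \<mu> i (q ^ (2 * i))) = bmw.sm lscale r K (- inverse q) \<mu> i (Q.alg.xq i)"
    unfolding x by (simp add: sigma_plus_def Q.alg.sm_def[unfolded K_op_dual] ev_add ev_1 ev_mult ev_scalar ev_sigma ev_kappa Q.alg.lam_def add.commute)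
  moreover have "strands n (sigma_plus q \<mu> i y)" if "Suc i \<le> n" "i \<noteq> 0" for y
    using that unfolding sigma_plus_def by (intro strands_add strands_1 strands_mult strands_scalar strands_sigma strands_kappa) auto
  ultimately show ?case using Suc c
    by (auto simp: mult.assoc Q.alg.asym.simps(2)[unfolded K_op_dual] ev_1 strands_1 ev_mult ev_scalar intro!: strands_mult strands_scalar)
qed

lemma elem_s_ts: "elem_s R F q \<mu> i = cl (ts i)"
proof -
  interpret Q: qm_bmw R F "- inverse q" \<mu> by (rule dual)
  have "ts i = tau i (ev R (symm q \<mu> i))"
    using symm_asym[of i i] by (simp add: ts_def Q.ta_def K_op_dual)
  then show ?thesis
    using symm_asym[of i i] by (auto simp: elem_s_def ch_def ev_1 tau_0 cl_1 simp flip: tau_ev)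
qed

lemma ts_B: "\<exists>x\<in>alg.B j. ts j = tau j x"
proof -
  interpret Q: qm_bmw R F "- inverse q" \<mu> by (rule dual)
  show ?thesis unfolding ts_def Q.ta_def using Q.alg.asym_B by blast
qed

lemma wronski_sep:
  assumes l: "l \<in> separating I" and def: "alg.asym_defined n" "symm_defined n"
  shows "(\<Sum>i\<le>n. (-1) ^ i * l (ta i * ts (n - i))) = of_bool (n = 0) * l 1 - of_bool (n = 2) * l tg"
proof (rule wronski_of_newton[where p = tp and \<mu> = \<mu> and q = q and L = "separating I"])
  have q0: "q \<noteq> 0" and lam: "q - inverse q \<noteq> 0" using alg.lam_nonzero q by (auto simp: alg.lam_def)
  show "q \<noteq> 0" by (rule q0)
  show "l \<in> separating I \<Longrightarrow> (\<lambda>x. l (u * x * v)) \<in> separating I" for l u v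
    by (rule separating_closed)
  show "l (ts j * ta i) = l (ta i * ts j)" if l: "l \<in> separating I" for l i j
  proof -
    obtain x where x: "x \<in> alg.B j" "ts j = tau j x" using ts_B by blast
    have "ts j * ta i - ta i * ts j \<in> I"
      unfolding x(2) ta_def by (rule tau_commute[OF x(1) alg.asym_B])
    then show ?thesis using separating_zero[OF l] separating_diff[OF l] by fastforce
  qed
  have mono: "alg.asym_defined m" "symm_defined m" if "m \<le> n" for m
    using def that by (auto simp: alg.asym_defined_def symm_defined_def)
  show "qnum q m \<noteq> 0" if "1 \<le> m" "m \<le> n" for m
  proof (cases "m = 1")
    case True
    then show ?thesis using lam by simp
  next
    case False
    then have "m - 1 \<in> {1..<n}" "Suc (m - 1) = m" using that by auto
    then show ?thesis using def(1) unfolding alg.asym_defined_def by metis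
  qed
  show "qnum q 2 = q + inverse q"
  proof -
    have "q ^ 2 - inverse q ^ 2 = (q + inverse q) * (q - inverse q)" by (simp add: power2_eq_square algebra_simps)
    then show ?thesis using lam by (simp add: qnum_def)
  qed
  show "ta 0 = 1" by (simp add: ta_def tau_0)
  show "ts 0 = 1"
  proof -
    interpret Q: qm_bmw R F "- inverse q" \<mu> by (rule dual)
    show ?thesis by (simp add: ts_def Q.ta_def tau_0)
  qed
  show "l \<in> separating I" by (rule l)
  fix l m assume lm: "l \<in> separating I" "m \<le> n"
  show "(\<Sum>i<m. (- q) ^ i * l (ta i * tp (m - i))) = (-1) powi (int m - 1) * qnum q m * l (ta m) + (-1) ^ m *
    (\<Sum>t\<in>{1..m div 2}. (\<mu> * q powi (int m - 2 * int t) - q powi (1 - int m + 2 * int t)) * l (ta (m - 2 * t) * tg ^ t))"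
    by (rule newton_sep[OF lm(1) mono(1)[OF lm(2)]])
  show "(\<Sum>i<m. q powi (- int i) * l (ts i * tp (m - i))) = qnum q m * l (ts m) +
    (\<Sum>t\<in>{1..m div 2}. (\<mu> * q powi (2 * int t - int m) + q powi (int m - 2 * int t - 1)) * l (ts (m - 2 * t) * tg ^ t))"
    by (rule newton_dual[OF lm(1) mono(2)[OF lm(2)]])
qed

end

theorem theorem6p1:
  fixes R F :: "'v::finite op2" and q \<mu> :: complex and n :: nat
  assumes "q \<notin> {0, 1, -1}"
    and "\<mu> \<notin> {0, q, - inverse q}"
    and "R_matrix R" and "strict_skew_invertible R"
    and "R_matrix F" and "strict_skew_invertible F"
    and "compatible R F"
    and "BMW_type q \<mu> R"
  shows
    "let A = qm_algebra R F; sc = qm_scale R F;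
         a = elem_a R F q \<mu>; s = elem_s R F q \<mu>; p = elem_p R F; g = elem_g R F q \<mu>;
         a_defined = (\<forall>j\<in>{2..n}. qnum q j \<noteq> 0 \<and> \<mu> \<noteq> - (q powi (- 2 * int j + 3)));
         s_defined = (\<forall>j\<in>{2..n}. qnum q j \<noteq> 0 \<and> \<mu> \<noteq> q powi (2 * int j - 3))
     in
       (a_defined \<longrightarrow>
          (\<Oplus>\<^bsub>A\<^esub>i\<in>{0..<n}. sc ((- q) ^ i) (a i \<otimes>\<^bsub>A\<^esub> p (n - i)))
          = sc ((-1) powi (int n - 1) * qnum q n) (a n)
            \<oplus>\<^bsub>A\<^esub> sc ((-1) ^ n)
                 (\<Oplus>\<^bsub>A\<^esub>i\<in>{1..n div 2}.
                    sc (\<mu> * q powi (int n - 2 * int i) - q powi (1 - int n + 2 * int i))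
                       (a (n - 2 * i) \<otimes>\<^bsub>A\<^esub> g [^]\<^bsub>A\<^esub> i))) \<and>
       (s_defined \<longrightarrow>
          (\<Oplus>\<^bsub>A\<^esub>i\<in>{0..<n}. sc (q powi (- int i)) (s i \<otimes>\<^bsub>A\<^esub> p (n - i)))
          = sc (qnum q n) (s n)
            \<oplus>\<^bsub>A\<^esub> (\<Oplus>\<^bsub>A\<^esub>i\<in>{1..n div 2}.
                    sc (\<mu> * q powi (2 * int i - int n) + q powi (int n - 2 * int i - 1))
                       (s (n - 2 * i) \<otimes>\<^bsub>A\<^esub> g [^]\<^bsub>A\<^esub> i))) \<and>
       (a_defined \<and> s_defined \<longrightarrow>
          (\<Oplus>\<^bsub>A\<^esub>i\<in>{0..n}. sc ((-1) ^ i) (a i \<otimes>\<^bsub>A\<^esub> s (n - i)))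
          = sc (of_bool (n = 0)) \<one>\<^bsub>A\<^esub> \<ominus>\<^bsub>A\<^esub> sc (of_bool (n = 2)) g)"
proof -
  interpret qm_bmw R F q \<mu>
    by unfold_locales (use assms in \<open>auto simp: strict_skew_invertible_def\<close>)
  have q0: "q \<noteq> 0" and m0: "\<mu> \<noteq> 0" using assms(1,2) by auto
  let ?a_defined = "\<forall>j\<in>{2..n}. qnum q j \<noteq> 0 \<and> \<mu> \<noteq> - (q powi (- 2 * int j + 3))"
  let ?s_defined = "\<forall>j\<in>{2..n}. qnum q j \<noteq> 0 \<and> \<mu> \<noteq> q powi (2 * int j - 3)"
  \<comment> \<open>\<mu> \<open>wq j\<close> is \<mu> + q^{1-2j}, so the condition for j + 1 in the
    theorem is the one for stage j of the recursion.\<close>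
  have adef: "alg.asym_defined n" if ?a_defined
    unfolding alg.asym_defined_def
  proof (intro ballI conjI)
    fix j assume j: "j \<in> {1..<n}"
    then have "Suc j \<in> {2..n}" by auto
    then have "qnum q (Suc j) \<noteq> 0" and mu: "\<mu> \<noteq> - (q powi (- 2 * int (Suc j) + 3))" using that by blast+
    then show "qnum q (Suc j) \<noteq> 0" by simp
    have "- 2 * int (Suc j) + 3 = 1 + - int (2 * j)" by simp
    moreover have "q powi (1 + - int (2 * j)) = q * alg.xq j"
      using q0 by (subst power_int_add) (auto simp: alg.xq_def power_int_minus power_inverse power_int_mult power_mult)
    ultimately have "\<mu> + q * alg.xq j \<noteq> 0" using mu by (simp add: add_eq_0_iff2)
    moreover have "\<mu> * alg.wq j = \<mu> + q * alg.xq j" using m0 by (simp add: alg.wq_def distrib_left)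
    ultimately show "alg.wq j \<noteq> 0" by auto
  qed
  have sdef: "symm_defined n" if ?s_defined
    unfolding symm_defined_def
  proof (intro ballI conjI)
    fix j assume j: "j \<in> {1..<n}"
    then have "Suc j \<in> {2..n}" by auto
    then have "qnum q (Suc j) \<noteq> 0" and mu: "\<mu> \<noteq> q powi (2 * int (Suc j) - 3)" using that by blast+
    then show "qnum q (Suc j) \<noteq> 0" by simp
    have "2 * int (Suc j) - 3 = int (2 * j) + - 1" by simp
    moreover have "q powi (int (2 * j) + - 1) = q ^ (2 * j) * inverse q"
      using q0 by (subst power_int_add) (auto simp: power_int_minus power_int_mult power_mult)
    ultimately have "\<mu> \<noteq> q ^ (2 * j) * inverse q" using mu by simp
    moreover have "\<mu> * (1 - inverse q * inverse \<mu> * q ^ (2 * j)) = \<mu> - q ^ (2 * j) * inverse q"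
      using m0 by (simp add: algebra_simps)
    ultimately show "1 - inverse q * inverse \<mu> * q ^ (2 * j) \<noteq> 0" by auto
  qed
  note sep = separating_sum separating_add separating_diff separating_scale
  have p: "elem_p R F (n - i) = cl (tp (n - i))" if "i < n" for i
    using that by (intro elem_p_tp) simp
  \<comment> \<open>Sums in \<open>A\<close> are compared only for terms in the carrier; the
    representatives \<open>v\<close> provide this.\<close>
  have fin_cong: "(\<Oplus>\<^bsub>A\<^esub>i\<in>S. w i) = (\<Oplus>\<^bsub>A\<^esub>i\<in>S. w' i)" if "\<And>i. i \<in> S \<Longrightarrow> w i = cl (v i)" "\<And>i. i \<in> S \<Longrightarrow> w' i = cl (v i)" for S w w' v
    using that by (intro abelian_monoid.finsum_cong'[OF abelian_group.axioms(1)[OF ring.is_abelian_group[OF ring_A]]]) auto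
  have i: "(\<Oplus>\<^bsub>A\<^esub>i\<in>{0..<n}. qm_scale R F ((- q) ^ i) (elem_a R F q \<mu> i \<otimes>\<^bsub>A\<^esub> elem_p R F (n - i)))
    = qm_scale R F ((-1) powi (int n - 1) * qnum q n) (elem_a R F q \<mu> n) \<oplus>\<^bsub>A\<^esub> qm_scale R F ((-1) ^ n)
      (\<Oplus>\<^bsub>A\<^esub>i\<in>{1..n div 2}. qm_scale R F (\<mu> * q powi (int n - 2 * int i) - q powi (1 - int n + 2 * int i))
        (elem_a R F q \<mu> (n - 2 * i) \<otimes>\<^bsub>A\<^esub> elem_g R F q \<mu> [^]\<^bsub>A\<^esub> i))" if ?a_defined
  proof -
    have "(\<Oplus>\<^bsub>A\<^esub>i\<in>{0..<n}. qm_scale R F ((- q) ^ i) (elem_a R F q \<mu> i \<otimes>\<^bsub>A\<^esub> elem_p R F (n - i)))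
      = (\<Oplus>\<^bsub>A\<^esub>i\<in>{0..<n}. cl (scalar ((- q) ^ i) * (ta i * tp (n - i))))"
      by (rule fin_cong) (simp_all add: elem_a_ta p cl_mult cl_scale)
    also have "\<dots> = cl (\<Sum>i\<in>{0..<n}. scalar ((- q) ^ i) * (ta i * tp (n - i)))"
      by (rule cl_sum) simp
    also have "\<dots> = cl (scalar ((-1) powi (int n - 1) * qnum q n) * ta n + scalar ((-1) ^ n) *
      (\<Sum>i\<in>{1..n div 2}. scalar (\<mu> * q powi (int n - 2 * int i) - q powi (1 - int n + 2 * int i)) * (ta (n - 2 * i) * tg ^ i)))"
    \<comment> \<open>Two representatives are equal in the quotient if all functionals that vanish
      on the ideal agree on them.\<close>
    proof (intro cl_eqI separating_I)
      fix l assume l: "l \<in> separating I"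
      show "l ((\<Sum>i\<in>{0..<n}. scalar ((- q) ^ i) * (ta i * tp (n - i))) -
        (scalar ((-1) powi (int n - 1) * qnum q n) * ta n + scalar ((-1) ^ n) *
        (\<Sum>i\<in>{1..n div 2}. scalar (\<mu> * q powi (int n - 2 * int i) - q powi (1 - int n + 2 * int i)) * (ta (n - 2 * i) * tg ^ i)))) = 0"
        unfolding sep[OF l] atLeast0LessThan newton_sep[OF l adef[OF that]] by simp
    qed
    finally show ?thesis
      by (simp add: elem_a_ta elem_g_tg cl_power cl_mult cl_scale cl_sum cl_add)
  qed
  have ii: "(\<Oplus>\<^bsub>A\<^esub>i\<in>{0..<n}. qm_scale R F (q powi (- int i)) (elem_s R F q \<mu> i \<otimes>\<^bsub>A\<^esub> elem_p R F (n - i)))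
    = qm_scale R F (qnum q n) (elem_s R F q \<mu> n) \<oplus>\<^bsub>A\<^esub>
      (\<Oplus>\<^bsub>A\<^esub>i\<in>{1..n div 2}. qm_scale R F (\<mu> * q powi (2 * int i - int n) + q powi (int n - 2 * int i - 1))
        (elem_s R F q \<mu> (n - 2 * i) \<otimes>\<^bsub>A\<^esub> elem_g R F q \<mu> [^]\<^bsub>A\<^esub> i))" if ?s_defined
  proof -
    have "(\<Oplus>\<^bsub>A\<^esub>i\<in>{0..<n}. qm_scale R F (q powi (- int i)) (elem_s R F q \<mu> i \<otimes>\<^bsub>A\<^esub> elem_p R F (n - i)))
      = (\<Oplus>\<^bsub>A\<^esub>i\<in>{0..<n}. cl (scalar (q powi (- int i)) * (ts i * tp (n - i))))"
      by (rule fin_cong) (simp_all add: elem_s_ts p cl_mult cl_scale)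
    also have "\<dots> = cl (\<Sum>i\<in>{0..<n}. scalar (q powi (- int i)) * (ts i * tp (n - i)))"
      by (rule cl_sum) simp
    also have "\<dots> = cl (scalar (qnum q n) * ts n +
      (\<Sum>i\<in>{1..n div 2}. scalar (\<mu> * q powi (2 * int i - int n) + q powi (int n - 2 * int i - 1)) * (ts (n - 2 * i) * tg ^ i)))"
    proof (intro cl_eqI separating_I)
      fix l assume l: "l \<in> separating I"
      show "l ((\<Sum>i\<in>{0..<n}. scalar (q powi (- int i)) * (ts i * tp (n - i))) - (scalar (qnum q n) * ts n +
        (\<Sum>i\<in>{1..n div 2}. scalar (\<mu> * q powi (2 * int i - int n) + q powi (int n - 2 * int i - 1)) * (ts (n - 2 * i) * tg ^ i)))) = 0"
        unfolding sep[OF l] atLeast0LessThan newton_dual[OF l sdef[OF that]] by simp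
    qed
    finally show ?thesis
      by (simp add: elem_s_ts elem_g_tg cl_power cl_mult cl_scale cl_sum cl_add)
  qed
  have iii: "(\<Oplus>\<^bsub>A\<^esub>i\<in>{0..n}. qm_scale R F ((-1) ^ i) (elem_a R F q \<mu> i \<otimes>\<^bsub>A\<^esub> elem_s R F q \<mu> (n - i)))
    = qm_scale R F (of_bool (n = 0)) \<one>\<^bsub>A\<^esub> \<ominus>\<^bsub>A\<^esub> qm_scale R F (of_bool (n = 2)) (elem_g R F q \<mu>)"
    if "?a_defined" "?s_defined"
  proof -
    have "(\<Oplus>\<^bsub>A\<^esub>i\<in>{0..n}. qm_scale R F ((-1) ^ i) (elem_a R F q \<mu> i \<otimes>\<^bsub>A\<^esub> elem_s R F q \<mu> (n - i)))
      = cl (\<Sum>i\<in>{0..n}. scalar ((-1) ^ i) * (ta i * ts (n - i)))"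
      by (simp add: elem_a_ta elem_s_ts cl_mult cl_scale cl_sum)
    also have "\<dots> = cl (scalar (of_bool (n = 0)) * 1 - scalar (of_bool (n = 2)) * tg)"
    proof (intro cl_eqI separating_I)
      fix l assume l: "l \<in> separating I"
      show "l ((\<Sum>i\<in>{0..n}. scalar ((-1) ^ i) * (ta i * ts (n - i))) - (scalar (of_bool (n = 0)) * 1 - scalar (of_bool (n = 2)) * tg)) = 0"
        unfolding sep[OF l] atLeast0AtMost wronski_sep[OF l adef[OF that(1)] sdef[OF that(2)]] by simp
    qed
    finally show ?thesis
      by (simp only: cl_1 cl_scale elem_g_tg cl_minus)
  qed
  show ?thesis
    unfolding Let_def using i ii iii by blast
qed

end
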